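(* Let $M$ be a connected manifold of dimension at least $2$, and let $F(x,\xi)=\sqrt{g(\xi,\xi)}+\omega(\xi)$ be a Randers metric on $M$, where $g$ is a Riemannian metric and $\omega$ is a $1$-form. If $\omega$ is not closed, then every projective transformation of $(M,F)$ is a homothety of the Riemannian metric $g$. In particular, if moreover $M$ is closed (compact and without boundary), then every projective transformation of $(M,F)$ is an isometry of the Riemannian metric $g$.
   Context: All objects considered (metrics, forms) are assumed to be at least $C^2$-smooth. A Randers metric on a manifold $M$ is a Finsler metric of the form $F(x,\xi)=\sqrt{g(x)_{ij}\xi^i\xi^j}+\omega(x)_i\xi^i=\sqrt{g(\xi,\xi)}+\omega(\xi)$, where $g$ is a Riemannian metric and $\omega$ is a $1$-form on $M$; that $F$ is a Finsler metric is equivalent to the $g$-norm of $\omega$ being less than one at every point. A forward geodesic of a Finsler metric $F$ is a regular curve $x:I\to M$ ($I$ an interval) such that for any sufficiently close $a,b\in I$, $a\le b$, the restriction of $x$ to $[a,b]$ is an extremal of the forward-length functional $L^+_F(c)=\int_a^b F(c(t),\dot c(t))\,dt$ in the set of all smooth curves $c:[a,b]\to M$ connecting $x(a)$ and $x(b)$. No preferred parameter is assumed: an orientation-preserving reparameterization of a forward geodesic is again a forward geodesic. Two Finsler metrics $F,\bar F$ on the same manifold are projectively equivalent if every forward geodesic of $F$ is a forward geodesic of $\bar F$. A projective transformation of $(M,F)$ is a diffeomorphism $\phi:M\to M$ such that the pullback $\phi^*F$, $(\phi^*F)(x,\xi)=F(\phi(x),d\phi_x(\xi))$, is projectively equivalent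 to $F$. A homothety of a (Finsler or Riemannian) metric is a diffeomorphism $\phi:M\to M$ such that the pullback of the metric is proportional to the metric with a constant positive coefficient; for a Riemannian metric $g$ this means $\phi^*g=\mathrm{const}\cdot g$. *)

theory Defs
  imports "HOL-Analysis.Analysis"
begin

section \<open>Maps of class \<open>C\<^sup>k\<close> between Euclidean spaces\<close>

text \<open>Meant for open domains.\<close>

fun Ck_on :: "nat \<Rightarrow> 'a::euclidean_space set \<Rightarrow> ('a \<Rightarrow> 'b::real_normed_vector) \<Rightarrow> bool" where
  "Ck_on 0 U f \<longleftrightarrow> continuous_on U f"
| "Ck_on (Suc k) U f \<longleftrightarrow> (\<forall>x\<in>U. f differentiable at x) \<and>
     (\<forall>v. Ck_on k U (\<lambda>x. frechet_derivative f (at x) v))"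

definition smooth_on :: "'a::euclidean_space set \<Rightarrow> ('a \<Rightarrow> 'b::real_normed_vector) \<Rightarrow> bool" where
  "smooth_on U f \<longleftrightarrow> (\<forall>k. Ck_on k U f)"


section \<open>Smooth manifolds\<close>

type_synonym ('a, 'e) chart = "'a set \<times> ('a \<Rightarrow> 'e)"

record ('a, 'e) manifold =
  mtop :: "'a topology"
  atlas :: "('a, 'e) chart set"

abbreviation points :: "('a, 'e) manifold \<Rightarrow> 'a set" where
  "points M \<equiv> topspace (mtop M)"

definition is_chart :: "'a topology \<Rightarrow> ('a, 'e::euclidean_space) chart \<Rightarrow> bool" where
  "is_chart X c \<longleftrightarrow> openin X (fst c) \<and> open (snd c ` fst c) \<and>
     homeomorphic_map (subtopology X (fst c)) (top_of_set (snd c ` fst c)) (snd c)"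

definition cinv :: "('a, 'e) chart \<Rightarrow> 'e \<Rightarrow> 'a" where
  "cinv c = inv_into (fst c) (snd c)"

definition smooth_manifold :: "('a, 'e::euclidean_space) manifold \<Rightarrow> bool" where
  "smooth_manifold M \<longleftrightarrow>
     Hausdorff_space (mtop M) \<and> second_countable (mtop M) \<and>
     (\<forall>c\<in>atlas M. is_chart (mtop M) c) \<and>
     (\<Union>c\<in>atlas M. fst c) = points M \<and>
     (\<forall>c\<in>atlas M. \<forall>d\<in>atlas M. smooth_on (snd c ` (fst c \<inter> fst d)) (snd d \<circ> cinv c))"

definition charts_at :: "('a, 'e) manifold \<Rightarrow> 'a \<Rightarrow> ('a, 'e) chart set" where
  "charts_at M p = {c \<in> atlas M. p \<in> fst c}"


section \<open>Tangent vectors\<close>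

text \<open>
  A tangent vector at \<open>p\<close> is the family of its coordinate vectors in all charts around \<open>p\<close>,
  related by the differentials of the coordinate changes; the entries at all other indices are 0.
  The vector space operations are the pointwise ones.
\<close>

type_synonym ('a, 'e) tvector = "('a, 'e) chart \<Rightarrow> 'e"

definition tangent_space ::
    "('a, 'e::euclidean_space) manifold \<Rightarrow> 'a \<Rightarrow> ('a, 'e) tvector set" where
  "tangent_space M p = {\<xi>.
     (\<forall>c. c \<notin> charts_at M p \<longrightarrow> \<xi> c = 0) \<and>
     (\<forall>c\<in>charts_at M p. \<forall>d\<in>charts_at M p.
        \<xi> d = frechet_derivative (snd d \<circ> cinv c) (at (snd c p)) (\<xi> c))}"

definition tzero :: "('a, 'e::euclidean_space) tvector" where
  "tzero = (\<lambda>c. 0)"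

definition tadd ::
    "('a, 'e::euclidean_space) tvector \<Rightarrow> ('a, 'e) tvector \<Rightarrow> ('a, 'e) tvector" where
  "tadd \<xi> \<eta> = (\<lambda>c. \<xi> c + \<eta> c)"

definition tscale :: "real \<Rightarrow> ('a, 'e::euclidean_space) tvector \<Rightarrow> ('a, 'e) tvector" where
  "tscale r \<xi> = (\<lambda>c. r *\<^sub>R \<xi> c)"

text \<open>The tangent vector at \<open>p\<close> whose coordinate vector in the chart \<open>c\<close> is \<open>u\<close>.\<close>

definition tvec ::
    "('a, 'e::euclidean_space) manifold \<Rightarrow> ('a, 'e) chart \<Rightarrow> 'a \<Rightarrow> 'e \<Rightarrow> ('a, 'e) tvector" where
  "tvec M c p u = (\<lambda>d. if d \<in> charts_at M p
     then frechet_derivative (snd d \<circ> cinv c) (at (snd c p)) u else 0)"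


section \<open>Diffeomorphisms and their differentials\<close>

definition smooth_map :: "('a, 'e::euclidean_space) manifold \<Rightarrow> ('a \<Rightarrow> 'a) \<Rightarrow> bool" where
  "smooth_map M \<phi> \<longleftrightarrow> continuous_map (mtop M) (mtop M) \<phi> \<and>
     (\<forall>c\<in>atlas M. \<forall>d\<in>atlas M.
        smooth_on (snd c ` {p \<in> fst c. \<phi> p \<in> fst d}) (snd d \<circ> \<phi> \<circ> cinv c))"

definition diffeomorphism :: "('a, 'e::euclidean_space) manifold \<Rightarrow> ('a \<Rightarrow> 'a) \<Rightarrow> bool" where
  "diffeomorphism M \<phi> \<longleftrightarrow> bij_betw \<phi> (points M) (points M) \<and>
     smooth_map M \<phi> \<and> smooth_map M (inv_into (points M) \<phi>)"

text \<open>By the chain rule the choice of the chart \<open>c\<close> around \<open>p\<close> is irrelevant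
  for \<open>\<xi> \<in> tangent_space M p\<close>.\<close>

definition differential ::
    "('a, 'e::euclidean_space) manifold \<Rightarrow> ('a \<Rightarrow> 'a) \<Rightarrow> 'a \<Rightarrow> ('a, 'e) tvector \<Rightarrow> ('a, 'e) tvector"
  where
  "differential M \<phi> p \<xi> = (\<lambda>d. if d \<in> charts_at M (\<phi> p)
     then (let c = (SOME c. c \<in> charts_at M p)
           in frechet_derivative (snd d \<circ> \<phi> \<circ> cinv c) (at (snd c p)) (\<xi> c))
     else 0)"


section \<open>Riemannian metrics, 1-forms, Finsler and Randers metrics\<close>

type_synonym ('a, 'e) bilinear_field = "'a \<Rightarrow> ('a, 'e) tvector \<Rightarrow> ('a, 'e) tvector \<Rightarrow> real"
type_synonym ('a, 'e) covector_field = "'a \<Rightarrow> ('a, 'e) tvector \<Rightarrow> real"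
type_synonym ('a, 'e) finsler_function = "'a \<Rightarrow> ('a, 'e) tvector \<Rightarrow> real"

text \<open>Local expressions in a chart \<open>c\<close>, as functions of the coordinates \<open>x \<in> snd c ` fst c\<close>
  and of coordinate vectors.\<close>

definition bilinear_coords ::
    "('a, 'e::euclidean_space) manifold \<Rightarrow> ('a, 'e) bilinear_field \<Rightarrow> ('a, 'e) chart \<Rightarrow>
     'e \<Rightarrow> 'e \<Rightarrow> 'e \<Rightarrow> real" where
  "bilinear_coords M g c x u v =
     g (cinv c x) (tvec M c (cinv c x) u) (tvec M c (cinv c x) v)"

definition fiber_coords ::
    "('a, 'e::euclidean_space) manifold \<Rightarrow> ('a \<Rightarrow> ('a, 'e) tvector \<Rightarrow> real) \<Rightarrow> ('a, 'e) chart \<Rightarrow>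
     'e \<Rightarrow> 'e \<Rightarrow> real" where
  "fiber_coords M F c x u = F (cinv c x) (tvec M c (cinv c x) u)"

definition linear_at ::
    "('a, 'e::euclidean_space) manifold \<Rightarrow> 'a \<Rightarrow> (('a, 'e) tvector \<Rightarrow> real) \<Rightarrow> bool" where
  "linear_at M p l \<longleftrightarrow>
     (\<forall>\<xi>\<in>tangent_space M p. \<forall>\<eta>\<in>tangent_space M p. l (tadd \<xi> \<eta>) = l \<xi> + l \<eta>) \<and>
     (\<forall>r. \<forall>\<xi>\<in>tangent_space M p. l (tscale r \<xi>) = r * l \<xi>)"

definition riemannian_metric ::
    "('a, 'e::euclidean_space) manifold \<Rightarrow> ('a, 'e) bilinear_field \<Rightarrow> bool" where
  "riemannian_metric M g \<longleftrightarrow>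
     (\<forall>p\<in>points M.
        (\<forall>\<eta>\<in>tangent_space M p. linear_at M p (\<lambda>\<xi>. g p \<xi> \<eta>)) \<and>
        (\<forall>\<xi>\<in>tangent_space M p. \<forall>\<eta>\<in>tangent_space M p. g p \<xi> \<eta> = g p \<eta> \<xi>) \<and>
        (\<forall>\<xi>\<in>tangent_space M p. \<xi> \<noteq> tzero \<longrightarrow> g p \<xi> \<xi> > 0)) \<and>
     (\<forall>c\<in>atlas M. \<forall>u v. Ck_on 2 (snd c ` fst c) (\<lambda>x. bilinear_coords M g c x u v))"

definition one_form ::
    "('a, 'e::euclidean_space) manifold \<Rightarrow> ('a, 'e) covector_field \<Rightarrow> bool" where
  "one_form M \<omega> \<longleftrightarrow>
     (\<forall>p\<in>points M. linear_at M p (\<omega> p)) \<and>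
     (\<forall>c\<in>atlas M. \<forall>u. Ck_on 2 (snd c ` fst c) (\<lambda>x. fiber_coords M \<omega> c x u))"

text \<open>The exterior derivative \<open>d\<omega>\<close> in the chart \<open>c\<close>, evaluated on constant vector
  fields \<open>u\<close>, \<open>v\<close>: \<open>\<partial>\<^sub>u (\<omega> v) - \<partial>\<^sub>v (\<omega> u)\<close>.\<close>

definition ext_deriv_coords ::
    "('a, 'e::euclidean_space) manifold \<Rightarrow> ('a, 'e) covector_field \<Rightarrow> ('a, 'e) chart \<Rightarrow>
     'e \<Rightarrow> 'e \<Rightarrow> 'e \<Rightarrow> real" where
  "ext_deriv_coords M \<omega> c x u v =
     frechet_derivative (\<lambda>y. fiber_coords M \<omega> c y v) (at x) u -
     frechet_derivative (\<lambda>y. fiber_coords M \<omega> c y u) (at x) v"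

definition closed_form ::
    "('a, 'e::euclidean_space) manifold \<Rightarrow> ('a, 'e) covector_field \<Rightarrow> bool" where
  "closed_form M \<omega> \<longleftrightarrow>
     (\<forall>c\<in>atlas M. \<forall>x\<in>snd c ` fst c. \<forall>u v. ext_deriv_coords M \<omega> c x u v = 0)"

text \<open>The last condition of the pointwise part is positive definiteness of the fundamental
  tensor, i.e. of the Hessian of \<open>F\<^sup>2\<close> restricted to a tangent space, off the origin.\<close>

definition finsler_metric ::
    "('a, 'e::euclidean_space) manifold \<Rightarrow> ('a, 'e) finsler_function \<Rightarrow> bool" where
  "finsler_metric M F \<longleftrightarrow>
     (\<forall>p\<in>points M.
        (\<forall>r\<ge>0. \<forall>\<xi>\<in>tangent_space M p. F p (tscale r \<xi>) = r * F p \<xi>) \<and>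
        (\<forall>\<xi>\<in>tangent_space M p. \<xi> \<noteq> tzero \<longrightarrow> F p \<xi> > 0) \<and>
        (\<forall>\<xi>\<in>tangent_space M p. \<forall>\<eta>\<in>tangent_space M p. \<xi> \<noteq> tzero \<longrightarrow> \<eta> \<noteq> tzero \<longrightarrow>
           (deriv ^^ 2) (\<lambda>t. (F p (tadd \<xi> (tscale t \<eta>)))\<^sup>2) 0 > 0)) \<and>
     (\<forall>c\<in>atlas M. Ck_on 2 ((snd c ` fst c) \<times> (- {0})) (\<lambda>(x, u). fiber_coords M F c x u))"

definition randers_function ::
    "('a, 'e) bilinear_field \<Rightarrow> ('a, 'e) covector_field \<Rightarrow> ('a, 'e) finsler_function" where
  "randers_function g \<omega> = (\<lambda>p \<xi>. sqrt (g p \<xi> \<xi>) + \<omega> p \<xi>)"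

definition pullback_finsler ::
    "('a, 'e::euclidean_space) manifold \<Rightarrow> ('a \<Rightarrow> 'a) \<Rightarrow> ('a, 'e) finsler_function \<Rightarrow>
     ('a, 'e) finsler_function" where
  "pullback_finsler M \<phi> F = (\<lambda>p \<xi>. F (\<phi> p) (differential M \<phi> p \<xi>))"

definition pullback_bilinear ::
    "('a, 'e::euclidean_space) manifold \<Rightarrow> ('a \<Rightarrow> 'a) \<Rightarrow> ('a, 'e) bilinear_field \<Rightarrow>
     ('a, 'e) bilinear_field" where
  "pullback_bilinear M \<phi> g =
     (\<lambda>p \<xi> \<eta>. g (\<phi> p) (differential M \<phi> p \<xi>) (differential M \<phi> p \<eta>))"


section \<open>Curves, forward length and forward geodesics\<close>

text \<open>A manifold-valued map on an arbitrary subset \<open>S\<close> of a Euclidean space is of class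
  \<open>C\<^sup>k\<close> if in charts it locally extends to a \<open>C\<^sup>k\<close> map on an open set. This covers
  intervals with end points, where it amounts to the use of one-sided derivatives.\<close>

definition Ck_into ::
    "nat \<Rightarrow> ('a, 'e::euclidean_space) manifold \<Rightarrow> 'd::euclidean_space set \<Rightarrow> ('d \<Rightarrow> 'a) \<Rightarrow> bool"
  where
  "Ck_into k M S f \<longleftrightarrow> (\<forall>z\<in>S. f z \<in> points M) \<and>
     (\<forall>z\<in>S. \<forall>c\<in>charts_at M (f z). \<exists>N h. open N \<and> z \<in> N \<and> f ` (N \<inter> S) \<subseteq> fst c \<and>
        Ck_on k N h \<and> (\<forall>y\<in>N \<inter> S. h y = snd c (f y)))"

definition velocity ::
    "('a, 'e::euclidean_space) manifold \<Rightarrow> real set \<Rightarrow> (real \<Rightarrow> 'a) \<Rightarrow> real \<Rightarrow> ('a, 'e) tvector"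
  where
  "velocity M I \<gamma> t = (\<lambda>c. if c \<in> charts_at M (\<gamma> t)
     then vector_derivative (snd c \<circ> \<gamma>) (at t within I) else 0)"

definition forward_length ::
    "('a, 'e::euclidean_space) manifold \<Rightarrow> ('a, 'e) finsler_function \<Rightarrow> real \<Rightarrow> real \<Rightarrow>
     (real \<Rightarrow> 'a) \<Rightarrow> real" where
  "forward_length M F a b \<gamma> = integral {a..b} (\<lambda>t. F (\<gamma> t) (velocity M {a..b} \<gamma> t))"

definition fixed_end_variation ::
    "('a, 'e::euclidean_space) manifold \<Rightarrow> real \<Rightarrow> real \<Rightarrow> (real \<Rightarrow> 'a) \<Rightarrow> real \<Rightarrow>
     (real \<Rightarrow> real \<Rightarrow> 'a) \<Rightarrow> bool" where
  "fixed_end_variation M a b \<gamma> \<epsilon> H \<longleftrightarrow>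
     Ck_into 2 M ({-\<epsilon><..<\<epsilon>} \<times> {a..b}) (\<lambda>(s, t). H s t) \<and>
     (\<forall>t\<in>{a..b}. H 0 t = \<gamma> t) \<and>
     (\<forall>s\<in>{-\<epsilon><..<\<epsilon>}. H s a = \<gamma> a \<and> H s b = \<gamma> b)"

text \<open>Extremals are the stationary points of the length functional: the first variation vanishes
  for all variations with fixed end points. Curves and variations are of class \<open>C\<^sup>2\<close>, since
  geodesics of a \<open>C\<^sup>2\<close> metric need not be of class \<open>C\<^sup>\<infinity>\<close> in any parametrization.\<close>

definition extremal ::
    "('a, 'e::euclidean_space) manifold \<Rightarrow> ('a, 'e) finsler_function \<Rightarrow> real \<Rightarrow> real \<Rightarrow>
     (real \<Rightarrow> 'a) \<Rightarrow> bool" where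
  "extremal M F a b \<gamma> \<longleftrightarrow>
     (\<forall>\<epsilon>>0. \<forall>H. fixed_end_variation M a b \<gamma> \<epsilon> H \<longrightarrow>
        ((\<lambda>s. forward_length M F a b (H s)) has_real_derivative 0) (at 0))"

definition regular_curve ::
    "('a, 'e::euclidean_space) manifold \<Rightarrow> real set \<Rightarrow> (real \<Rightarrow> 'a) \<Rightarrow> bool" where
  "regular_curve M I \<gamma> \<longleftrightarrow> Ck_into 2 M I \<gamma> \<and> (\<forall>t\<in>I. velocity M I \<gamma> t \<noteq> tzero)"

definition forward_geodesic ::
    "('a, 'e::euclidean_space) manifold \<Rightarrow> ('a, 'e) finsler_function \<Rightarrow> real set \<Rightarrow>
     (real \<Rightarrow> 'a) \<Rightarrow> bool" where
  "forward_geodesic M F I \<gamma> \<longleftrightarrow>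
     is_interval I \<and> (\<exists>a\<in>I. \<exists>b\<in>I. a < b) \<and> regular_curve M I \<gamma> \<and>
     (\<forall>t\<in>I. \<exists>\<delta>>0. \<forall>a\<in>I. \<forall>b\<in>I.
        a \<le> b \<and> \<bar>a - t\<bar> < \<delta> \<and> \<bar>b - t\<bar> < \<delta> \<longrightarrow> extremal M F a b \<gamma>)"


section \<open>Projective transformations, homotheties, isometries\<close>

definition projectively_equivalent ::
    "('a, 'e::euclidean_space) manifold \<Rightarrow> ('a, 'e) finsler_function \<Rightarrow>
     ('a, 'e) finsler_function \<Rightarrow> bool" where
  "projectively_equivalent M F F' \<longleftrightarrow>
     (\<forall>I \<gamma>. forward_geodesic M F I \<gamma> \<longrightarrow> forward_geodesic M F' I \<gamma>)"

definition projective_transformation ::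
    "('a, 'e::euclidean_space) manifold \<Rightarrow> ('a, 'e) finsler_function \<Rightarrow> ('a \<Rightarrow> 'a) \<Rightarrow> bool" where
  "projective_transformation M F \<phi> \<longleftrightarrow>
     diffeomorphism M \<phi> \<and> projectively_equivalent M (pullback_finsler M \<phi> F) F"

definition homothety ::
    "('a, 'e::euclidean_space) manifold \<Rightarrow> ('a, 'e) bilinear_field \<Rightarrow> ('a \<Rightarrow> 'a) \<Rightarrow> bool" where
  "homothety M g \<phi> \<longleftrightarrow> diffeomorphism M \<phi> \<and>
     (\<exists>k>0. \<forall>p\<in>points M. \<forall>\<xi>\<in>tangent_space M p. \<forall>\<eta>\<in>tangent_space M p.
        pullback_bilinear M \<phi> g p \<xi> \<eta> = k * g p \<xi> \<eta>)"

definition isometry ::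
    "('a, 'e::euclidean_space) manifold \<Rightarrow> ('a, 'e) bilinear_field \<Rightarrow> ('a \<Rightarrow> 'a) \<Rightarrow> bool" where
  "isometry M g \<phi> \<longleftrightarrow> diffeomorphism M \<phi> \<and>
     (\<forall>p\<in>points M. \<forall>\<xi>\<in>tangent_space M p. \<forall>\<eta>\<in>tangent_space M p.
        pullback_bilinear M \<phi> g p \<xi> \<eta> = g p \<xi> \<eta>)"

end

theory Submission
  imports Defs
begin

text \<open>
  Let \<open>\<phi>\<close> be a projective transformation and put \<open>g' = \<phi>\<^sup>*g\<close>, \<open>\<omega>' = \<phi>\<^sup>*\<omega>\<close>. In a chart, the
  Euler-Lagrange equation of \<open>sqrt (g(v,v)) + \<omega>(v)\<close> in a parametrization of constant speed \<open>\<nu>\<close> is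
  the magnetic geodesic equation \<open>x'' = \<nu> J x' - \<Gamma>(x',x')\<close>, where \<open>g(J v, w) = d\<omega>(w, v)\<close>; in any
  other parametrization the acceleration changes by a multiple of the velocity
  (\<open>euler_lagrange_acc\<close>, \<open>acc_of_euler_lagrange\<close>). With \<open>\<nu>\<close> as a constant the equation has local
  solutions through every point in every direction (\<open>magnetic_geodesics_exist\<close>), and since the
  magnetic force does no work their speed is constant (\<open>speed_conserved\<close>). The first variation
  formula identifies the solutions, up to parametrization, with the forward geodesics
  (\<open>forward_geodesic_of_euler_lagrange\<close>, \<open>euler_lagrange_of_extremal\<close>). Hence, for all \<open>v \<noteq> 0\<close>, the
  accelerations of the two metrics agree up to a multiple of \<open>v\<close>
  (\<open>projective_randers_data_chart\<close>).

  Comparing \<open>v\<close> with \<open>- v\<close> splits this relation (\<open>odd_even_parts\<close>): the odd part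
  \<open>|v| J v - |v|' J' v\<close> and the even part \<open>(\<Gamma> - \<Gamma>')(v,v)\<close> are both multiples of \<open>v\<close>. The odd part is
  used where \<open>d\<omega> \<noteq> 0\<close>. There it expresses \<open>g(v,v) / g'(v,v)\<close> as the square of a rational function
  of \<open>v\<close>; as both quadratic forms are definite, this is possible only if they are proportional
  (\<open>conformal_of_odd_parts\<close>). So \<open>g' = f g\<close> near the point.

  The even part holds everywhere and says that the Levi-Civita connections differ by a tensor
  \<open>\<psi> \<otimes> Id + Id \<otimes> \<psi>\<close>. Traces identify \<open>\<psi>\<close> with a multiple of \<open>d \<theta>\<close>, where
  \<open>\<theta> = ln (det g' / det g)\<close>, and \<open>exp (- 2 \<theta> / (n + 1)) g'\<close> turns out to be a Killing tensor of
  \<open>g\<close>: it is constant on the velocities of \<open>g\<close>-geodesics (\<open>killing_identity\<close>). For \<open>g' = f g\<close> and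
  \<open>n \<ge> 2\<close> this makes \<open>f\<close> a constant \<open>k\<close> (\<open>conformal_factor_constant\<close>). Transporting the conserved
  quantity along geodesics that enter the region where \<open>g' = k g\<close> extends this equality across
  the boundary of the region (\<open>proportionality_unique_continuation\<close>), and by connectedness it holds
  on all of \<open>M\<close> (\<open>proportional_everywhere\<close>): \<open>\<phi>\<close> is a homothety.

  For \<open>g' = k g\<close> the odd part gives \<open>\<phi>\<^sup>*d\<omega> = sqrt k d\<omega>\<close>, hence the \<open>g\<close>-norm of \<open>d\<omega>\<close> at \<open>\<phi> p\<close> is
  \<open>1 / sqrt k\<close> times its norm at \<open>p\<close>. On a compact manifold this norm is bounded, and it is not
  identically zero. Since \<open>\<phi>\<close> is a bijection, \<open>k = 1\<close> (\<open>homothety_constant_of_compact\<close>).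
\<close>

section \<open>Calculus of maps of class \<open>C\<^sup>k\<close>\<close>

lemma frechet_derivative_cong_open:
  assumes "open U" "x \<in> U" "\<And>y. y \<in> U \<Longrightarrow> f y = g y"
  shows "frechet_derivative f (at x) = frechet_derivative g (at x)"
proof -
  have "(f has_derivative D) (at x) \<longleftrightarrow> (g has_derivative D) (at x)" for D
    using assms by (metis has_derivative_transform_within_open)
  then show ?thesis by (simp add: frechet_derivative_def)
qed

lemma differentiable_cong_open:
  assumes "open U" "x \<in> U" "\<And>y. y \<in> U \<Longrightarrow> f y = g y"
  shows "f differentiable at x \<longleftrightarrow> g differentiable at x"
  using assms unfolding differentiable_def by (metis has_derivative_transform_within_open)

lemma Ck_on_cong:
  assumes "open U" "\<And>y. y \<in> U \<Longrightarrow> f y = g y"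
  shows "Ck_on k U f \<longleftrightarrow> Ck_on k U g"
  using assms(2)
proof (induction k arbitrary: f g)
  case 0
  then show ?case using continuous_on_cong by fastforce
next
  case (Suc k)
  have "Ck_on k U (\<lambda>x. frechet_derivative f (at x) v) \<longleftrightarrow>
        Ck_on k U (\<lambda>x. frechet_derivative g (at x) v)" for v
    by (rule Suc.IH) (metis Suc.prems assms(1) frechet_derivative_cong_open)
  then show ?case
    using differentiable_cong_open[OF assms(1) _ Suc.prems] by auto
qed

lemma Ck_on_subset: "Ck_on k U f \<Longrightarrow> V \<subseteq> U \<Longrightarrow> Ck_on k V f"
proof (induction k arbitrary: f)
  case (Suc k) then show ?case by (simp only: Ck_on.simps) blast
qed (auto intro: continuous_on_subset)

lemma Ck_on_continuous: "Ck_on k U f \<Longrightarrow> continuous_on U f"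
  by (cases k) (auto intro!: differentiable_imp_continuous_on
      simp: differentiable_on_def differentiable_at_withinI)

lemma Ck_on_SucD: "Ck_on (Suc k) U f \<Longrightarrow> Ck_on k U f"
proof (induction k arbitrary: f)
  case 0 then show ?case by (metis Ck_on.simps(1) Ck_on_continuous)
next
  case (Suc k) then show ?case by (simp only: Ck_on.simps(2)) blast
qed

lemma Ck_on_has_derivative:
  "Ck_on (Suc k) U f \<Longrightarrow> x \<in> U \<Longrightarrow> (f has_derivative frechet_derivative f (at x)) (at x)"
  by (simp add: frechet_derivative_works)

text \<open>Any explicit formula for the derivative may take the place of \<open>frechet_derivative\<close>.\<close>

lemma Ck_on_SucI:
  assumes "open U" "\<And>x. x \<in> U \<Longrightarrow> (f has_derivative f' x) (at x)"
    "\<And>v. Ck_on k U (\<lambda>x. f' x v)"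
  shows "Ck_on (Suc k) U f"
proof -
  have eq: "frechet_derivative f (at x) = f' x" if "x \<in> U" for x
    using assms(2) that by (metis frechet_derivative_at)
  have "Ck_on k U (\<lambda>x. frechet_derivative f (at x) v)" for v
    using assms(3)[of v] by (subst Ck_on_cong[OF assms(1)]) (auto simp: eq)
  then show ?thesis using assms(2) by (auto simp: differentiable_def)
qed

lemma Ck_on_const: "open U \<Longrightarrow> Ck_on k U (\<lambda>x. c)"
proof (induction k arbitrary: c)
  case (Suc k) then show ?case by (intro Ck_on_SucI[where f'="\<lambda>x v. 0"]) auto
qed auto

lemma Ck_on_bounded_linear: "open U \<Longrightarrow> bounded_linear l \<Longrightarrow> Ck_on k U l"
proof (cases k)
  case (Suc j)
  assume "open U" "bounded_linear l"
  then show ?thesis unfolding Suc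
    by (intro Ck_on_SucI[where f'="\<lambda>x. l"]) (auto intro: bounded_linear_imp_has_derivative Ck_on_const)
qed (auto intro: linear_continuous_on)

lemma Ck_on_linear_comp:
  assumes "open U" "bounded_linear l" "Ck_on k U f"
  shows "Ck_on k U (\<lambda>x. l (f x))"
  using assms(3)
proof (induction k arbitrary: f)
  case 0 then show ?case
    using bounded_linear.continuous_on[OF assms(2)] by auto
next
  case (Suc k)
  show ?case
    by (rule Ck_on_SucI[OF assms(1) bounded_linear.has_derivative[OF assms(2)]])
      (use Suc Ck_on_has_derivative[OF Suc.prems] in auto)
qed

lemma Ck_on_add: "open U \<Longrightarrow> Ck_on k U f \<Longrightarrow> Ck_on k U g \<Longrightarrow> Ck_on k U (\<lambda>x. f x + g x)"
proof (induction k arbitrary: f g)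
  case (Suc k)
  show ?case
  proof (rule Ck_on_SucI[OF Suc.prems(1)])
    show "((\<lambda>x. f x + g x) has_derivative
        (\<lambda>v. frechet_derivative f (at x) v + frechet_derivative g (at x) v)) (at x)" if "x \<in> U" for x
      by (intro has_derivative_add Ck_on_has_derivative[OF Suc.prems(2) that]
          Ck_on_has_derivative[OF Suc.prems(3) that])
  qed (use Suc in auto)
qed (auto intro: continuous_intros)

lemma Ck_on_sum:
  "open U \<Longrightarrow> (\<And>i. i \<in> A \<Longrightarrow> Ck_on k U (f i)) \<Longrightarrow> Ck_on k U (\<lambda>x. \<Sum>i\<in>A. f i x)"
  by (induction A rule: infinite_finite_induct) (auto intro: Ck_on_add Ck_on_const)

lemma Ck_on_scaleR:
  fixes a :: "_ \<Rightarrow> real"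
  shows "open U \<Longrightarrow> Ck_on k U a \<Longrightarrow> Ck_on k U f \<Longrightarrow> Ck_on k U (\<lambda>x. a x *\<^sub>R f x)"
proof (induction k arbitrary: a f)
  case (Suc k)
  note lower = Ck_on_SucD[OF Suc.prems(2)] Ck_on_SucD[OF Suc.prems(3)]
  show ?case
  proof (rule Ck_on_SucI[OF Suc.prems(1)])
    show "((\<lambda>x. a x *\<^sub>R f x) has_derivative (\<lambda>v. a x *\<^sub>R frechet_derivative f (at x) v
        + frechet_derivative a (at x) v *\<^sub>R f x)) (at x)" if "x \<in> U" for x
      by (intro has_derivative_scaleR Ck_on_has_derivative[OF Suc.prems(2) that]
          Ck_on_has_derivative[OF Suc.prems(3) that])
  qed (use Suc.IH Suc.prems lower in \<open>auto intro!: Ck_on_add\<close>)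
qed (auto intro: continuous_intros)

lemma Ck_on_mult:
  fixes a b :: "_ \<Rightarrow> real"
  shows "open U \<Longrightarrow> Ck_on k U a \<Longrightarrow> Ck_on k U b \<Longrightarrow> Ck_on k U (\<lambda>x. a x * b x)"
  using Ck_on_scaleR[of U k a b] by simp

lemma linear_euclidean_expansion:
  fixes l :: "'a::euclidean_space \<Rightarrow> 'b::real_vector"
  assumes "linear l"
  shows "l v = (\<Sum>i\<in>Basis. (v \<bullet> i) *\<^sub>R l i)"
proof -
  have "l v = l (\<Sum>i\<in>Basis. (v \<bullet> i) *\<^sub>R i)" by (simp add: euclidean_representation)
  also have "\<dots> = (\<Sum>i\<in>Basis. (v \<bullet> i) *\<^sub>R l i)"
    by (simp add: linear_sum[OF assms] linear_scale[OF assms])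
  finally show ?thesis .
qed

text \<open>Expanding the chain rule in an orthonormal basis reduces the induction step to sums and
  products of maps of lower class.\<close>

lemma Ck_on_compose:
  fixes g :: "'b::euclidean_space \<Rightarrow> 'c::real_normed_vector" and f :: "'a::euclidean_space \<Rightarrow> 'b"
  assumes "open U" "open V" "f ` U \<subseteq> V" "Ck_on k V g" "Ck_on k U f"
  shows "Ck_on k U (\<lambda>x. g (f x))"
  using assms(4,5)
proof (induction k arbitrary: g)
  case 0 then show ?case using assms(3) by (auto intro: continuous_on_compose2)
next
  case (Suc k)
  let ?Dg = "\<lambda>y. frechet_derivative g (at y)" and ?Df = "\<lambda>x. frechet_derivative f (at x)"
  have f: "Ck_on k U f" using Suc.prems(2) by (rule Ck_on_SucD)
  have dg: "(g has_derivative ?Dg (f x)) (at (f x))" if "x \<in> U" for x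
    using Ck_on_has_derivative[OF Suc.prems(1)] that assms(3) by blast
  have d: "((\<lambda>x. g (f x)) has_derivative (\<lambda>v. \<Sum>i\<in>Basis. (?Df x v \<bullet> i) *\<^sub>R ?Dg (f x) i)) (at x)"
    if "x \<in> U" for x
  proof -
    have "((\<lambda>x. g (f x)) has_derivative (\<lambda>v. ?Dg (f x) (?Df x v))) (at x)"
      by (rule has_derivative_compose[OF Ck_on_has_derivative[OF Suc.prems(2) that] dg[OF that]])
    moreover have "linear (?Dg (f x))" using dg[OF that] by (simp add: has_derivative_linear)
    ultimately show ?thesis by (subst linear_euclidean_expansion[symmetric])
  qed
  have c: "Ck_on k U (\<lambda>x. ?Dg (f x) i)" for i
    by (rule Suc.IH) (use Suc.prems f in auto)
  have "Ck_on k U (\<lambda>x. ?Df x v \<bullet> i)" for v i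
    by (rule Ck_on_linear_comp[OF assms(1) bounded_linear_inner_left]) (use Suc.prems in auto)
  then show ?case
    by (intro Ck_on_SucI[OF assms(1) d] Ck_on_sum Ck_on_scaleR c assms(1)) auto
qed

lemma smooth_on_imp_Ck_on: "smooth_on U f \<Longrightarrow> Ck_on k U f"
  by (simp add: smooth_on_def)

lemma Ck_on_one_lipschitz:
  fixes f :: "'a::euclidean_space \<Rightarrow> real"
  assumes "Ck_on (Suc k) U f" "compact K" "convex K" "K \<subseteq> U"
  shows "\<exists>L. L-lipschitz_on K f"
proof -
  let ?D = "\<lambda>x. frechet_derivative f (at x)"
  have c: "continuous_on K (\<lambda>x. ?D x v)" for v
    using assms(1,4) Ck_on_continuous[of k U "\<lambda>x. ?D x v"] continuous_on_subset by auto
  have "\<exists>B\<ge>0. \<forall>x\<in>K. norm (?D x v) \<le> B" for v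
  proof -
    obtain B where "\<forall>y\<in>(\<lambda>x. ?D x v) ` K. norm y \<le> B"
      using compact_imp_bounded[OF compact_continuous_image[OF c assms(2)]]
      unfolding bounded_iff by blast
    then show ?thesis by (intro exI[of _ "\<bar>B\<bar>"]) force
  qed
  then obtain B where B: "\<And>v. B v \<ge> 0" "\<And>v x. x \<in> K \<Longrightarrow> norm (?D x v) \<le> B v" by metis
  define L where "L = (\<Sum>i\<in>(Basis::'a set). B i)"
  have "onorm (?D x) \<le> L" if "x \<in> K" for x
  proof (rule onorm_le)
    fix v
    have lin: "linear (?D x)"
      using Ck_on_has_derivative[OF assms(1)] that assms(4) by (blast intro: has_derivative_linear)
    have "norm (?D x v) \<le> (\<Sum>i\<in>Basis. norm ((v \<bullet> i) *\<^sub>R ?D x i))"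
      by (subst linear_euclidean_expansion[OF lin]) (rule norm_sum)
    also have "\<dots> \<le> (\<Sum>i\<in>Basis. norm v * B i)"
      using B(2)[OF that] B(1) by (intro sum_mono) (auto simp: abs_mult intro!: mult_mono Basis_le_norm)
    finally show "norm (?D x v) \<le> L * norm v" by (simp add: L_def sum_distrib_left mult.commute)
  qed
  moreover have "(f has_derivative ?D x) (at x within K)" if "x \<in> K" for x
    using Ck_on_has_derivative[OF assms(1)] that assms(4) by (blast intro: has_derivative_at_withinI)
  ultimately have "norm (f x - f y) \<le> L * norm (x - y)" if "x \<in> K" "y \<in> K" for x y
    using assms(3) that by (intro differentiable_bound[where S=K and f'="?D"])
  moreover have "L \<ge> 0" by (simp add: L_def B sum_nonneg)
  ultimately have "L-lipschitz_on K f"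
    by (intro lipschitz_onI) (auto simp: dist_norm)
  then show ?thesis ..
qed

text \<open>
  Write \<open>D\<^sub>v h\<close> along the line in direction \<open>u\<close> as an integral of \<open>\<partial>\<^sub>v \<partial>\<^sub>u h\<close>, by differentiating
  \<open>h (p + s v + t u) - h (p + s v) = \<integral> D\<^sub>u h\<close> in \<open>s\<close> under the integral sign; the derivative in
  \<open>t\<close> at 0 is then \<open>\<partial>\<^sub>v \<partial>\<^sub>u h\<close> by the fundamental theorem and \<open>\<partial>\<^sub>u \<partial>\<^sub>v h\<close> by definition.
\<close>

lemma mixed_partials_commute:
  fixes h :: "'a::euclidean_space \<Rightarrow> 'b::euclidean_space"
  assumes N: "open N" "p \<in> N" and h: "Ck_on 2 N h"
  shows "frechet_derivative (\<lambda>y. frechet_derivative h (at y) u) (at p) v =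
         frechet_derivative (\<lambda>y. frechet_derivative h (at y) v) (at p) u"
proof -
  define D where "D = (\<lambda>w y. frechet_derivative h (at y) w)"
  define E where "E = (\<lambda>w w' y. frechet_derivative (D w) (at y) w')"
  have dh: "(h has_derivative (\<lambda>w. D w y)) (at y)" if "y \<in> N" for y
    using Ck_on_has_derivative[of 1 N h y] h that by (simp add: D_def numeral_2_eq_2)
  have dD: "(D w has_derivative (\<lambda>w'. E w w' y)) (at y)" if "y \<in> N" for y w
    using Ck_on_has_derivative[of 0 N "D w" y] h that by (simp add: D_def E_def numeral_2_eq_2)
  have cE: "continuous_on N (E w w')" for w w'
    using h by (simp add: D_def E_def numeral_2_eq_2)
  have linD: "linear (\<lambda>w. D w y)" and linE: "linear (\<lambda>w'. E w w' y)" if "y \<in> N" for y w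
    using dh dD that by (blast intro: has_derivative_linear)+
  have scD: "D (k *\<^sub>R w) y = k *\<^sub>R D w y" and scE: "E w' (k *\<^sub>R w) y = k *\<^sub>R E w' w y"
    if "y \<in> N" for y k w w'
    using linear_scale[OF linD[OF that]] linear_scale[OF linE[OF that]] by auto
  obtain e where e: "e > 0" "ball p e \<subseteq> N" using N open_contains_ball by blast
  \<comment> \<open>the parallelogram \<open>p + s v + t u\<close> with \<open>|s|, |t| \<le> r\<close> lies in \<open>N\<close>\<close>
  define r where "r = e / (2 * (norm u + norm v + 1))"
  have r: "r > 0" using e by (simp add: r_def add_nonneg_pos)
  have inN: "p + s *\<^sub>R v + t *\<^sub>R u \<in> N" if "\<bar>s\<bar> \<le> r" "\<bar>t\<bar> \<le> r" for s t
  proof -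
    have "norm (s *\<^sub>R v + t *\<^sub>R u) \<le> \<bar>s\<bar> * norm v + \<bar>t\<bar> * norm u"
      using norm_triangle_ineq[of "s *\<^sub>R v" "t *\<^sub>R u"] by simp
    also have "\<dots> \<le> r * (norm u + norm v + 1)"
      using that r mult_right_mono[of "\<bar>s\<bar>" r "norm v"] mult_right_mono[of "\<bar>t\<bar>" r "norm u"]
      by (simp add: algebra_simps)
    also have "\<dots> = e / 2" unfolding r_def
      using add_nonneg_pos[of "norm u + norm v" 1] by (simp add: field_simps)
    finally have "norm (s *\<^sub>R v + t *\<^sub>R u) < e" using e by simp
    then have "p + s *\<^sub>R v + t *\<^sub>R u \<in> ball p e"
      by (simp add: dist_norm norm_minus_cancel[of "s *\<^sub>R v + t *\<^sub>R u", symmetric] add.assoc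
          del: norm_minus_cancel)
    then show ?thesis using e by blast
  qed
  define P where "P = (\<lambda>s t. p + s *\<^sub>R v + t *\<^sub>R u)"
  have Pt: "((\<lambda>t. P s t) has_derivative (\<lambda>k. k *\<^sub>R u)) (at t within S)" for s t S
    unfolding P_def by (auto intro!: derivative_eq_intros)
  have Ps: "((\<lambda>s. P s t) has_derivative (\<lambda>k. k *\<^sub>R v)) (at s within S)" for s t S
    unfolding P_def by (auto intro!: derivative_eq_intros)
  have PN: "P s t \<in> N" if "\<bar>s\<bar> \<le> r" "\<bar>t\<bar> \<le> r" for s t using inN that by (simp add: P_def)
  have cont: "continuous_on ({-r..r} \<times> {0..t}) (\<lambda>(s, t). E u v (P s t))" if "t \<le> r" for t
    unfolding split_beta using that PN
    by (intro continuous_on_compose2[OF cE]) (auto simp: P_def intro!: continuous_intros)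
  have i: "((\<lambda>\<tau>. D u (P s \<tau>)) has_integral (h (P s t) - h (P s 0))) {0..t}"
    if "\<bar>s\<bar> \<le> r" "0 \<le> t" "t \<le> r" for s t
  proof (rule fundamental_theorem_of_calculus[OF that(2)])
    fix \<tau> assume "\<tau> \<in> {0..t}"
    then have "P s \<tau> \<in> N" using that by (intro PN) auto
    from has_derivative_compose[OF Pt dh[OF this]]
    show "((\<lambda>t. h (P s t)) has_vector_derivative D u (P s \<tau>)) (at \<tau> within {0..t})"
      using scD[OF \<open>P s \<tau> \<in> N\<close>] by (simp add: has_vector_derivative_def)
  qed
  have dvP: "((\<lambda>s. h (P s t)) has_vector_derivative D v (P 0 t)) (at 0 within {-r..r})"
    if "0 \<le> t" "t \<le> r" for t
    using has_derivative_compose[OF Ps dh[OF PN], of 0 t] scD[OF PN, of 0 t] that r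
    by (simp add: has_vector_derivative_def)
  have key: "integral {0..t} (\<lambda>\<tau>. E u v (P 0 \<tau>)) = D v (P 0 t) - D v (P 0 0)"
    if t: "0 \<le> t" "t \<le> r" for t
  proof -
    have "((\<lambda>s. integral (cbox 0 t) (\<lambda>\<tau>. D u (P s \<tau>))) has_vector_derivative
       integral (cbox 0 t) (\<lambda>\<tau>. E u v (P 0 \<tau>))) (at 0 within {-r..r})"
    proof (rule leibniz_rule_vector_derivative)
      show "((\<lambda>x. D u (P x \<tau>)) has_vector_derivative E u v (P s \<tau>)) (at s within {-r..r})"
        if "s \<in> {-r..r}" "\<tau> \<in> cbox 0 t" for s \<tau>
        using has_derivative_compose[OF Ps dD[OF PN], of s \<tau>] scE[OF PN, of s \<tau>] that t
        by (auto simp add: has_vector_derivative_def)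
      show "(\<lambda>\<tau>. D u (P s \<tau>)) integrable_on cbox 0 t" if "s \<in> {-r..r}" for s
        using i[of s t] that t by (auto simp: abs_le_iff intro: has_integral_integrable)
    qed (use r t cont in auto)
    moreover have "((\<lambda>s. integral (cbox 0 t) (\<lambda>\<tau>. D u (P s \<tau>))) has_vector_derivative
        D v (P 0 t) - D v (P 0 0)) (at 0 within {-r..r})"
    proof (rule has_vector_derivative_transform[rotated 2])
      show "((\<lambda>s. h (P s t) - h (P s 0)) has_vector_derivative D v (P 0 t) - D v (P 0 0))
          (at 0 within {-r..r})"
        using dvP[of t] dvP[of 0] t r by (intro has_vector_derivative_diff) auto
      show "0 \<in> {-r..r}" using r by auto
      show "integral (cbox 0 t) (\<lambda>\<tau>. D u (P s \<tau>)) = h (P s t) - h (P s 0)" if "s \<in> {-r..r}" for s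
        using i[of s t] t that by (auto intro: integral_unique)
    qed
    ultimately show ?thesis
      using vector_derivative_unique_within[of 0 "{-r..r}"] r
      by (auto simp: trivial_limit_within islimpt_Icc)
  qed
  have "((\<lambda>t. integral {0..t} (\<lambda>\<tau>. E u v (P 0 \<tau>))) has_vector_derivative E u v (P 0 0)) (at 0 within {0..r})"
    using cont[of r] r
    by (intro integral_has_vector_derivative continuous_on_compose2[OF cE] PN)
      (auto simp: P_def intro!: continuous_intros inN[of 0, simplified])
  moreover have "((\<lambda>t. integral {0..t} (\<lambda>\<tau>. E u v (P 0 \<tau>))) has_vector_derivative E v u (P 0 0)) (at 0 within {0..r})"
  proof (rule has_vector_derivative_transform[rotated 2])
    have "((\<lambda>t. D v (P 0 t)) has_vector_derivative E v u (P 0 0)) (at 0 within {0..r})"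
      using has_derivative_compose[OF Pt dD[OF PN], of 0 0] scE[OF PN, of 0 0] r
      by (simp add: has_vector_derivative_def)
    then show "((\<lambda>t. D v (P 0 t) - D v (P 0 0)) has_vector_derivative E v u (P 0 0)) (at 0 within {0..r})"
      by (simp add: has_vector_derivative_diff_const)
  qed (use key r in auto)
  ultimately have "E u v (P 0 0) = E v u (P 0 0)"
    using vector_derivative_unique_within[of 0 "{0..r}"] r
    by (auto simp: trivial_limit_within islimpt_Icc)
  then show ?thesis by (simp add: P_def E_def D_def)
qed


section \<open>Local solutions of ordinary differential equations\<close>

text \<open>The solution is the fixed point of the integral operator. Curves on \<open>[0, \<tau>]\<close> are continued by
  constants to the real line, so that those with values in the ball form a closed subset of the
  complete space of bounded continuous functions. The interval depends on the bounds for \<open>f\<close>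
  only.\<close>

lemma picard_lindelof:
  fixes f :: "'a::euclidean_space \<Rightarrow> 'a"
  assumes "R > 0" "L \<ge> 0" "\<tau> > 0" "\<tau> * M \<le> R" "\<tau> * L < 1"
    and lip: "L-lipschitz_on (cball z0 R) f"
    and bd: "\<And>z. z \<in> cball z0 R \<Longrightarrow> norm (f z) \<le> M"
  shows "\<exists>z. z 0 = z0 \<and> (\<forall>t\<in>{0..\<tau>}. z t \<in> cball z0 R \<and>
           (z has_vector_derivative f (z t)) (at t within {0..\<tau>}))"
proof -
  define S where "S = PiC (UNIV :: real set) (\<lambda>_. cball z0 R)"
  define P where "P = (\<lambda>(z :: real \<Rightarrow>\<^sub>C 'a) t. z0 + integral {0..t} (\<lambda>s. f (apply_bcontfun z s)))"
  have inS: "z t \<in> cball z0 R" if "z \<in> S" for z and t :: real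
    using that by (auto simp: S_def mem_PiC_iff)
  have fz: "continuous_on T (\<lambda>s. f (apply_bcontfun z s))" if "z \<in> S" for z T
    using lipschitz_on_continuous_on[OF lip] inS[OF that]
    by (intro continuous_on_compose2[of "cball z0 R" f T "apply_bcontfun z"]) auto
  have int: "(\<lambda>s. f (apply_bcontfun z s)) integrable_on {0..t}" if "z \<in> S" for z t
    using fz[OF that] by (rule integrable_continuous_interval)
  have "M \<ge> 0" using order_trans[OF norm_ge_zero bd[of z0]] assms(1) by simp
  have Pc: "continuous_on (cbox 0 \<tau>) (P z)" if "z \<in> S" for z
    unfolding P_def using int[OF that] by (auto intro!: continuous_intros indefinite_integral_continuous_1)
  have "\<exists>g. \<forall>t. apply_bcontfun g t = P z (clamp 0 \<tau> t)" if "z \<in> S" for z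
    by (rule continuous_on_cbox_bcontfunE[OF Pc[OF that]]) blast
  then obtain T where T: "\<And>z t. z \<in> S \<Longrightarrow> apply_bcontfun (T z) t = P z (clamp 0 \<tau> t)" by metis
  have cl: "clamp 0 \<tau> t \<in> {0..\<tau>}" for t :: real
    using clamp_in_interval[of 0 \<tau> t] assms(3) by simp
  have "\<exists>!z. z \<in> S \<and> T z = z"
  proof (rule Banach_fix)
    show "complete S" unfolding S_def
      by (rule complete_eq_closed[THEN iffD2, OF closed_PiC]) auto
    show "S \<noteq> {}"
    proof -
      have "const_bcontfun z0 \<in> S" using assms(1) by (auto simp: S_def mem_PiC_iff const_bcontfun.rep_eq)
      then show ?thesis by blast
    qed
    show "0 \<le> \<tau> * L" "\<tau> * L < 1" using assms by auto
    show "T ` S \<subseteq> S"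
    proof clarify
      fix z assume z: "z \<in> S"
      have "dist z0 (P z t) \<le> R" if "t \<in> {0..\<tau>}" for t
      proof -
        have "norm (integral {0..t} (\<lambda>s. f (apply_bcontfun z s))) \<le> M * (t - 0)"
          using that fz[OF z] bd inS[OF z] by (intro integral_bound) auto
        also have "\<dots> \<le> R" using that assms(4) \<open>M \<ge> 0\<close> mult_left_mono[of t \<tau> M] by (auto simp: mult.commute)
        finally show ?thesis by (simp add: P_def dist_norm)
      qed
      then show "T z \<in> S" using cl by (auto simp: S_def mem_PiC_iff T[OF z])
    qed
    fix y z assume yz: "y \<in> S" "z \<in> S"
    have "dist (P y t) (P z t) \<le> \<tau> * L * dist y z" if "t \<in> {0..\<tau>}" for t
    proof -
      have "dist (P y t) (P z t) = norm (integral {0..t} (\<lambda>s. f (apply_bcontfun y s) - f (apply_bcontfun z s)))"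
        using yz int by (simp add: P_def dist_norm integral_diff)
      also have "\<dots> \<le> (L * dist y z) * (t - 0)"
      proof (rule integral_bound)
        fix s
        have "norm (f (apply_bcontfun y s) - f (apply_bcontfun z s)) \<le> L * dist (apply_bcontfun y s) (apply_bcontfun z s)"
          using lipschitz_onD[OF lip inS inS] yz by (simp add: dist_norm)
        also have "\<dots> \<le> L * dist y z" using assms(2) by (intro mult_left_mono dist_bounded)
        finally show "norm (f (apply_bcontfun y s) - f (apply_bcontfun z s)) \<le> L * dist y z" .
      qed (use that yz fz in \<open>auto intro!: continuous_intros\<close>)
      also have "\<dots> \<le> \<tau> * L * dist y z"
        using that assms(2) mult_right_mono[of t \<tau> "L * dist y z"] by (auto simp: mult_ac)
      finally show ?thesis .
    qed
    then show "dist (T y) (T z) \<le> \<tau> * L * dist y z"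
      using cl yz by (intro dist_bound) (auto simp: T)
  qed
  then obtain z where z: "z \<in> S" "T z = z" by blast
  have zP: "apply_bcontfun z t = P z t" if "t \<in> {0..\<tau>}" for t
    using T[OF z(1), of t] z(2) that clamp_cancel_cbox[of t 0 \<tau>] by simp
  have "(apply_bcontfun z has_vector_derivative f (apply_bcontfun z t)) (at t within {0..\<tau>})" if "t \<in> {0..\<tau>}" for t
  proof (rule has_vector_derivative_transform[OF that zP])
    have "((\<lambda>u. integral {0..u} (\<lambda>s. f (apply_bcontfun z s))) has_vector_derivative f (apply_bcontfun z t)) (at t within {0..\<tau>})"
      by (rule integral_has_vector_derivative[OF fz[OF z(1)] that])
    then show "(P z has_vector_derivative f (apply_bcontfun z t)) (at t within {0..\<tau>})"
      unfolding P_def by (auto intro!: derivative_eq_intros)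
  qed
  moreover have "apply_bcontfun z 0 = z0" using zP[of 0] assms(3) by (simp add: P_def)
  ultimately show ?thesis using inS[OF z(1)] by blast
qed

section \<open>Linear algebra of positive definite forms\<close>

definition inner_form :: "('e::euclidean_space \<Rightarrow> 'e \<Rightarrow> real) \<Rightarrow> bool" where
  "inner_form B \<longleftrightarrow> (\<forall>v. linear (\<lambda>u. B u v)) \<and> (\<forall>u v. B u v = B v u) \<and> (\<forall>u. u \<noteq> 0 \<longrightarrow> B u u > 0)"

text \<open>Raising an index: the vector that represents the linear form \<open>l\<close>.\<close>

definition riesz :: "('e::euclidean_space \<Rightarrow> 'e \<Rightarrow> real) \<Rightarrow> ('e \<Rightarrow> real) \<Rightarrow> 'e" where
  "riesz B l = (THE c. \<forall>w. B c w = l w)"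

context
  fixes B :: "'e::euclidean_space \<Rightarrow> 'e \<Rightarrow> real"
  assumes B: "inner_form B"
begin

lemma form_sym: "B u v = B v u" and form_pos: "u \<noteq> 0 \<Longrightarrow> B u u > 0"
  and form_linear: "linear (\<lambda>u. B u v)"
  using B by (auto simp: inner_form_def)

lemma form_linear2: "linear (B u)"
  using form_linear[of u] form_sym[of u] by (metis (no_types, lifting) ext)

lemma form_simps:
  "B (a + b) v = B a v + B b v" "B v (a + b) = B v a + B v b"
  "B (a - b) v = B a v - B b v" "B v (a - b) = B v a - B v b"
  "B (r *\<^sub>R a) v = r * B a v" "B v (r *\<^sub>R a) = r * B v a"
  "B (- a) v = - B a v" "B v (- a) = - B v a" "B 0 v = 0" "B v 0 = 0"
  using linear_add[OF form_linear] linear_add[OF form_linear2] linear_diff[OF form_linear]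
    linear_diff[OF form_linear2] linear_cmul[OF form_linear] linear_cmul[OF form_linear2]
    linear_neg[OF form_linear] linear_neg[OF form_linear2] linear_0[OF form_linear]
    linear_0[OF form_linear2] by auto

lemma form_eq_0: "B u u = 0 \<longleftrightarrow> u = 0"
  using form_pos[of u] by (force simp: form_simps)

lemma form_nonneg: "B u u \<ge> 0"
  using form_pos[of u] by (cases "u = 0") (auto simp: form_simps)

lemma form_unique: "(\<And>w. B c w = B d w) \<Longrightarrow> c = d"
  using form_eq_0[of "c - d"] by (simp add: form_simps)

text \<open>An injective linear map of a Euclidean space into itself is surjective.\<close>

lemma form_riesz: assumes "linear l" shows "B (riesz B l) w = l w"
proof -
  define M where "M = (\<lambda>u. \<Sum>b\<in>Basis. B u b *\<^sub>R b)"
  have lin: "linear M" unfolding M_def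
    by (intro linear_compose_sum ballI) (auto intro!: linearI simp: form_simps algebra_simps)
  have M: "M u \<bullet> w = B u w" for u w
    using linear_euclidean_expansion[OF form_linear2, of u w]
    by (simp add: M_def inner_sum_left inner_sum_right inner_commute[of _ w] mult.commute)
  have "inj M" unfolding linear_injective_0[OF lin]
    by (metis M form_eq_0 inner_zero_left)
  then have "surj M" using eucl.linear_inj_imp_surj[OF lin] by blast
  then obtain c where "M c = (\<Sum>b\<in>Basis. l b *\<^sub>R b)" by (metis surjD)
  then have c: "B c w = l w" for w
    using linear_euclidean_expansion[OF assms, of w]
    by (simp add: M[symmetric] inner_sum_left inner_sum_right inner_commute[of _ w] mult.commute)
  have "(\<forall>w. B (riesz B l) w = l w)" unfolding riesz_def
    by (rule theI[of _ c]) (use c form_unique in auto)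
  then show ?thesis by blast
qed

lemma form_coercive: "\<exists>m>0. \<forall>v. m * (norm v)\<^sup>2 \<le> B v v"
proof -
  have c: "continuous_on UNIV (\<lambda>v. B v v)"
  proof -
    have "B v v = (\<Sum>i\<in>Basis. \<Sum>j\<in>Basis. (v \<bullet> i) * (v \<bullet> j) * B i j)" for v
      by (subst linear_euclidean_expansion[OF form_linear], subst linear_euclidean_expansion[OF form_linear2])
        (simp add: sum_distrib_left mult.assoc)
    then show ?thesis by (simp only:) (intro continuous_intros)
  qed
  obtain b :: 'e where b: "b \<in> Basis" using nonempty_Basis by blast
  have "sphere 0 1 \<noteq> ({}::'e set)" using b by (auto intro!: exI[of _ b] simp: sphere_def)
  then obtain v where v: "v \<in> sphere (0::'e) 1" "\<And>w. w \<in> sphere 0 1 \<Longrightarrow> B v v \<le> B w w"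
    using continuous_attains_inf[OF compact_sphere _ continuous_on_subset[OF c subset_UNIV]] by metis
  have "B v v * (norm w)\<^sup>2 \<le> B w w" for w
  proof (cases "w = 0")
    case False
    have "B v v \<le> B ((1 / norm w) *\<^sub>R w) ((1 / norm w) *\<^sub>R w)" using False by (intro v) auto
    then show ?thesis using False by (simp add: form_simps field_simps power2_eq_square)
  qed (simp add: form_simps)
  moreover have "v \<noteq> 0" using v(1) by auto
  ultimately show ?thesis using form_pos by blast
qed

text \<open>The raising operator is symmetric, so contracting it with a skew form gives zero.\<close>

lemma trace_skew:
  assumes Z: "\<And>u w. B (Z u) w = sk u w" and sk: "\<And>u w. sk u w = - sk w u"
  shows "(\<Sum>b\<in>Basis. Z b \<bullet> b) = 0"
proof -
  define H where "H = (\<lambda>a. riesz B (\<lambda>w. a \<bullet> w))"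
  have H: "B (H a) w = a \<bullet> w" for a w unfolding H_def
    by (rule form_riesz) (auto intro!: linearI simp: algebra_simps)
  have Hs: "H b \<bullet> k = H k \<bullet> b" for b k by (metis H form_sym inner_commute)
  have "Z b \<bullet> b = (\<Sum>k\<in>Basis. (H b \<bullet> k) * sk b k)" for b
  proof -
    have "Z b \<bullet> b = B (Z b) (H b)" by (metis H form_sym inner_commute)
    also have "\<dots> = (\<Sum>k\<in>Basis. (H b \<bullet> k) * B (Z b) k)"
      using linear_euclidean_expansion[OF form_linear2, of "Z b" "H b"] by simp
    finally show ?thesis by (simp add: Z)
  qed
  then have eq: "(\<Sum>b\<in>Basis. Z b \<bullet> b) = (\<Sum>b\<in>Basis. \<Sum>k\<in>Basis. (H b \<bullet> k) * sk b k)" by simp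
  also have "\<dots> = (\<Sum>b\<in>Basis. \<Sum>k\<in>Basis. (H k \<bullet> b) * sk k b)" by (rule sum.swap)
  also have "\<dots> = - (\<Sum>b\<in>Basis. \<Sum>k\<in>Basis. (H b \<bullet> k) * sk b k)"
    unfolding sum_negf[symmetric] by (intro sum.cong refl) (metis Hs sk mult_minus_right)
  finally show ?thesis using eq by simp
qed

end

lemma quadratic_form_eqI:
  assumes "inner_form A" "inner_form B" "\<And>u. A u u = c * B u u"
  shows "A u v = c * B u v"
  using assms(3)[of "u + v"] assms(3)[of u] assms(3)[of v]
  by (simp add: form_simps[OF assms(1)] form_simps[OF assms(2)] form_sym[OF assms(1), of v u]
      form_sym[OF assms(2), of v u] algebra_simps)

text \<open>The second difference at \<open>v0\<close> recovers the quadratic form from its values near \<open>v0\<close>.\<close>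

lemma quadratic_form_eq_on_ball:
  fixes A B :: "'e::euclidean_space \<Rightarrow> 'e \<Rightarrow> real"
  assumes A: "inner_form A" and B: "inner_form B" and r: "r > 0"
    and eq: "\<And>v. v \<in> ball v0 r \<Longrightarrow> A v v = c * B v v"
  shows "A u v = c * B u v"
proof (rule quadratic_form_eqI[OF A B])
  fix u :: 'e
  define e where "e = r / (2 * (norm u + 1))"
  have e: "e > 0" using r by (simp add: e_def add_nonneg_pos)
  have "norm (e *\<^sub>R u) < r"
  proof -
    have "e * norm u \<le> e * (norm u + 1)" using e by simp
    also have "\<dots> = r / 2" using add_nonneg_pos[of "norm u" 1] by (simp add: e_def field_simps)
    finally show ?thesis using r e by simp
  qed
  then have "v0 + e *\<^sub>R u \<in> ball v0 r" "v0 - e *\<^sub>R u \<in> ball v0 r" "v0 \<in> ball v0 r"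
    using r by (auto simp: dist_norm)
  from this[THEN eq] have
    "A v0 v0 + 2 * (e * A u v0) + e * (e * A u u) = c * (B v0 v0 + 2 * (e * B u v0) + e * (e * B u u))"
    "A v0 v0 - 2 * (e * A u v0) + e * (e * A u u) = c * (B v0 v0 - 2 * (e * B u v0) + e * (e * B u u))"
    "A v0 v0 = c * B v0 v0"
    by (simp_all add: form_simps[OF A] form_simps[OF B] form_sym[OF A, of v0 u] form_sym[OF B, of v0 u]
        algebra_simps)
  then have "e * (e * A u u) = e * (e * (c * B u u))" by algebra
  then show "A u u = c * B u u" using e by simp
qed


subsection \<open>Conformality from the odd parts\<close>

text \<open>A real quadratic polynomial with the non-real root \<open>z\<close> is a multiple of
  \<open>x\<^sup>2 - 2 Re z x + |z|\<^sup>2\<close>.\<close>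

lemma real_quadratic_common_root:
  fixes c0 c1 c2 p0 p1 p2 :: real and z :: complex
  assumes "Im z \<noteq> 0" "p2 \<noteq> 0"
    and "of_real p0 + of_real p1 * z + of_real p2 * z\<^sup>2 = 0"
    and "of_real c0 + of_real c1 * z + of_real c2 * z\<^sup>2 = 0"
  shows "c0 = c2 / p2 * p0" "c1 = c2 / p2 * p1"
proof -
  have *: "d1 = - 2 * d2 * Re z \<and> d0 = d2 * ((Re z)\<^sup>2 + (Im z)\<^sup>2)"
    if "of_real d0 + of_real d1 * z + of_real d2 * z\<^sup>2 = 0" for d0 d1 d2
  proof -
    from that have i: "d1 * Im z + d2 * (2 * Re z * Im z) = 0"
      and r: "d0 + d1 * Re z + d2 * ((Re z)\<^sup>2 - (Im z)\<^sup>2) = 0"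
      by (auto simp: complex_eq_iff power2_eq_square algebra_simps)
    from i have "Im z * (d1 + 2 * d2 * Re z) = 0" by (simp add: algebra_simps)
    then have "d1 = - 2 * d2 * Re z" using assms(1) by simp
    with r show ?thesis by (simp add: power2_eq_square algebra_simps)
  qed
  show "c0 = c2 / p2 * p0" "c1 = c2 / p2 * p1"
    using *[OF assms(3)] *[OF assms(4)] assms(2) by auto
qed

lemma real_quadratic_nonreal_root:
  fixes p0 p1 p2 :: real
  assumes "p1\<^sup>2 < 4 * p0 * p2"
  obtains z :: complex where "Im z \<noteq> 0" "of_real p0 + of_real p1 * z + of_real p2 * z\<^sup>2 = 0"
proof -
  have p2: "p2 \<noteq> 0" using assms by (auto dest: order_le_less_trans[OF zero_le_power2])
  define d where "d = sqrt (4 * p0 * p2 - p1\<^sup>2)"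
  have d: "d > 0" "d\<^sup>2 = 4 * p0 * p2 - p1\<^sup>2" using assms by (auto simp: d_def)
  show ?thesis
  proof
    show "Im (Complex (- p1 / (2 * p2)) (d / (2 * p2))) \<noteq> 0" using d p2 by simp
    show "of_real p0 + of_real p1 * Complex (- p1 / (2 * p2)) (d / (2 * p2))
        + of_real p2 * (Complex (- p1 / (2 * p2)) (d / (2 * p2)))\<^sup>2 = 0"
    proof -
      have "p0 + p1 * x + p2 * (x\<^sup>2 - y\<^sup>2) = 0" "p1 * y + p2 * (2 * x * y) = 0"
        if "x = - p1 / (2 * p2)" "y = d / (2 * p2)" for x y
      proof -
        have x: "p1 = - 2 * p2 * x" and y: "d = 2 * p2 * y" using that p2 by auto
        have "4 * p2 * (p0 + p1 * x + p2 * (x\<^sup>2 - y\<^sup>2)) = 0"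
          using d(2) unfolding x y by (simp add: power2_eq_square algebra_simps)
        then show "p0 + p1 * x + p2 * (x\<^sup>2 - y\<^sup>2) = 0" using p2 by simp
        show "p1 * y + p2 * (2 * x * y) = 0" unfolding x by simp
      qed
      from this[OF refl refl] show ?thesis
        by (simp add: complex_eq_iff power2_eq_square)
    qed
  qed
qed

text \<open>Irreducible quadratics \<open>p\<close>, \<open>q\<close> with \<open>p a\<^sup>2 = q b\<^sup>2\<close> are proportional. A non-real root of \<open>p\<close>
  is a root of \<open>q\<close>, and then they are, or of \<open>b\<close>; symmetrically for \<open>q\<close> and \<open>a\<close>. In the remaining
  case \<open>b = k p\<close> and \<open>a = l q\<close> by the degrees, and cancelling \<open>p q\<close> leaves \<open>l\<^sup>2 q = k\<^sup>2 p\<close>.\<close>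

lemma quadratic_square_quotient:
  fixes p0 p1 p2 q0 q1 q2 a0 a1 a2 b0 b1 b2 :: real
  assumes p: "p1\<^sup>2 < 4 * p0 * p2" and q: "q1\<^sup>2 < 4 * q0 * q2" and a: "a0 \<noteq> 0"
    and eq: "\<And>s. (p0 + p1 * s + p2 * s\<^sup>2) * (a0 + a1 * s + a2 * s\<^sup>2)\<^sup>2 =
                  (q0 + q1 * s + q2 * s\<^sup>2) * (b0 + b1 * s + b2 * s\<^sup>2)\<^sup>2"
  shows "p0 * q2 = p2 * q0"
proof -
  have nz: "p2 \<noteq> 0" "q2 \<noteq> 0" "p0 \<noteq> 0" "q0 \<noteq> 0"
    using p q by (auto dest: order_le_less_trans[OF zero_le_power2])
  let ?c = "complex_of_real"
  let ?Q = "\<lambda>d0 d1 d2 z. ?c d0 + ?c d1 * z + ?c d2 * z\<^sup>2"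
  have ceq: "?Q p0 p1 p2 z * (?Q a0 a1 a2 z)\<^sup>2 = ?Q q0 q1 q2 z * (?Q b0 b1 b2 z)\<^sup>2" for z
  proof -
    define r where "r = [:?c p0, ?c p1, ?c p2:] * [:?c a0, ?c a1, ?c a2:]\<^sup>2
        - [:?c q0, ?c q1, ?c q2:] * [:?c b0, ?c b1, ?c b2:]\<^sup>2"
    have r: "poly r z = ?Q p0 p1 p2 z * (?Q a0 a1 a2 z)\<^sup>2 - ?Q q0 q1 q2 z * (?Q b0 b1 b2 z)\<^sup>2" for z
      by (simp add: r_def power2_eq_square algebra_simps)
    have "poly r (?c s) = 0" for s
    proof -
      have "?c ((p0 + p1 * s + p2 * s\<^sup>2) * (a0 + a1 * s + a2 * s\<^sup>2)\<^sup>2) =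
            ?c ((q0 + q1 * s + q2 * s\<^sup>2) * (b0 + b1 * s + b2 * s\<^sup>2)\<^sup>2)"
        by (simp only: eq)
      then show ?thesis unfolding r by simp
    qed
    then have "range ?c \<subseteq> {z. poly r z = 0}" by auto
    moreover have "infinite (range ?c)" by (simp add: finite_image_iff inj_of_real infinite_UNIV_char_0)
    ultimately have "r = 0" using poly_roots_finite finite_subset by blast
    then show ?thesis using r[of z] by simp
  qed
  have proportional: "p0 * q2 = p2 * q0" if "q0 = q2 / p2 * p0 \<or> p0 = p2 / q2 * q0" using that nz by (auto simp: field_simps)
  obtain z where z: "Im z \<noteq> 0" "?Q p0 p1 p2 z = 0" by (rule real_quadratic_nonreal_root[OF p])
  obtain y where y: "Im y \<noteq> 0" "?Q q0 q1 q2 y = 0" by (rule real_quadratic_nonreal_root[OF q])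
  from ceq[of z] z have "?Q q0 q1 q2 z = 0 \<or> ?Q b0 b1 b2 z = 0" by auto
  moreover from ceq[of y] y have "?Q p0 p1 p2 y = 0 \<or> ?Q a0 a1 a2 y = 0" by auto
  moreover have "p0 * q2 = p2 * q0" if bz: "?Q b0 b1 b2 z = 0" and ay: "?Q a0 a1 a2 y = 0"
  proof -
    define k l where "k = b2 / p2" and "l = a2 / q2"
    have b: "b0 = k * p0" "b1 = k * p1" "b2 = k * p2"
      using real_quadratic_common_root[OF z(1) nz(1) z(2) bz] nz by (auto simp: k_def)
    have a': "a0 = l * q0" "a1 = l * q1" "a2 = l * q2"
      using real_quadratic_common_root[OF y(1) nz(2) y(2) ay] nz by (auto simp: l_def)
    have l: "l \<noteq> 0" using a a' by auto
    have PQ: "d0 + d1 * s + d2 * s\<^sup>2 \<noteq> 0" if "d1\<^sup>2 < 4 * d0 * d2" for d0 d1 d2 s :: real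
    proof
      assume "d0 + d1 * s + d2 * s\<^sup>2 = 0"
      then have "(d1 + 2 * d2 * s)\<^sup>2 = d1\<^sup>2 - 4 * d0 * d2" by (algebra)
      then show False using that zero_le_power2[of "d1 + 2 * d2 * s"] by linarith
    qed
    have e: "l\<^sup>2 * (q0 + q1 * s + q2 * s\<^sup>2) = k\<^sup>2 * (p0 + p1 * s + p2 * s\<^sup>2)" for s
    proof -
      let ?P = "p0 + p1 * s + p2 * s\<^sup>2" and ?R = "q0 + q1 * s + q2 * s\<^sup>2"
      have "?P * (l * ?R)\<^sup>2 = ?R * (k * ?P)\<^sup>2" using eq[of s] unfolding a' b by (simp add: algebra_simps)
      then have "(?P * ?R) * (l\<^sup>2 * ?R) = (?P * ?R) * (k\<^sup>2 * ?P)" by (simp add: power2_eq_square algebra_simps)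
      then show ?thesis using PQ[OF p] PQ[OF q] by simp
    qed
    from e[of 0] have e0: "l\<^sup>2 * q0 = k\<^sup>2 * p0" by simp
    from e[of 1] e[of "-1"] e0 have e2: "l\<^sup>2 * q2 = k\<^sup>2 * p2" by (simp add: algebra_simps)
    have "l\<^sup>2 * (p0 * q2) = p0 * (k\<^sup>2 * p2)" by (simp add: e2[symmetric])
    also have "\<dots> = l\<^sup>2 * (p2 * q0)" using e0 by (simp add: algebra_simps)
    finally show ?thesis using l by simp
  qed
  ultimately show ?thesis
    using proportional real_quadratic_common_root(1)[OF z(1) nz(1) z(2)]
      real_quadratic_common_root(1)[OF y(1) nz(2) y(2)] by blast
qed

text \<open>
  Wedging with \<open>w\<close> removes the multiple of \<open>w\<close>: \<open>|w| (J w \<and> w) = |w|' (J' w \<and> w)\<close>. Along the line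
  \<open>w = v + s u\<close> the coordinates of the bivectors are quadratic polynomials in \<open>s\<close>, so the quotient
  of the squared norms is the square of a quotient of such polynomials.
\<close>

lemma conformal_of_odd_parts:
  fixes B B' :: "'e::euclidean_space \<Rightarrow> 'e \<Rightarrow> real"
  assumes B: "inner_form B" and B': "inner_form B'" and J: "linear J" and J': "linear J'"
    and skew: "\<And>v. B (J v) v = 0" and v: "J v \<noteq> 0"
    and par: "\<And>w. w \<noteq> 0 \<Longrightarrow> \<exists>c. sqrt (B w w) *\<^sub>R J w - sqrt (B' w w) *\<^sub>R J' w = c *\<^sub>R w"
  shows "\<exists>f>0. \<forall>u w. B' u w = f * B u w"
proof -
  have v0: "v \<noteq> 0" using v linear_0[OF J] by auto
  have "(v \<bullet> v) *\<^sub>R J v \<noteq> (J v \<bullet> v) *\<^sub>R v"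
  proof
    assume e: "(v \<bullet> v) *\<^sub>R J v = (J v \<bullet> v) *\<^sub>R v"
    have "(v \<bullet> v) * B (J v) v = (J v \<bullet> v) * B v v"
      using arg_cong[OF e, of "\<lambda>w. B w v"] by (simp add: form_simps[OF B])
    then have "J v \<bullet> v = 0" using skew v0 form_pos[OF B v0] by simp
    then show False using e v v0 by simp
  qed
  then obtain x where x: "(J v \<bullet> x) * (v \<bullet> v) \<noteq> (J v \<bullet> v) * (v \<bullet> x)"
    by (metis euclidean_eqI inner_scaleR_left mult.commute)
  \<comment> \<open>a coordinate of \<open>K w \<and> w\<close> that does not vanish for \<open>K = J\<close>, \<open>w = v\<close>\<close>
  define a where "a = (\<lambda>K w. (K w \<bullet> x) * (w \<bullet> v) - (K w \<bullet> v) * (w \<bullet> x))"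
  have ab: "B w w * (a J w)\<^sup>2 = B' w w * (a J' w)\<^sup>2" if w: "w \<noteq> 0" for w
  proof -
    obtain l where l: "sqrt (B w w) *\<^sub>R J w - sqrt (B' w w) *\<^sub>R J' w = l *\<^sub>R w" using par[OF w] by blast
    have "sqrt (B w w) * (J w \<bullet> y) - sqrt (B' w w) * (J' w \<bullet> y) = l * (w \<bullet> y)" for y
      using arg_cong[OF l, of "\<lambda>z. z \<bullet> y"] by (simp add: inner_diff_left)
    from this[of x] this[of v]
    have "sqrt (B w w) * a J w = sqrt (B' w w) * a J' w"
      unfolding a_def by algebra
    then have "(sqrt (B w w) * a J w)\<^sup>2 = (sqrt (B' w w) * a J' w)\<^sup>2" by simp
    then show ?thesis using form_nonneg[OF B, of w] form_nonneg[OF B', of w] by (simp add: power_mult_distrib)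
  qed
  define f where "f = B' v v / B v v"
  have f: "f > 0" using form_pos[OF B v0] form_pos[OF B' v0] by (simp add: f_def)
  have "B' u u = f * B u u" for u
  proof (cases "\<exists>c. u = c *\<^sub>R v")
    case True
    then show ?thesis using form_pos[OF B v0] by (auto simp: f_def form_simps[OF B] form_simps[OF B'])
  next
    case False
    have nz: "v + s *\<^sub>R u \<noteq> 0" for s
    proof
      assume e: "v + s *\<^sub>R u = 0"
      then have "s \<noteq> 0" using v0 by auto
      moreover have "s *\<^sub>R u = (-1) *\<^sub>R v" using e by (simp add: add_eq_0_iff)
      ultimately have "u = (- 1 / s) *\<^sub>R v" by (metis divide_inverse inverse_eq_divide
            scaleR_scaleR left_inverse scaleR_one mult.commute)
      then show False using False by blast
    qed
    have u0: "u \<noteq> 0" using False by (metis scaleR_zero_left)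
    have disc: "(2 * A v u)\<^sup>2 < 4 * A v v * A u u" if A: "inner_form A" for A
    proof -
      have "0 < A (v + (- A v u / A u u) *\<^sub>R u) (v + (- A v u / A u u) *\<^sub>R u)"
        using form_pos[OF A nz] .
      also have "\<dots> = A v v - (A v u)\<^sup>2 / A u u"
        using form_pos[OF A u0] by (simp add: form_simps[OF A] form_sym[OF A, of u v] power2_eq_square field_simps)
      finally show ?thesis using form_pos[OF A u0] by (simp add: field_simps power2_eq_square)
    qed
    \<comment> \<open>the coefficient of \<open>s\<close> in \<open>a K (v + s u)\<close>\<close>
    let ?ac = "\<lambda>K. (K u \<bullet> x) * (v \<bullet> v) + (K v \<bullet> x) * (u \<bullet> v) - (K u \<bullet> v) * (v \<bullet> x) - (K v \<bullet> v) * (u \<bullet> x)"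
    have "B v v * B' u u = B u u * B' v v"
    proof (rule quadratic_square_quotient[OF disc[OF B] disc[OF B'], of "a J v" "?ac J" "a J u" "a J' v" "?ac J'" "a J' u"])
      show "a J v \<noteq> 0" using x by (simp add: a_def)
      fix s
      have e: "A v v + 2 * A v u * s + A u u * s\<^sup>2 = A (v + s *\<^sub>R u) (v + s *\<^sub>R u)" if A: "inner_form A" for A
        by (simp add: form_simps[OF A] form_sym[OF A, of u v] power2_eq_square algebra_simps)
      have e2: "a K v + ?ac K * s + a K u * s\<^sup>2 = a K (v + s *\<^sub>R u)" if K: "linear K" for K
        by (simp add: a_def linear_add[OF K] linear_scale[OF K] power2_eq_square algebra_simps)
      show "(B v v + 2 * B v u * s + B u u * s\<^sup>2) * (a J v + ?ac J * s + a J u * s\<^sup>2)\<^sup>2 =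
            (B' v v + 2 * B' v u * s + B' u u * s\<^sup>2) * (a J' v + ?ac J' * s + a J' u * s\<^sup>2)\<^sup>2"
        unfolding e[OF B] e[OF B'] e2[OF J] e2[OF J'] by (rule ab[OF nz])
    qed
    then show ?thesis using form_pos[OF B v0] by (simp add: f_def field_simps)
  qed
  then show ?thesis using quadratic_form_eqI[OF B' B] f by blast
qed


subsection \<open>Symmetric bilinear maps with values along the argument\<close>

text \<open>
  Let \<open>T v v = m v *\<^sub>R v\<close>. Computing \<open>T u v\<close> from \<open>T (u + v) (u + v)\<close> and from \<open>T (u - v) (u - v)\<close>, for
  linearly independent \<open>u\<close> and \<open>v\<close>, and comparing coefficients shows that \<open>m\<close> is additive, and that
  \<open>2 T u v = m v u + m u v\<close>. The trace of \<open>T v\<close> is therefore \<open>(n + 1) / 2\<close> times \<open>m v\<close>.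
\<close>

lemma trace_of_radial_bilinear:
  fixes T :: "'e::euclidean_space \<Rightarrow> 'e \<Rightarrow> 'e"
  assumes lin: "\<And>u. linear (T u)" and sym: "\<And>u v. T u v = T v u"
    and rad: "\<And>v. v \<noteq> 0 \<Longrightarrow> \<exists>m. T v v = m *\<^sub>R v"
  shows "T v v = (2 / (real DIM('e) + 1) * (\<Sum>b\<in>Basis. T v b \<bullet> b)) *\<^sub>R v"
proof -
  define m where "m = (\<lambda>v. if v = 0 then 0 else (T v v \<bullet> v) / (v \<bullet> v))"
  note add = linear_add[OF lin] and sc = linear_scale[OF lin]
  have add2: "T (a + b) c = T a c + T b c" and sc2: "T (r *\<^sub>R a) c = r *\<^sub>R T a c" for a b c r
    by (metis add sym, metis sc sym)
  have m: "T v v = m v *\<^sub>R v" for v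
  proof (cases "v = 0")
    case True then show ?thesis using linear_0[OF lin] by simp
  next
    case False then obtain c where "T v v = c *\<^sub>R v" using rad by blast
    then show ?thesis using False by (simp add: m_def)
  qed
  have msc: "m (c *\<^sub>R v) = c * m v" for c v
    by (cases "c = 0 \<or> v = 0") (auto simp: m_def sc sc2 field_simps)
  have pol: "2 *\<^sub>R T u v = m v *\<^sub>R u + m u *\<^sub>R v \<and> m (u + v) = m u + m v" for u v
  proof (cases "\<exists>c. u = c *\<^sub>R v \<or> v = c *\<^sub>R u")
    case True
    then obtain c where "u = c *\<^sub>R v \<or> v = c *\<^sub>R u" by blast
    then show ?thesis
    proof
      assume u: "u = c *\<^sub>R v"
      have "m (u + v) = (c + 1) * m v" unfolding u by (metis msc scaleR_left_distrib scaleR_one)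
      then show ?thesis by (simp add: u msc sc2 m algebra_simps flip: scaleR_add_left)
    next
      assume v: "v = c *\<^sub>R u"
      have "m (u + v) = (1 + c) * m u" unfolding v by (metis msc scaleR_left_distrib scaleR_one)
      then show ?thesis by (simp add: v msc sc m algebra_simps flip: scaleR_add_left)
    qed
  next
    case False
    have indep: "a = 0 \<and> b = 0" if e: "a *\<^sub>R u + b *\<^sub>R v = 0" for a b
    proof (rule ccontr)
      assume n: "\<not> (a = 0 \<and> b = 0)"
      have "u = (- b / a) *\<^sub>R v" if "a \<noteq> 0"
      proof -
        have "u = inverse a *\<^sub>R (a *\<^sub>R u)" using that by simp
        also have "a *\<^sub>R u = - (b *\<^sub>R v)" using e by (simp add: eq_neg_iff_add_eq_0)
        finally show ?thesis by (simp add: divide_inverse mult.commute)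
      qed
      moreover have "v = 0 *\<^sub>R u" if "a = 0" using e n that by simp
      ultimately show False using False by blast
    qed
    have p: "2 *\<^sub>R T u v = m (u + v) *\<^sub>R (u + v) - m u *\<^sub>R u - m v *\<^sub>R v"
      using m[of "u + v"] m[of u] m[of v] by (simp add: add add2 sym[of v u] algebra_simps scaleR_2)
    have q: "2 *\<^sub>R T u v = m u *\<^sub>R u + m v *\<^sub>R v - m (u - v) *\<^sub>R (u - v)"
    proof -
      have "T (u - v) (u - v) = T u u + T v v - 2 *\<^sub>R T u v"
        by (simp add: linear_diff[OF lin] scaleR_2 sym[of "u - v"] sym[of v u])
      then show ?thesis using m[of "u - v"] m[of u] m[of v] by simp
    qed
    have "m (u + v) *\<^sub>R (u + v) - m u *\<^sub>R u - m v *\<^sub>R v =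
        m u *\<^sub>R u + m v *\<^sub>R v - m (u - v) *\<^sub>R (u - v)" using p q by simp
    then have "(m (u + v) - m u - m u + m (u - v)) *\<^sub>R u + (m (u + v) - m v - m v - m (u - v)) *\<^sub>R v = 0"
      unfolding scaleR_left_distrib scaleR_left_diff_distrib by (simp add: algebra_simps)
    then have "m (u + v) - m u - m u + m (u - v) = 0 \<and> m (u + v) - m v - m v - m (u - v) = 0"
      by (rule indep)
    then have "m (u + v) = m u + m v" by linarith
    then show ?thesis using p by (simp add: algebra_simps)
  qed
  have mlin: "linear m" using pol msc by (auto intro!: linearI)
  have "2 * (\<Sum>b\<in>Basis. T v b \<bullet> b) = (\<Sum>b\<in>Basis. (2 *\<^sub>R T v b) \<bullet> b)" by (simp add: sum_distrib_left)
  also have "\<dots> = (\<Sum>b\<in>Basis. m b * (v \<bullet> b) + m v * (b \<bullet> b))" using pol by (simp add: inner_add_left)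
  also have "\<dots> = (\<Sum>b\<in>Basis. (v \<bullet> b) *\<^sub>R m b) + m v * DIM('e)"
    by (simp add: sum.distrib mult.commute)
  also have "\<dots> = m v * (real DIM('e) + 1)"
    using linear_euclidean_expansion[OF mlin, of v] by (simp add: algebra_simps)
  finally have mv: "m v = 2 / (real DIM('e) + 1) * (\<Sum>b\<in>Basis. T v b \<bullet> b)" by (simp add: field_simps)
  show ?thesis by (simp only: m mv)
qed

subsection \<open>Gram determinants\<close>

text \<open>The determinant of the matrix of \<open>A\<close> in the standard basis, by the Leibniz formula, because
  rows and columns are indexed by the set \<open>Basis\<close>.\<close>

definition gram_det :: "('e::euclidean_space \<Rightarrow> 'e \<Rightarrow> real) \<Rightarrow> real" where
  "gram_det A = (\<Sum>p | p permutes Basis. of_int (sign p) * (\<Prod>i\<in>Basis. A i (p i)))"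

text \<open>Replacing row \<open>i\<close> by row \<open>k\<close> gives a determinant with two equal rows unless \<open>k = i\<close>.\<close>

lemma gram_det_row_replaced:
  fixes A :: "'e::euclidean_space \<Rightarrow> 'e \<Rightarrow> real"
  assumes ik: "i \<in> Basis" "k \<in> Basis"
  shows "(\<Sum>p | p permutes Basis. of_int (sign p) * (A k (p i) * (\<Prod>j\<in>Basis - {i}. A j (p j)))) =
    (if i = k then gram_det A else 0)"
proof (cases "i = k")
  case True
  then show ?thesis unfolding gram_det_def
    using prod.remove[OF finite_Basis ik(1), where g="\<lambda>j. A j (p j)" for p] by simp
next
  case False
  let ?t = "Transposition.transpose i k"
  let ?f = "\<lambda>p. of_int (sign p) * (A k (p i) * (\<Prod>j\<in>Basis - {i}. A j (p j))) :: real"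
  have t: "?t permutes Basis" using ik by (simp add: permutes_swap_id)
  have split: "(\<Prod>j\<in>Basis - {i}. A j (p j)) = A k (p k) * (\<Prod>j\<in>Basis - {i} - {k}. A j (p j))" for p
    using ik False by (intro prod.remove) auto
  have neg: "?f (p \<circ> ?t) = - ?f p" if p: "p permutes Basis" for p
  proof -
    have "sign (p \<circ> ?t) = - sign p"
      using p t False by (subst sign_compose) (auto simp: sign_swap_id permutation_permutes intro: finite_Basis)
    moreover have "(\<Prod>j\<in>Basis - {i} - {k}. A j (p (?t j))) = (\<Prod>j\<in>Basis - {i} - {k}. A j (p j))"
      by (intro prod.cong) (auto simp: transpose_def)
    ultimately show ?thesis by (simp add: split)
  qed
  have "sum ?f {p. p permutes Basis} = (\<Sum>p | p permutes Basis. ?f (p \<circ> ?t))"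
    by (rule sum_permutations_compose_right[OF t])
  also have "\<dots> = - sum ?f {p. p permutes Basis}"
    unfolding sum_negf[symmetric] by (intro sum.cong refl neg) auto
  finally show ?thesis using False by simp
qed

text \<open>Jacobi's formula. Writing the derivative of the matrix as a product \<open>C A\<close> takes the place of
  the inverse matrix.\<close>

lemma gram_det_has_derivative:
  fixes A :: "'d::real_normed_vector \<Rightarrow> 'e::euclidean_space \<Rightarrow> 'e \<Rightarrow> real"
  assumes d: "\<And>i j. i \<in> Basis \<Longrightarrow> j \<in> Basis \<Longrightarrow> ((\<lambda>y. A y i j) has_derivative (\<lambda>h. A' h i j)) (at x within S)"
    and C: "\<And>h i j. i \<in> Basis \<Longrightarrow> j \<in> Basis \<Longrightarrow> A' h i j = (\<Sum>k\<in>Basis. C h i k * A x k j)"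
  shows "((\<lambda>y. gram_det (A y)) has_derivative (\<lambda>h. (\<Sum>i\<in>Basis. C h i i) * gram_det (A x))) (at x within S)"
proof -
  let ?P = "{p. p permutes (Basis :: 'e set)}"
  have pB: "p i \<in> Basis" if "p \<in> ?P" "i \<in> Basis" for p i using that permutes_in_image by fastforce
  have "((\<lambda>y. gram_det (A y)) has_derivative (\<lambda>h. \<Sum>p\<in>?P. of_int (sign p) *
      (\<Sum>i\<in>Basis. A' h i (p i) * (\<Prod>j\<in>Basis - {i}. A x j (p j))))) (at x within S)"
    unfolding gram_det_def
  proof (intro has_derivative_sum has_derivative_mult_right has_derivative_prod)
    show "((\<lambda>y. A y i (p i)) has_derivative (\<lambda>h. A' h i (p i))) (at x within S)"
      if "p \<in> ?P" "i \<in> Basis" for p i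
      using d[OF that(2) pB[OF that]] .
  qed
  moreover have "(\<Sum>p\<in>?P. of_int (sign p) * (\<Sum>i\<in>Basis. A' h i (p i) * (\<Prod>j\<in>Basis - {i}. A x j (p j)))) =
     (\<Sum>i\<in>Basis. C h i i) * gram_det (A x)" for h
  proof -
    have "(\<Sum>p\<in>?P. of_int (sign p) * (\<Sum>i\<in>Basis. A' h i (p i) * (\<Prod>j\<in>Basis - {i}. A x j (p j)))) =
       (\<Sum>p\<in>?P. \<Sum>i\<in>Basis. \<Sum>k\<in>Basis. C h i k * (of_int (sign p) * (A x k (p i) * (\<Prod>j\<in>Basis - {i}. A x j (p j)))))"
      by (intro sum.cong refl) (simp add: C pB sum_distrib_left sum_distrib_right algebra_simps)
    also have "\<dots> = (\<Sum>i\<in>Basis. \<Sum>k\<in>Basis. \<Sum>p\<in>?P. C h i k * (of_int (sign p) * (A x k (p i) * (\<Prod>j\<in>Basis - {i}. A x j (p j)))))"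
      by (subst sum.swap, intro sum.cong refl, subst sum.swap, rule refl)
    also have "\<dots> = (\<Sum>i\<in>Basis. \<Sum>k\<in>Basis. C h i k * (if i = k then gram_det (A x) else 0))"
      by (intro sum.cong refl) (simp add: gram_det_row_replaced sum_distrib_left[symmetric])
    also have "\<dots> = (\<Sum>i\<in>Basis. C h i i * gram_det (A x))"
      by (intro sum.cong refl) (simp add: if_distrib[of "\<lambda>z. _ * z"] cong: if_cong)
    finally show ?thesis by (simp add: sum_distrib_right)
  qed
  ultimately show ?thesis by simp
qed

lemma gram_det_scale:
  "gram_det (\<lambda>u v. c * A u v) = c ^ DIM('e) * gram_det (A :: 'e::euclidean_space \<Rightarrow> 'e \<Rightarrow> real)"
  by (simp add: gram_det_def prod.distrib sum_distrib_left algebra_simps)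

lemma gram_det_inner: "gram_det (\<lambda>u v :: 'e::euclidean_space. u \<bullet> v) = 1"
proof -
  have "(\<Prod>i\<in>Basis. i \<bullet> p i) = (if p = id then 1 else 0)" if p: "p permutes (Basis :: 'e set)" for p
  proof (cases "p = id")
    case False
    then obtain i where i: "p i \<noteq> i" by (auto simp: fun_eq_iff)
    then have iB: "i \<in> Basis" using p by (auto simp: permutes_def)
    then have "i \<bullet> p i = 0" using i p permutes_in_image[OF p] by (metis inner_not_same_Basis)
    then show ?thesis using False iB by (metis prod_zero finite_Basis)
  qed auto
  then have "gram_det (\<lambda>u v :: 'e. u \<bullet> v) =
      (\<Sum>p | p permutes (Basis :: 'e set). of_int (sign p) * (if p = id then 1 else 0))"
    unfolding gram_det_def by (intro sum.cong) auto
  also have "\<dots> = 1"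
    by (simp add: if_distrib[of "\<lambda>z. _ * z"] finite_permutations permutes_id sign_id sum.delta cong: if_cong)
  finally show ?thesis .
qed

text \<open>
  Along the segment from the inner product to \<open>B\<close> the determinant \<open>y\<close> satisfies \<open>y' = \<tau> y\<close> with
  bounded \<open>\<tau>\<close>, so it cannot reach zero.
\<close>

lemma gram_det_nonzero:
  fixes B :: "'e::euclidean_space \<Rightarrow> 'e \<Rightarrow> real"
  assumes B: "inner_form B"
  shows "gram_det B \<noteq> 0"
proof -
  define A where "A = (\<lambda>(t::real) u v. (1 - t) * (u \<bullet> v) + t * B u v)"
  have A: "inner_form (A t)" if "0 \<le> t" "t \<le> 1" for t
  proof -
    have "A t u u > 0" if "u \<noteq> 0" for u
    proof (cases "t = 0")
      case False
      then have "t * B u u > 0" using \<open>0 \<le> t\<close> form_pos[OF B that] by simp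
      moreover have "(1 - t) * (u \<bullet> u) \<ge> 0" using \<open>t \<le> 1\<close> by simp
      ultimately show ?thesis by (simp add: A_def)
    qed (use that in \<open>simp add: A_def\<close>)
    moreover have "linear (\<lambda>u. A t u v)" for v
      by (rule linearI) (simp_all add: A_def form_simps[OF B] inner_add_left algebra_simps)
    moreover have "A t u v = A t v u" for u v
      by (simp add: A_def inner_commute[of u v] form_sym[OF B, of u v])
    ultimately show ?thesis unfolding inner_form_def by blast
  qed
  define l where "l = (\<lambda>b w. B b w - b \<bullet> w)"
  have lin: "linear (l b)" for b by (auto simp: l_def form_simps[OF B] algebra_simps intro!: linearI)
  define c where "c = (\<lambda>t b. riesz (A t) (l b))"
  have c: "A t (c t b) w = l b w" if "0 \<le> t" "t \<le> 1" for t b w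
    unfolding c_def by (rule form_riesz[OF A[OF that] lin])
  obtain m0 where m0: "m0 > 0" "\<And>v. m0 * (norm v)\<^sup>2 \<le> B v v" using form_coercive[OF B] by blast
  define m where "m = min 1 m0"
  have m: "m > 0" "m * (norm v)\<^sup>2 \<le> A t v v" if "0 \<le> t" "t \<le> 1" for t v
  proof -
    show "m > 0" using m0 by (simp add: m_def)
    have "(1 - t) * (m * (norm v)\<^sup>2) + t * (m * (norm v)\<^sup>2) \<le> (1 - t) * (v \<bullet> v) + t * B v v"
    proof (intro add_mono mult_left_mono)
      show "m * (norm v)\<^sup>2 \<le> v \<bullet> v"
        using mult_right_mono[of m 1 "(norm v)\<^sup>2"] by (simp add: m_def power2_norm_eq_inner)
      show "m * (norm v)\<^sup>2 \<le> B v v"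
        using m0(2)[of v] mult_right_mono[of m m0 "(norm v)\<^sup>2"] by (simp add: m_def)
    qed (use that in auto)
    then show "m * (norm v)\<^sup>2 \<le> A t v v" by (simp add: A_def algebra_simps)
  qed
  have "\<exists>K\<ge>0. \<forall>w. \<bar>l b w\<bar> \<le> K * norm w" for b
    using linear_bounded[OF lin[of b]] by (metis abs_ge_zero abs_ge_self mult_right_mono norm_ge_zero order_trans real_norm_def)
  then obtain K where K: "\<And>b. K b \<ge> 0" "\<And>b w. \<bar>l b w\<bar> \<le> K b * norm w" by metis
  have cb: "norm (c t b) \<le> K b / m" if t: "0 \<le> t" "t \<le> 1" for t b
  proof -
    have "m * (norm (c t b))\<^sup>2 \<le> l b (c t b)" using m(2)[OF t, of "c t b"] c[OF t, of b "c t b"] by simp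
    also have "\<dots> \<le> K b * norm (c t b)" using K(2)[of b "c t b"] by simp
    finally have "(m * norm (c t b)) * norm (c t b) \<le> K b * norm (c t b)"
      by (simp add: power2_eq_square mult.assoc)
    then have "m * norm (c t b) \<le> K b"
      using K(1) by (cases "c t b = 0") auto
    then show ?thesis using m(1)[OF t] by (simp add: field_simps)
  qed
  define \<tau> where "\<tau> = (\<lambda>t. \<Sum>b\<in>Basis. c t b \<bullet> b)"
  define k where "k = (\<Sum>b\<in>Basis. K b / m)"
  have \<tau>: "\<bar>\<tau> t\<bar> \<le> k" if "0 \<le> t" "t \<le> 1" for t
    unfolding \<tau>_def k_def
    by (rule order_trans[OF sum_abs], rule sum_mono) (use Basis_le_norm cb[OF that] order_trans in blast)
  define y where "y = (\<lambda>t. gram_det (A t))"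
  have dy: "(y has_real_derivative \<tau> t * y t) (at t)" if t: "0 \<le> t" "t \<le> 1" for t
  proof -
    have "(y has_derivative (\<lambda>h. (\<Sum>i\<in>Basis. h * (c t i \<bullet> i)) * gram_det (A t))) (at t)"
      unfolding y_def
    proof (rule gram_det_has_derivative[where A'="\<lambda>h i j. h * l i j" and C="\<lambda>h i k. h * (c t i \<bullet> k)"])
      show "((\<lambda>y. A y i j) has_derivative (\<lambda>h. h * l i j)) (at t)" for i j
        unfolding A_def l_def by (auto intro!: derivative_eq_intros simp: algebra_simps)
      show "h * l i j = (\<Sum>k\<in>Basis. (h * (c t i \<bullet> k)) * A t k j)" for h i j
      proof -
        have "l i j = (\<Sum>k\<in>Basis. (c t i \<bullet> k) * A t k j)"
          using linear_euclidean_expansion[OF form_linear[OF A[OF t]], of "c t i" j] c[OF t] by simp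
        then show ?thesis by (simp add: sum_distrib_left mult.assoc)
      qed
    qed
    then show ?thesis
      by (rule has_derivative_imp_has_field_derivative)
        (simp add: y_def \<tau>_def sum_distrib_left[symmetric])
  qed
  define E where "E = (\<lambda>t. (y t)\<^sup>2 * exp (2 * k * t))"
  have "E 0 \<le> E 1"
  proof (rule DERIV_nonneg_imp_nondecreasing[of 0 1])
    fix t :: real assume t: "0 \<le> t" "t \<le> 1"
    have "(E has_real_derivative 2 * (\<tau> t + k) * ((y t)\<^sup>2 * exp (2 * k * t))) (at t)"
      unfolding E_def by (auto intro!: derivative_eq_intros dy[OF t] simp: power2_eq_square algebra_simps)
    moreover have "2 * (\<tau> t + k) * ((y t)\<^sup>2 * exp (2 * k * t)) \<ge> 0"
      using \<tau>[OF t] by (intro mult_nonneg_nonneg) auto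
    ultimately show "\<exists>d. (E has_real_derivative d) (at t) \<and> d \<ge> 0" by blast
  qed auto
  moreover have "E 0 = 1" by (simp add: E_def y_def A_def gram_det_inner)
  moreover have "y 1 = gram_det B" by (simp add: y_def A_def)
  ultimately show ?thesis by (auto simp: E_def)
qed

section \<open>Randers data in a coordinate domain\<close>

lemma Ck_on_2D:
  assumes "Ck_on 2 U f"
  shows "x \<in> U \<Longrightarrow> (f has_derivative frechet_derivative f (at x)) (at x)"
    and "Ck_on 1 U (\<lambda>x. frechet_derivative f (at x) v)"
proof -
  have "Ck_on (Suc 1) U f" using assms by (metis Suc_1)
  then show "x \<in> U \<Longrightarrow> (f has_derivative frechet_derivative f (at x)) (at x)"
    and "Ck_on 1 U (\<lambda>x. frechet_derivative f (at x) v)"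
    using Ck_on_has_derivative Ck_on.simps(2) by blast+
qed

lemma linear_expand:
  fixes l :: "'e::euclidean_space \<Rightarrow> real"
  assumes "linear l" shows "l v = (\<Sum>i\<in>Basis. (v \<bullet> i) * l i)"
  using linear_euclidean_expansion[OF assms, of v] by simp

lemma bilinear_expand:
  fixes b :: "'e::euclidean_space \<Rightarrow> 'e \<Rightarrow> real"
  assumes "\<And>v. linear (\<lambda>u. b u v)" "\<And>u. linear (b u)"
  shows "b u v = (\<Sum>i\<in>Basis. \<Sum>j\<in>Basis. (u \<bullet> i) * (v \<bullet> j) * b i j)"
proof -
  have "b u v = (\<Sum>i\<in>Basis. (u \<bullet> i) * b i v)" by (rule linear_expand[OF assms(1)])
  also have "\<dots> = (\<Sum>i\<in>Basis. (u \<bullet> i) * (\<Sum>j\<in>Basis. (v \<bullet> j) * b i j))"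
    by (intro sum.cong refl arg_cong2[where f="(*)"] linear_expand[OF assms(2)])
  finally show ?thesis by (simp add: sum_distrib_left mult.assoc)
qed

lemma has_real_derivative_transform_on:
  assumes "t \<in> S" "\<And>s. s \<in> S \<Longrightarrow> g s = f s" "(f has_real_derivative D) (at t within S)"
  shows "(g has_real_derivative D) (at t within S)"
  using has_derivative_transform[where f=f and g=g, OF assms(1,2)] assms(3)
  unfolding has_field_derivative_def by blast

text \<open>Lipschitz functions on a compact set are bounded, so they form an algebra.\<close>

lemma lipschitz_on_mult_compact:
  fixes f g :: "'d::metric_space \<Rightarrow> real"
  assumes "compact K" "\<exists>L. L-lipschitz_on K f" "\<exists>L. L-lipschitz_on K g"
  shows "\<exists>L. L-lipschitz_on K (\<lambda>x. f x * g x)"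
proof -
  obtain a b where ab: "a-lipschitz_on K f" "b-lipschitz_on K g" using assms by blast
  have "\<exists>B\<ge>0. \<forall>x\<in>K. \<bar>h x\<bar> \<le> B" if "L-lipschitz_on K h" for h :: "'d \<Rightarrow> real" and L
  proof -
    have "bounded (h ` K)"
      using compact_continuous_image[OF lipschitz_on_continuous_on[OF that] assms(1)] compact_imp_bounded by blast
    then obtain B where "\<forall>x\<in>K. \<bar>h x\<bar> \<le> B" unfolding bounded_iff by auto
    then show ?thesis by (intro exI[of _ "\<bar>B\<bar>"]) force
  qed
  from this[OF ab(1)] this[OF ab(2)] obtain A B where AB: "A \<ge> 0" "B \<ge> 0"
    "\<And>x. x \<in> K \<Longrightarrow> \<bar>f x\<bar> \<le> A" "\<And>x. x \<in> K \<Longrightarrow> \<bar>g x\<bar> \<le> B" by metis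
  have "(A * b + B * a)-lipschitz_on K (\<lambda>x. f x * g x)"
  proof (rule lipschitz_onI)
    fix x y assume xy: "x \<in> K" "y \<in> K"
    have "f x * g x - f y * g y = f x * (g x - g y) + g y * (f x - f y)" by (simp add: algebra_simps)
    then have "\<bar>f x * g x - f y * g y\<bar> \<le> \<bar>f x\<bar> * \<bar>g x - g y\<bar> + \<bar>g y\<bar> * \<bar>f x - f y\<bar>"
      by (metis abs_mult abs_triangle_ineq)
    also have "\<dots> \<le> A * (b * dist x y) + B * (a * dist x y)"
      using AB xy lipschitz_onD[OF ab(1) xy] lipschitz_onD[OF ab(2) xy]
      by (intro add_mono mult_mono) (auto simp: dist_real_def)
    finally show "dist (f x * g x) (f y * g y) \<le> (A * b + B * a) * dist x y"
      by (simp add: dist_real_def algebra_simps)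
  qed (use AB lipschitz_on_nonneg[OF ab(1)] lipschitz_on_nonneg[OF ab(2)] in auto)
  then show ?thesis ..
qed

lemma lipschitz_on_ex_sum:
  fixes f :: "'i \<Rightarrow> 'd::metric_space \<Rightarrow> real"
  assumes "\<And>i. i \<in> I \<Longrightarrow> \<exists>L. L-lipschitz_on K (f i)"
  shows "\<exists>L. L-lipschitz_on K (\<lambda>x. \<Sum>i\<in>I. f i x)"
  using assms
proof (induction I rule: infinite_finite_induct)
  case (insert i I)
  then obtain a b where "a-lipschitz_on K (f i)" "b-lipschitz_on K (\<lambda>x. \<Sum>i\<in>I. f i x)" by blast
  then have "(a + b)-lipschitz_on K (\<lambda>x. f i x + (\<Sum>i\<in>I. f i x))" by (rule lipschitz_on_add)
  then show ?case using insert.hyps by auto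
qed (auto intro: lipschitz_on_constant)

text \<open>The coordinate expressions of a Riemannian metric and a 1-form. Besides the given metric on a
  chart, its pullback under a diffeomorphism is an instance, on the part of the chart
  where the map has a coordinate expression.\<close>

locale randers_data =
  fixes U :: "'e::euclidean_space set" and G :: "'e \<Rightarrow> 'e \<Rightarrow> 'e \<Rightarrow> real" and W :: "'e \<Rightarrow> 'e \<Rightarrow> real"
  assumes open_U: "open U"
    and inner_G: "x \<in> U \<Longrightarrow> inner_form (G x)"
    and C2_G: "Ck_on 2 U (\<lambda>x. G x u v)"
    and linear_W: "x \<in> U \<Longrightarrow> linear (W x)"
    and C2_W: "Ck_on 2 U (\<lambda>x. W x u)"
begin

definition DG :: "'e \<Rightarrow> 'e \<Rightarrow> 'e \<Rightarrow> 'e \<Rightarrow> real" where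
  "DG x w u v = frechet_derivative (\<lambda>y. G y u v) (at x) w"

definition DW :: "'e \<Rightarrow> 'e \<Rightarrow> 'e \<Rightarrow> real" where
  "DW x w u = frechet_derivative (\<lambda>y. W y u) (at x) w"

definition dW :: "'e \<Rightarrow> 'e \<Rightarrow> 'e \<Rightarrow> real" where
  "dW x u v = DW x u v - DW x v u"

lemmas G_sym = form_sym[OF inner_G]
lemmas G_simps = form_simps[OF inner_G]

lemma has_derivative_G: "x \<in> U \<Longrightarrow> ((\<lambda>y. G y u v) has_derivative (\<lambda>w. DG x w u v)) (at x)"
  unfolding DG_def by (rule Ck_on_2D(1)[OF C2_G])

lemma has_derivative_W: "x \<in> U \<Longrightarrow> ((\<lambda>y. W y u) has_derivative (\<lambda>w. DW x w u)) (at x)"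
  unfolding DW_def by (rule Ck_on_2D(1)[OF C2_W])

lemma C1_DG: "Ck_on 1 U (\<lambda>x. DG x w u v)" and C1_DW: "Ck_on 1 U (\<lambda>x. DW x w u)"
  unfolding DG_def DW_def by (rule Ck_on_2D(2)[OF C2_G], rule Ck_on_2D(2)[OF C2_W])

lemma linear_DG1: "x \<in> U \<Longrightarrow> linear (\<lambda>w. DG x w u v)"
  using has_derivative_G by (rule has_derivative_linear)

lemma linear_DW1: "x \<in> U \<Longrightarrow> linear (\<lambda>w. DW x w u)"
  using has_derivative_W by (rule has_derivative_linear)

lemma DG_eqI:
  assumes "x \<in> U" "(f has_derivative D) (at x)" "\<And>y. y \<in> U \<Longrightarrow> G y u v = f y"
  shows "DG x w u v = D w"
proof -
  have "((\<lambda>y. G y u v) has_derivative D) (at x)"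
    by (rule has_derivative_transform_within_open[OF assms(2) open_U assms(1)]) (simp add: assms(3))
  then show ?thesis using has_derivative_unique[OF has_derivative_G[OF assms(1)]] by metis
qed

lemma DW_eqI:
  assumes "x \<in> U" "(f has_derivative D) (at x)" "\<And>y. y \<in> U \<Longrightarrow> W y u = f y"
  shows "DW x w u = D w"
proof -
  have "((\<lambda>y. W y u) has_derivative D) (at x)"
    by (rule has_derivative_transform_within_open[OF assms(2) open_U assms(1)]) (simp add: assms(3))
  then show ?thesis using has_derivative_unique[OF has_derivative_W[OF assms(1)]] by metis
qed

lemma DG_sym: "x \<in> U \<Longrightarrow> DG x w u v = DG x w v u"
  by (rule DG_eqI[OF _ has_derivative_G]) (auto intro: G_sym)

lemma linear_DG2: assumes x: "x \<in> U" shows "linear (\<lambda>u. DG x w u v)"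
proof (rule linearI)
  show "DG x w (a + b) v = DG x w a v + DG x w b v" for a b
    by (rule DG_eqI[OF x has_derivative_add[OF has_derivative_G[OF x] has_derivative_G[OF x]]])
      (simp add: G_simps)
  show "DG x w (r *\<^sub>R a) v = r *\<^sub>R DG x w a v" for r a
    by (rule DG_eqI[OF x has_derivative_scaleR_right[OF has_derivative_G[OF x]]]) (simp add: G_simps)
qed

lemma linear_DG3: assumes x: "x \<in> U" shows "linear (DG x w u)"
  using linear_DG2[OF x, of w u] unfolding DG_sym[OF x, of w _ u] .

lemma linear_DW2: assumes x: "x \<in> U" shows "linear (DW x w)"
proof (rule linearI)
  show "DW x w (a + b) = DW x w a + DW x w b" for a b
    by (rule DW_eqI[OF x has_derivative_add[OF has_derivative_W[OF x] has_derivative_W[OF x]]])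
      (simp add: linear_add[OF linear_W])
  show "DW x w (r *\<^sub>R a) = r *\<^sub>R DW x w a" for r a
    by (rule DW_eqI[OF x has_derivative_scaleR_right[OF has_derivative_W[OF x]]])
      (simp add: linear_scale[OF linear_W])
qed

context fixes x assumes x: "x \<in> U" begin

lemmas D_simps =
  linear_add[OF linear_DG1[OF x]] linear_add[OF linear_DG2[OF x]] linear_add[OF linear_DG3[OF x]]
  linear_cmul[OF linear_DG1[OF x], unfolded real_scaleR_def]
  linear_cmul[OF linear_DG2[OF x], unfolded real_scaleR_def]
  linear_cmul[OF linear_DG3[OF x], unfolded real_scaleR_def]
  linear_neg[OF linear_DG1[OF x]] linear_neg[OF linear_DG2[OF x]] linear_neg[OF linear_DG3[OF x]]
  linear_add[OF linear_DW1[OF x]] linear_add[OF linear_DW2[OF x]]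
  linear_cmul[OF linear_DW1[OF x], unfolded real_scaleR_def]
  linear_cmul[OF linear_DW2[OF x], unfolded real_scaleR_def]
  linear_neg[OF linear_DW1[OF x]] linear_neg[OF linear_DW2[OF x]]
  linear_add[OF linear_W[OF x]] linear_cmul[OF linear_W[OF x], unfolded real_scaleR_def]

lemma G_expand: "G x u v = (\<Sum>i\<in>Basis. \<Sum>j\<in>Basis. (u \<bullet> i) * (v \<bullet> j) * G x i j)"
  by (rule bilinear_expand[OF form_linear[OF inner_G[OF x]] form_linear2[OF inner_G[OF x]]])

lemma DG_expand2: "DG x w u v = (\<Sum>i\<in>Basis. \<Sum>j\<in>Basis. (u \<bullet> i) * (v \<bullet> j) * DG x w i j)"
  by (rule bilinear_expand[OF linear_DG2[OF x] linear_DG3[OF x]])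

lemma DG_expand12: "DG x w u v = (\<Sum>i\<in>Basis. \<Sum>j\<in>Basis. (w \<bullet> i) * (u \<bullet> j) * DG x i j v)"
  by (rule bilinear_expand[of "\<lambda>w u. DG x w u v", OF linear_DG1[OF x] linear_DG2[OF x]])

lemma DG_expand: "DG x w u v =
    (\<Sum>i\<in>Basis. \<Sum>j\<in>Basis. (u \<bullet> i) * (v \<bullet> j) * (\<Sum>k\<in>Basis. (w \<bullet> k) * DG x k i j))"
proof -
  have "DG x w i j = (\<Sum>k\<in>Basis. (w \<bullet> k) * DG x k i j)" for i j
    by (rule linear_expand[OF linear_DG1[OF x]])
  then show ?thesis using DG_expand2[of w u v] by simp
qed

lemma DW_expand: "DW x w u = (\<Sum>k\<in>Basis. \<Sum>i\<in>Basis. (w \<bullet> k) * (u \<bullet> i) * DW x k i)"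
  by (rule bilinear_expand[OF linear_DW1[OF x] linear_DW2[OF x]])

lemma W_expand: "W x u = (\<Sum>i\<in>Basis. (u \<bullet> i) * W x i)"
  by (rule linear_expand[OF linear_W[OF x]])

end

lemma
  assumes "\<And>s. s \<in> S \<Longrightarrow> X s \<in> U" "continuous_on S X" "continuous_on S u" "continuous_on S v" "continuous_on S w"
  shows continuous_on_G: "continuous_on S (\<lambda>s. G (X s) (u s) (v s))"
    and continuous_on_DG: "continuous_on S (\<lambda>s. DG (X s) (w s) (u s) (v s))"
    and continuous_on_W: "continuous_on S (\<lambda>s. W (X s) (u s))"
    and continuous_on_DW: "continuous_on S (\<lambda>s. DW (X s) (w s) (u s))"
proof -
  have c: "continuous_on S (\<lambda>s. h (X s))" if "Ck_on k U h" for h :: "'e \<Rightarrow> real" and k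
    using Ck_on_continuous[OF that] assms(1,2) by (intro continuous_on_compose2[of U h S X]) auto
  have [continuous_intros]: "continuous_on S (\<lambda>s. G (X s) i j)" "continuous_on S (\<lambda>s. DG (X s) k i j)"
    "continuous_on S (\<lambda>s. W (X s) i)" "continuous_on S (\<lambda>s. DW (X s) k i)" for i j k
    by (rule c, rule C2_G C1_DG C2_W C1_DW)+
  show "continuous_on S (\<lambda>s. G (X s) (u s) (v s))"
    by (subst continuous_on_cong[OF refl G_expand[OF assms(1)]], assumption) (intro continuous_intros assms)
  show "continuous_on S (\<lambda>s. DG (X s) (w s) (u s) (v s))"
    by (subst continuous_on_cong[OF refl DG_expand[OF assms(1)]], assumption) (intro continuous_intros assms)
  show "continuous_on S (\<lambda>s. W (X s) (u s))"
    by (subst continuous_on_cong[OF refl W_expand[OF assms(1)]], assumption) (intro continuous_intros assms)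
  show "continuous_on S (\<lambda>s. DW (X s) (w s) (u s))"
    by (subst continuous_on_cong[OF refl DW_expand[OF assms(1)]], assumption) (intro continuous_intros assms)
qed

text \<open>The product rule for a form with moving base point and moving arguments. Sets \<open>S\<close> other than
  open ones occur as intervals with end points.\<close>

lemma
  fixes X u v :: "real \<Rightarrow> 'e"
  assumes S: "\<And>s. s \<in> S \<Longrightarrow> X s \<in> U" "t \<in> S"
    and X: "(X has_vector_derivative X') (at t within S)" and u: "(u has_vector_derivative u') (at t within S)"
    and v: "(v has_vector_derivative v') (at t within S)"
  shows has_derivative_G_along: "((\<lambda>s. G (X s) (u s) (v s)) has_real_derivative
        DG (X t) X' (u t) (v t) + G (X t) u' (v t) + G (X t) (u t) v') (at t within S)"
    and has_derivative_W_along: "((\<lambda>s. W (X s) (u s)) has_real_derivative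
        DW (X t) X' (u t) + W (X t) u') (at t within S)"
proof -
  have Xt: "X t \<in> U" using S by blast
  have comp: "((\<lambda>s. h (X s)) has_real_derivative D X') (at t within S)"
    if "(h has_derivative D) (at (X t))" for h :: "'e \<Rightarrow> real" and D
  proof -
    have "((\<lambda>s. h (X s)) has_derivative (\<lambda>k. D (k *\<^sub>R X'))) (at t within S)"
      using has_derivative_compose[OF X[unfolded has_vector_derivative_def] that] .
    then show ?thesis
      by (rule has_derivative_imp_has_field_derivative)
        (simp add: linear_cmul[OF has_derivative_linear[OF that]])
  qed
  have inn: "((\<lambda>s. u s \<bullet> i) has_real_derivative u' \<bullet> i) (at t within S)"
    "((\<lambda>s. v s \<bullet> i) has_real_derivative v' \<bullet> i) (at t within S)" for i
    using bounded_linear.has_vector_derivative[OF bounded_linear_inner_left u, of i]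
      bounded_linear.has_vector_derivative[OF bounded_linear_inner_left v, of i]
    by (simp_all add: has_real_derivative_iff_has_vector_derivative)
  have "((\<lambda>s. \<Sum>i\<in>Basis. \<Sum>j\<in>Basis. (u s \<bullet> i) * (v s \<bullet> j) * G (X s) i j) has_real_derivative
     (\<Sum>i\<in>Basis. \<Sum>j\<in>Basis. (u t \<bullet> i) * (v t \<bullet> j) * DG (X t) X' i j +
       ((u t \<bullet> i) * (v' \<bullet> j) + (u' \<bullet> i) * (v t \<bullet> j)) * G (X t) i j)) (at t within S)"
    by (intro DERIV_sum DERIV_mult' inn comp[OF has_derivative_G[OF Xt]])
  also have "(\<Sum>i\<in>Basis. \<Sum>j\<in>Basis. (u t \<bullet> i) * (v t \<bullet> j) * DG (X t) X' i j +
       ((u t \<bullet> i) * (v' \<bullet> j) + (u' \<bullet> i) * (v t \<bullet> j)) * G (X t) i j) =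
     DG (X t) X' (u t) (v t) + G (X t) u' (v t) + G (X t) (u t) v'"
  proof -
    show ?thesis
      by (simp add: G_expand[OF Xt, of u'] G_expand[OF Xt, of _ v'] DG_expand2[OF Xt, of _ "u t"]
          sum.distrib algebra_simps)
  qed
  finally have d: "((\<lambda>s. \<Sum>i\<in>Basis. \<Sum>j\<in>Basis. (u s \<bullet> i) * (v s \<bullet> j) * G (X s) i j) has_real_derivative
     DG (X t) X' (u t) (v t) + G (X t) u' (v t) + G (X t) (u t) v') (at t within S)" .
  show "((\<lambda>s. G (X s) (u s) (v s)) has_real_derivative
        DG (X t) X' (u t) (v t) + G (X t) u' (v t) + G (X t) (u t) v') (at t within S)"
    by (rule has_real_derivative_transform_on[rotated 2, OF d]) (auto intro: G_expand S)
  have "((\<lambda>s. \<Sum>i\<in>Basis. (u s \<bullet> i) * W (X s) i) has_real_derivative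
     (\<Sum>i\<in>Basis. (u t \<bullet> i) * DW (X t) X' i + (u' \<bullet> i) * W (X t) i)) (at t within S)"
    by (intro DERIV_sum DERIV_mult' inn comp[OF has_derivative_W[OF Xt]])
  also have "(\<Sum>i\<in>Basis. (u t \<bullet> i) * DW (X t) X' i + (u' \<bullet> i) * W (X t) i) = DW (X t) X' (u t) + W (X t) u'"
    by (simp add: W_expand[OF Xt, of u'] linear_expand[OF linear_DW2[OF Xt], of _ "u t"] sum.distrib)
  finally have d: "((\<lambda>s. \<Sum>i\<in>Basis. (u s \<bullet> i) * W (X s) i) has_real_derivative
     DW (X t) X' (u t) + W (X t) u') (at t within S)" .
  show "((\<lambda>s. W (X s) (u s)) has_real_derivative DW (X t) X' (u t) + W (X t) u') (at t within S)"
    by (rule has_real_derivative_transform_on[rotated 2, OF d]) (auto intro: W_expand S)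
qed


subsection \<open>The Euler-Lagrange expression and the magnetic geodesic equation\<close>

definition lagr :: "'e \<Rightarrow> 'e \<Rightarrow> real" where
  "lagr x v = sqrt (G x v v) + W x v"

definition speed :: "'e \<Rightarrow> 'e \<Rightarrow> real" where
  "speed x v = sqrt (G x v v)"

text \<open>The covector \<open>\<partial>L/\<partial>x - d/dt \<partial>L/\<partial>v\<close> for \<open>L = lagr\<close>, evaluated at \<open>w\<close>, along a curve with position
  \<open>x\<close>, velocity \<open>v\<close> and acceleration \<open>a\<close>.\<close>

definition euler_lagrange :: "'e \<Rightarrow> 'e \<Rightarrow> 'e \<Rightarrow> 'e \<Rightarrow> real" where
  "euler_lagrange x v a w = (DG x w v v / 2 - DG x v v w - G x a w) / speed x v
     + G x v w * (DG x v v v / 2 + G x a v) / speed x v ^ 3 + dW x w v"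

text \<open>
  In parametrizations of constant speed \<open>\<nu>\<close> the Euler-Lagrange equation is
  \<open>G (x'', w) = force \<nu> x x' w\<close>. With \<open>\<nu>\<close> as a parameter in place of \<open>|v|\<close> the right hand side is a
  polynomial in \<open>v\<close>, also at \<open>v = 0\<close>, and solutions of initial speed \<open>\<nu>\<close> keep that speed.
\<close>

definition force :: "real \<Rightarrow> 'e \<Rightarrow> 'e \<Rightarrow> 'e \<Rightarrow> real" where
  "force \<nu> x v w = DG x w v v / 2 - DG x v v w + \<nu> * dW x w v"

definition acc :: "real \<Rightarrow> 'e \<Rightarrow> 'e \<Rightarrow> 'e" where
  "acc \<nu> x v = riesz (G x) (force \<nu> x v)"

definition \<Gamma> :: "'e \<Rightarrow> 'e \<Rightarrow> 'e \<Rightarrow> 'e" where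
  "\<Gamma> x u v = riesz (G x) (\<lambda>w. (DG x u v w + DG x v u w - DG x w u v) / 2)"

definition J :: "'e \<Rightarrow> 'e \<Rightarrow> 'e" where
  "J x v = riesz (G x) (\<lambda>w. dW x w v)"

lemma speed_pos: "x \<in> U \<Longrightarrow> v \<noteq> 0 \<Longrightarrow> speed x v > 0"
  using form_pos[OF inner_G] by (auto simp: speed_def)

context fixes x assumes x: "x \<in> U" begin

lemma linear_dW: "linear (\<lambda>w. dW x w v)" "linear (dW x v)"
  by (auto simp: dW_def D_simps[OF x] algebra_simps intro!: linearI)

lemma dW_self: "dW x u u = 0" by (simp add: dW_def)

lemma G_acc: "G x (acc \<nu> x v) w = force \<nu> x v w" unfolding acc_def
  by (rule form_riesz[OF inner_G[OF x]])
    (auto intro!: linearI simp: force_def D_simps[OF x] dW_def algebra_simps add_divide_distrib)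

lemma G_\<Gamma>: "G x (\<Gamma> x u v) w = (DG x u v w + DG x v u w - DG x w u v) / 2" unfolding \<Gamma>_def
  by (rule form_riesz[OF inner_G[OF x]])
    (auto intro!: linearI simp: D_simps[OF x] algebra_simps add_divide_distrib diff_divide_distrib)

lemma G_J: "G x (J x v) w = dW x w v" unfolding J_def
  by (rule form_riesz[OF inner_G[OF x] linear_dW(1)])

lemma acc_eq: "acc \<nu> x v = \<nu> *\<^sub>R J x v - \<Gamma> x v v"
  by (rule form_unique[OF inner_G[OF x]])
    (simp add: G_acc G_\<Gamma> G_J G_simps[OF x] force_def field_simps)

lemma linear_J: "linear (J x)"
  by (rule linearI; rule form_unique[OF inner_G[OF x]])
    (simp_all add: G_J G_simps[OF x] linear_add[OF linear_dW(2)] linear_cmul[OF linear_dW(2)])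

lemma linear_\<Gamma>: "linear (\<Gamma> x u)"
  by (rule linearI; rule form_unique[OF inner_G[OF x]])
    (simp_all add: G_\<Gamma> G_simps[OF x] D_simps[OF x] field_simps)

lemma \<Gamma>_sym: "\<Gamma> x u v = \<Gamma> x v u"
  by (rule form_unique[OF inner_G[OF x]]) (simp add: G_\<Gamma> G_simps[OF x] DG_sym[OF x, of _ u v])

lemma J_skew: "G x (J x v) v = 0" by (simp add: G_J dW_self)

lemma euler_lagrange_acc:
  assumes "v \<noteq> 0" shows "euler_lagrange x v (acc (speed x v) x v) w = 0"
  using speed_pos[OF x assms]
  by (simp add: euler_lagrange_def G_acc force_def dW_self field_simps)

text \<open>Length is invariant under reparametrization, so the Euler-Lagrange equation leaves the
  tangential part of the acceleration undetermined.\<close>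

lemma acc_of_euler_lagrange:
  assumes v: "v \<noteq> 0" and el: "\<And>w. euler_lagrange x v a w = 0"
  shows "\<exists>m. a = acc (speed x v) x v + m *\<^sub>R v"
proof -
  let ?N = "speed x v"
  define m where "m = (DG x v v v / 2 + G x a v) / ?N\<^sup>2"
  have N: "?N > 0" by (rule speed_pos[OF x v])
  have "a = acc ?N x v + m *\<^sub>R v"
  proof (rule form_unique[OF inner_G[OF x]])
    fix w
    have "0 = ?N * euler_lagrange x v a w" by (simp add: el)
    also have "\<dots> = DG x w v v / 2 - DG x v v w - G x a w + m * G x v w + ?N * dW x w v"
      using N by (simp add: euler_lagrange_def m_def field_simps power2_eq_square power3_eq_cube)
    finally show "G x a w = G x (acc ?N x v + m *\<^sub>R v) w"
      by (simp add: G_simps[OF x] G_acc force_def)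
  qed
  then show ?thesis ..
qed

end


subsection \<open>Existence of magnetic geodesics\<close>

lemma coercive_on_compact:
  assumes K: "compact K" "K \<subseteq> U"
  shows "\<exists>m>0. \<forall>x\<in>K. \<forall>v. m * (norm v)\<^sup>2 \<le> G x v v"
proof (cases "K = {}")
  case False
  obtain b :: 'e where b: "b \<in> Basis" using nonempty_Basis by blast
  have cont: "continuous_on (K \<times> sphere 0 1) (\<lambda>z. G (fst z) (snd z) (snd z))"
    using K by (intro continuous_on_G[where w=snd] continuous_intros) auto
  have ne: "compact (K \<times> sphere (0::'e) 1)" "K \<times> sphere (0::'e) 1 \<noteq> {}"
    using K False b by (auto intro!: compact_Times exI[of _ b])
  obtain z where z: "z \<in> K \<times> sphere 0 1"
    "\<And>y. y \<in> K \<times> sphere 0 1 \<Longrightarrow> G (fst z) (snd z) (snd z) \<le> G (fst y) (snd y) (snd y)"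
    using continuous_attains_inf[OF ne cont] by blast
  define m where "m = G (fst z) (snd z) (snd z)"
  have "fst z \<in> U" "snd z \<noteq> 0" using z K by auto
  then have "m > 0" unfolding m_def using form_pos[OF inner_G] by blast
  moreover have "m * (norm v)\<^sup>2 \<le> G x v v" if x: "x \<in> K" for x v
  proof (cases "v = 0")
    case False
    have "m \<le> G x ((1 / norm v) *\<^sub>R v) ((1 / norm v) *\<^sub>R v)"
      using z(2)[of "(x, (1 / norm v) *\<^sub>R v)"] x False by (simp add: m_def)
    then show ?thesis using False x K G_simps[of x] by (simp add: subset_eq field_simps power2_eq_square)
  qed (use x K G_simps[of x] in auto)
  ultimately show ?thesis by blast
qed (auto intro: exI[of _ 1])

text \<open>
  The coefficients of \<open>G\<close> and of the force are Lipschitz continuous. For \<open>a = acc \<nu> y u\<close> and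
  \<open>b = acc \<nu> z v\<close> this passes to \<open>a - b\<close> by testing the difference of the defining equations
  against \<open>a - b\<close> itself: coercivity of \<open>G y\<close> bounds \<open>|a - b|\<^sup>2\<close> from below, which avoids
  estimates for the inverse matrix of \<open>G\<close>.
\<close>

lemma acc_lipschitz:
  assumes K: "compact K" "convex K" "K \<subseteq> U"
  shows "\<exists>L. L-lipschitz_on (K \<times> cball 0 V) (\<lambda>z. acc \<nu> (fst z) (snd z))"
proof -
  let ?K = "K \<times> cball (0::'e) V"
  have cK: "compact ?K" using K by (intro compact_Times) auto
  have fstL: "\<exists>L. L-lipschitz_on ?K (\<lambda>z. h (fst z))" if h: "Ck_on (Suc k) U h" for h :: "'e \<Rightarrow> real" and k
  proof -
    obtain L where L: "L-lipschitz_on K h" using Ck_on_one_lipschitz[OF h K] by blast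
    have "L-lipschitz_on ?K (\<lambda>z. h (fst z))"
    proof (rule lipschitz_onI)
      fix y z assume "y \<in> ?K" "z \<in> ?K"
      then have "dist (h (fst y)) (h (fst z)) \<le> L * dist (fst y) (fst z)" by (intro lipschitz_onD[OF L]) auto
      also have "\<dots> \<le> L * dist y z" using lipschitz_on_nonneg[OF L] by (intro mult_left_mono dist_fst_le)
      finally show "dist (h (fst y)) (h (fst z)) \<le> L * dist y z" .
    qed (rule lipschitz_on_nonneg[OF L])
    then show ?thesis ..
  qed
  have GL: "\<exists>L. L-lipschitz_on ?K (\<lambda>z. G (fst z) i j)" for i j
    using C2_G[of i j] by (intro fstL[of 1]) (simp add: numeral_2_eq_2)
  have DGL: "\<exists>L. L-lipschitz_on ?K (\<lambda>z. DG (fst z) k i j)" for k i j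
    using C1_DG[of k i j] by (intro fstL[of 0]) simp
  have DWL: "\<exists>L. L-lipschitz_on ?K (\<lambda>z. DW (fst z) k i)" for k i
    using C1_DW[of k i] by (intro fstL[of 0]) simp
  have sndL: "\<exists>L. L-lipschitz_on ?K (\<lambda>z. snd z \<bullet> i)" if i: "i \<in> Basis" for i
  proof -
    have "1-lipschitz_on ?K (\<lambda>z. snd z \<bullet> i)"
    proof (rule lipschitz_onI)
      fix y z :: "'e \<times> 'e"
      have "dist (snd y \<bullet> i) (snd z \<bullet> i) \<le> dist (snd y) (snd z)"
        using Basis_le_norm[OF i, of "snd y - snd z"] by (simp add: dist_norm inner_diff_left)
      also have "\<dots> \<le> dist y z" by (rule dist_snd_le)
      finally show "dist (snd y \<bullet> i) (snd z \<bullet> i) \<le> 1 * dist y z" by simp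
    qed simp
    then show ?thesis ..
  qed
  have cL: "\<exists>L. L-lipschitz_on ?K (\<lambda>z. c)" for c :: real by (blast intro: lipschitz_on_constant)
  note mL = lipschitz_on_mult_compact[OF cK]
  have FL: "\<exists>L. L-lipschitz_on ?K (\<lambda>z. force \<nu> (fst z) (snd z) b)" for b
  proof -
    have e: "force \<nu> x v b =
       (\<Sum>i\<in>Basis. \<Sum>j\<in>Basis. (1 / 2) * (v \<bullet> i) * (v \<bullet> j) * DG x b i j) +
       (\<Sum>i\<in>Basis. \<Sum>j\<in>Basis. (- 1) * (v \<bullet> i) * (v \<bullet> j) * DG x i j b) +
       (\<Sum>i\<in>Basis. \<nu> * (v \<bullet> i) * DW x b i) + (\<Sum>i\<in>Basis. (- \<nu>) * (v \<bullet> i) * DW x i b)"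
      if x: "x \<in> U" for x v
    proof -
      have "DG x b v v = (\<Sum>i\<in>Basis. \<Sum>j\<in>Basis. (v \<bullet> i) * (v \<bullet> j) * DG x b i j)"
        by (rule DG_expand2[OF x])
      moreover have "DG x v v b = (\<Sum>i\<in>Basis. \<Sum>j\<in>Basis. (v \<bullet> i) * (v \<bullet> j) * DG x i j b)"
        by (rule DG_expand12[OF x])
      moreover have "DW x b v = (\<Sum>i\<in>Basis. (v \<bullet> i) * DW x b i)"
        by (rule linear_expand[OF linear_DW2[OF x]])
      moreover have "DW x v b = (\<Sum>i\<in>Basis. (v \<bullet> i) * DW x i b)"
        by (rule linear_expand[OF linear_DW1[OF x]])
      ultimately show ?thesis
        by (simp add: force_def dW_def sum_distrib_left sum_negf sum_divide_distrib algebra_simps)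
    qed
    have add: "\<exists>L. L-lipschitz_on ?K (\<lambda>z. f z + g z)"
      if "\<exists>L. L-lipschitz_on ?K f" "\<exists>L. L-lipschitz_on ?K g" for f g :: "'e \<times> 'e \<Rightarrow> real"
      using that lipschitz_on_add by blast
    have "\<exists>L. L-lipschitz_on ?K (\<lambda>z.
       (\<Sum>i\<in>Basis. \<Sum>j\<in>Basis. (1 / 2) * (snd z \<bullet> i) * (snd z \<bullet> j) * DG (fst z) b i j) +
       (\<Sum>i\<in>Basis. \<Sum>j\<in>Basis. (- 1) * (snd z \<bullet> i) * (snd z \<bullet> j) * DG (fst z) i j b) +
       (\<Sum>i\<in>Basis. \<nu> * (snd z \<bullet> i) * DW (fst z) b i) + (\<Sum>i\<in>Basis. (- \<nu>) * (snd z \<bullet> i) * DW (fst z) i b))"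
      by (intro add lipschitz_on_ex_sum mL sndL cL DGL DWL) assumption+
    then obtain L where L: "L-lipschitz_on ?K (\<lambda>z.
       (\<Sum>i\<in>Basis. \<Sum>j\<in>Basis. (1 / 2) * (snd z \<bullet> i) * (snd z \<bullet> j) * DG (fst z) b i j) +
       (\<Sum>i\<in>Basis. \<Sum>j\<in>Basis. (- 1) * (snd z \<bullet> i) * (snd z \<bullet> j) * DG (fst z) i j b) +
       (\<Sum>i\<in>Basis. \<nu> * (snd z \<bullet> i) * DW (fst z) b i) + (\<Sum>i\<in>Basis. (- \<nu>) * (snd z \<bullet> i) * DW (fst z) i b))" ..
    have "L-lipschitz_on ?K (\<lambda>z. force \<nu> (fst z) (snd z) b)"
      by (rule lipschitz_on_transform[OF L]) (use K e in auto)
    then show ?thesis ..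
  qed
  obtain LG where LG: "\<And>i j. (LG i j)-lipschitz_on ?K (\<lambda>z. G (fst z) i j)" using GL by metis
  obtain LF where LF: "\<And>b. (LF b)-lipschitz_on ?K (\<lambda>z. force \<nu> (fst z) (snd z) b)" using FL by metis
  obtain m where m: "m > 0" "\<And>x v. x \<in> K \<Longrightarrow> m * (norm v)\<^sup>2 \<le> G x v v"
    using coercive_on_compact[OF K(1,3)] by blast
  have linF: "linear (force \<nu> x v)" if "x \<in> U" for x v
    using G_acc[OF that, of \<nu> v] form_linear2[OF inner_G[OF that], of "acc \<nu> x v"] by (metis (no_types, lifting) ext)
  have "\<exists>B\<ge>0. \<forall>z\<in>?K. \<bar>force \<nu> (fst z) (snd z) b\<bar> \<le> B" for b
  proof -
    have "bounded ((\<lambda>z. force \<nu> (fst z) (snd z) b) ` ?K)"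
      using compact_continuous_image[OF lipschitz_on_continuous_on[OF LF] cK] compact_imp_bounded by blast
    then obtain B where "\<forall>z\<in>?K. \<bar>force \<nu> (fst z) (snd z) b\<bar> \<le> B" unfolding bounded_iff by auto
    then show ?thesis by (intro exI[of _ "\<bar>B\<bar>"]) force
  qed
  then obtain B where B: "\<And>b. B b \<ge> 0" "\<And>b z. z \<in> ?K \<Longrightarrow> \<bar>force \<nu> (fst z) (snd z) b\<bar> \<le> B b" by metis
  have linb: "\<bar>l w\<bar> \<le> norm w * (\<Sum>b\<in>Basis. c b)" if "linear l" "\<And>b. b \<in> Basis \<Longrightarrow> \<bar>l b\<bar> \<le> c b"
    for l :: "'e \<Rightarrow> real" and w c
  proof -
    have "\<bar>l w\<bar> \<le> (\<Sum>b\<in>Basis. \<bar>(w \<bullet> b) * l b\<bar>)"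
      using linear_expand[OF that(1), of w] sum_abs by metis
    also have "\<dots> \<le> (\<Sum>b\<in>Basis. norm w * c b)"
      unfolding abs_mult by (intro sum_mono mult_mono that Basis_le_norm) auto
    finally show ?thesis by (simp add: sum_distrib_left)
  qed
  define A where "A = (\<Sum>b\<in>Basis. B b) / m"
  have A: "norm (acc \<nu> (fst z) (snd z)) \<le> A" if z: "z \<in> ?K" for z
  proof -
    let ?a = "acc \<nu> (fst z) (snd z)"
    have zU: "fst z \<in> U" and zK: "fst z \<in> K" using z K by auto
    have "m * (norm ?a)\<^sup>2 \<le> force \<nu> (fst z) (snd z) ?a" using m(2)[OF zK, of ?a] G_acc[OF zU] by simp
    also have "\<dots> \<le> norm ?a * (\<Sum>b\<in>Basis. B b)" using linb[OF linF[OF zU] B(2)[OF z], of ?a] by simp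
    finally have "norm ?a * (m * norm ?a) \<le> norm ?a * (\<Sum>b\<in>Basis. B b)" by (simp add: power2_eq_square mult_ac)
    then have "m * norm ?a \<le> (\<Sum>b\<in>Basis. B b)" using B(1) by (cases "?a = 0") (auto simp: sum_nonneg)
    then show ?thesis using m(1) by (simp add: A_def field_simps)
  qed
  define L where "L = ((\<Sum>b\<in>Basis. LF b) + (\<Sum>b\<in>Basis. \<Sum>i\<in>Basis. A * LG i b)) / m"
  have A0: "A \<ge> 0" using B(1) m(1) by (simp add: A_def sum_nonneg)
  have nn: "LF b \<ge> 0" "LG i j \<ge> 0" for b i j using lipschitz_on_nonneg LF LG by blast+
  have "L-lipschitz_on ?K (\<lambda>z. acc \<nu> (fst z) (snd z))"
  proof (rule lipschitz_onI)
    show "L \<ge> 0" using m(1) A0 nn by (auto simp: L_def intro!: divide_nonneg_pos add_nonneg_nonneg sum_nonneg)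
    fix y z assume y: "y \<in> ?K" and z: "z \<in> ?K"
    let ?a = "acc \<nu> (fst y) (snd y)" and ?b = "acc \<nu> (fst z) (snd z)"
    let ?w = "?a - ?b" and ?d = "dist y z"
    have U: "fst y \<in> U" "fst z \<in> U" "fst y \<in> K" using y z K by auto
    have "m * (norm ?w)\<^sup>2 \<le> G (fst y) ?w ?w" by (rule m(2)[OF U(3)])
    also have "\<dots> = (force \<nu> (fst y) (snd y) ?w - force \<nu> (fst z) (snd z) ?w) + (G (fst z) ?b ?w - G (fst y) ?b ?w)"
      by (simp add: G_acc[OF U(1), symmetric] G_acc[OF U(2), symmetric] G_simps(3)[OF U(1), of ?a ?b ?w])
    also have "\<dots> \<le> norm ?w * (\<Sum>b\<in>Basis. LF b * ?d) + norm ?w * (\<Sum>b\<in>Basis. \<Sum>i\<in>Basis. A * (LG i b * ?d))"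
    proof (rule add_mono; rule order_trans[OF abs_ge_self])
      show "\<bar>force \<nu> (fst y) (snd y) ?w - force \<nu> (fst z) (snd z) ?w\<bar> \<le> norm ?w * (\<Sum>b\<in>Basis. LF b * ?d)"
      proof (rule linb)
        show "linear (\<lambda>w. force \<nu> (fst y) (snd y) w - force \<nu> (fst z) (snd z) w)"
          by (intro linear_compose_sub linF U)
      qed (use lipschitz_onD[OF LF y z] in \<open>simp add: dist_real_def\<close>)
      show "\<bar>G (fst z) ?b ?w - G (fst y) ?b ?w\<bar> \<le> norm ?w * (\<Sum>b\<in>Basis. \<Sum>i\<in>Basis. A * (LG i b * ?d))"
      proof (rule linb)
        show "linear (\<lambda>w. G (fst z) ?b w - G (fst y) ?b w)"
          by (intro linear_compose_sub form_linear2 inner_G U)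
        fix b :: 'e assume "b \<in> Basis"
        have "\<bar>G (fst z) ?b b - G (fst y) ?b b\<bar> \<le> norm ?b * (\<Sum>i\<in>Basis. LG i b * ?d)"
        proof (rule linb)
          show "linear (\<lambda>u. G (fst z) u b - G (fst y) u b)"
            by (intro linear_compose_sub form_linear inner_G U)
        qed (use lipschitz_onD[OF LG z y] in \<open>simp add: dist_real_def dist_commute\<close>)
        also have "\<dots> \<le> A * (\<Sum>i\<in>Basis. LG i b * ?d)"
          using A[OF z] nn by (intro mult_right_mono sum_nonneg mult_nonneg_nonneg) auto
        finally show "\<bar>G (fst z) ?b b - G (fst y) ?b b\<bar> \<le> (\<Sum>i\<in>Basis. A * (LG i b * ?d))"
          by (simp add: sum_distrib_left)
      qed
    qed
    also have "\<dots> = norm ?w * (m * (L * ?d))" using m(1)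
      by (simp add: L_def distrib_left sum_distrib_left sum_distrib_right field_simps)
    finally have "norm ?w * (m * norm ?w) \<le> norm ?w * (m * (L * ?d))" by (simp add: power2_eq_square mult_ac)
    then have "norm ?w \<le> L * ?d" using m(1) \<open>L \<ge> 0\<close> by (cases "?w = 0") auto
    then show "dist ?a ?b \<le> L * ?d" by (simp add: dist_norm)
  qed
  then show ?thesis ..
qed

end

lemma vector_derivative_mean_value_bound:
  fixes f :: "real \<Rightarrow> 'b::real_normed_vector"
  assumes "\<And>t. t \<in> {a..b} \<Longrightarrow> (f has_vector_derivative f' t) (at t within {a..b})"
    and "\<And>t. t \<in> {a..b} \<Longrightarrow> norm (f' t) \<le> B" and "x \<in> {a..b}" "y \<in> {a..b}"
  shows "norm (f x - f y) \<le> B * \<bar>x - y\<bar>"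
proof -
  have "norm (f x - f y) \<le> B * norm (x - y)"
  proof (rule differentiable_bound[where f'="\<lambda>t h. h *\<^sub>R f' t"])
    show "onorm (\<lambda>h. h *\<^sub>R f' t) \<le> B" if "t \<in> {a..b}" for t
      using assms(2)[OF that] by (intro onorm_le) (simp add: mult.commute[of B] mult_left_mono)
  qed (use assms in \<open>auto simp: has_vector_derivative_def\<close>)
  then show ?thesis by simp
qed

context randers_data
begin

text \<open>The time \<open>\<tau>\<close> and the bound \<open>M\<close> are the same for all initial points near \<open>x0\<close>; unique continuation
  needs geodesics of a definite length from points close to the boundary of a region.\<close>

lemma magnetic_geodesics_exist:
  assumes x0: "x0 \<in> U" and V: "V > 0"
  obtains \<rho> \<tau> M where "\<rho> > 0" "\<tau> > 0" "M > 0" "cball x0 (2 * \<rho>) \<subseteq> U"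
    "\<And>q u. q \<in> cball x0 \<rho> \<Longrightarrow> norm u \<le> V \<Longrightarrow> \<exists>X Y. X 0 = q \<and> Y 0 = u \<and> (\<forall>t\<in>{0..\<tau>}.
       X t \<in> cball x0 (2 * \<rho>) \<and> norm (Y t) \<le> V + 1 \<and> norm (acc \<nu> (X t) (Y t)) \<le> M \<and>
       (X has_vector_derivative Y t) (at t within {0..\<tau>}) \<and>
       (Y has_vector_derivative acc \<nu> (X t) (Y t)) (at t within {0..\<tau>}))"
proof -
  obtain r where r: "r > 0" "cball x0 r \<subseteq> U" using open_U x0 open_contains_cball by blast
  define \<rho> where "\<rho> = r / 2"
  have \<rho>: "\<rho> > 0" "cball x0 (2 * \<rho>) \<subseteq> U" using r by (auto simp: \<rho>_def)
  define K where "K = cball x0 (2 * \<rho>) \<times> cball (0::'e) (V + 1)"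
  define f where "f = (\<lambda>z. (snd z, acc \<nu> (fst z) (snd z)))"
  obtain L where L: "L-lipschitz_on K (\<lambda>z. acc \<nu> (fst z) (snd z))"
    using acc_lipschitz[of "cball x0 (2 * \<rho>)" "V + 1" \<nu>] \<rho> unfolding K_def by auto
  have "1-lipschitz_on K (\<lambda>z. snd z)"
    by (rule lipschitz_onI) (auto intro: dist_snd_le)
  then obtain L' where L': "L'-lipschitz_on K f"
    unfolding f_def using lipschitz_on_Pair[OF _ L] by blast
  have L'0: "L' \<ge> 0" by (rule lipschitz_on_nonneg[OF L'])
  have "compact K" unfolding K_def by (intro compact_Times) auto
  then have "bounded (f ` K)"
    using compact_continuous_image[OF lipschitz_on_continuous_on[OF L']] compact_imp_bounded by blast
  then obtain M0 where M0: "\<And>z. z \<in> K \<Longrightarrow> norm (f z) \<le> M0" unfolding bounded_iff by auto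
  define M where "M = \<bar>M0\<bar> + 1"
  have M: "M > 0" "\<And>z. z \<in> K \<Longrightarrow> norm (f z) \<le> M" using M0 by (fastforce simp: M_def)+
  \<comment> \<open>a ball of radius \<open>R\<close> around any admissible initial value stays in \<open>K\<close>\<close>
  define R where "R = min \<rho> 1"
  have R: "R > 0" "R \<le> \<rho>" "R \<le> 1" using \<rho> by (auto simp: R_def)
  define \<tau> where "\<tau> = min (R / M) (1 / (2 * L' + 2))"
  have \<tau>: "\<tau> > 0" "\<tau> * M \<le> R" "\<tau> * L' < 1"
  proof -
    show "\<tau> > 0" using R M L'0 by (simp add: \<tau>_def)
    have "\<tau> * M \<le> (R / M) * M" unfolding \<tau>_def using M by (intro mult_right_mono) auto
    then show "\<tau> * M \<le> R" using M by simp
    have "\<tau> * L' \<le> (1 / (2 * L' + 2)) * L'" unfolding \<tau>_def using L'0 by (intro mult_right_mono) auto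
    also have "\<dots> < 1" using L'0 by (simp add: field_simps)
    finally show "\<tau> * L' < 1" .
  qed
  show thesis
  proof (rule that[of \<rho> \<tau> M, OF \<rho>(1) \<tau>(1) M(1) \<rho>(2)])
    fix q u :: 'e assume q: "q \<in> cball x0 \<rho>" and u: "norm u \<le> V"
    have sub: "cball (q, u) R \<subseteq> K"
    proof
      fix z assume "z \<in> cball (q, u) R"
      then have z: "dist q (fst z) \<le> R" "dist u (snd z) \<le> R"
        using dist_fst_le[of "(q, u)" z] dist_snd_le[of "(q, u)" z] by auto
      have "dist x0 (fst z) \<le> 2 * \<rho>" using dist_triangle[of x0 "fst z" q] q z(1) R by auto
      moreover have "norm (snd z) \<le> V + 1"
        using norm_triangle_ineq2[of "snd z" u] z(2) u R by (simp add: dist_norm norm_minus_commute)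
      ultimately show "z \<in> K" by (simp add: K_def mem_Times_iff)
    qed
    obtain z where z: "z 0 = (q, u)" "\<And>t. t \<in> {0..\<tau>} \<Longrightarrow> z t \<in> cball (q, u) R"
      "\<And>t. t \<in> {0..\<tau>} \<Longrightarrow> (z has_vector_derivative f (z t)) (at t within {0..\<tau>})"
      using picard_lindelof[OF R(1) L'0 \<tau> lipschitz_on_subset[OF L' sub]] M(2) sub by blast
    show "\<exists>X Y. X 0 = q \<and> Y 0 = u \<and> (\<forall>t\<in>{0..\<tau>}.
       X t \<in> cball x0 (2 * \<rho>) \<and> norm (Y t) \<le> V + 1 \<and> norm (acc \<nu> (X t) (Y t)) \<le> M \<and>
       (X has_vector_derivative Y t) (at t within {0..\<tau>}) \<and>
       (Y has_vector_derivative acc \<nu> (X t) (Y t)) (at t within {0..\<tau>}))"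
    proof (rule exI[of _ "\<lambda>t. fst (z t)"], rule exI[of _ "\<lambda>t. snd (z t)"], intro conjI ballI)
      fix t assume t: "t \<in> {0..\<tau>}"
      have "z t \<in> K" using z(2)[OF t] sub by blast
      then show "fst (z t) \<in> cball x0 (2 * \<rho>)" "norm (snd (z t)) \<le> V + 1" by (auto simp: K_def)
      have "norm (acc \<nu> (fst (z t)) (snd (z t))) \<le> norm (f (z t))"
        unfolding f_def by (rule norm_snd_le[of "acc _ _ _", simplified] | simp add: norm_Pair)+
      then show "norm (acc \<nu> (fst (z t)) (snd (z t))) \<le> M" using M(2)[OF \<open>z t \<in> K\<close>] by linarith
      show "((\<lambda>t. fst (z t)) has_vector_derivative snd (z t)) (at t within {0..\<tau>})"
        using bounded_linear.has_vector_derivative[OF bounded_linear_fst z(3)[OF t]] by (simp add: f_def)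
      show "((\<lambda>t. snd (z t)) has_vector_derivative acc \<nu> (fst (z t)) (snd (z t))) (at t within {0..\<tau>})"
        using bounded_linear.has_vector_derivative[OF bounded_linear_snd z(3)[OF t]] by (simp add: f_def)
    qed (use z in auto)
  qed
qed

text \<open>The magnetic force \<open>J v\<close> is orthogonal to \<open>v\<close> and does no work.\<close>

lemma speed_conserved:
  assumes "convex S" "s \<in> S" "t \<in> S"
    and X: "\<And>t. t \<in> S \<Longrightarrow> X t \<in> U"
    and dX: "\<And>t. t \<in> S \<Longrightarrow> (X has_vector_derivative Y t) (at t within S)"
    and dY: "\<And>t. t \<in> S \<Longrightarrow> (Y has_vector_derivative acc \<nu> (X t) (Y t)) (at t within S)"
  shows "G (X s) (Y s) (Y s) = G (X t) (Y t) (Y t)"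
proof -
  have "((\<lambda>t. G (X t) (Y t) (Y t)) has_derivative (\<lambda>h. 0)) (at t within S)" if t: "t \<in> S" for t
  proof -
    have "DG (X t) (Y t) (Y t) (Y t) + G (X t) (acc \<nu> (X t) (Y t)) (Y t) + G (X t) (Y t) (acc \<nu> (X t) (Y t)) = 0"
      by (simp add: G_sym[OF X[OF t], of "Y t"] G_acc[OF X[OF t]] force_def dW_self[OF X[OF t]])
    then show ?thesis
      using has_derivative_G_along[OF X t dX[OF t] dY[OF t] dY[OF t]]
      unfolding has_field_derivative_def by (auto elim!: has_derivative_eq_rhs)
  qed
  then have "\<exists>c. \<forall>t\<in>S. G (X t) (Y t) (Y t) = c"
    by (intro has_derivative_zero_constant[OF assms(1)]) auto
  then show ?thesis using assms(2,3) by auto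
qed

text \<open>The classical formula \<open>d ln det G = 2 tr \<Gamma>\<close>: raising an index in \<open>DG h b\<close> gives \<open>2 \<Gamma> h b\<close> up to the
  vector of a skew form, which has no trace.\<close>

lemma gram_det_derivative:
  assumes x: "x \<in> U"
  shows "((\<lambda>y. gram_det (G y)) has_derivative (\<lambda>h. 2 * (\<Sum>b\<in>Basis. \<Gamma> x h b \<bullet> b) * gram_det (G x))) (at x)"
proof -
  define C where "C = (\<lambda>h b. riesz (G x) (DG x h b))"
  have C: "G x (C h b) w = DG x h b w" for h b w
    unfolding C_def by (rule form_riesz[OF inner_G[OF x] linear_DG3[OF x]])
  have tr: "(\<Sum>b\<in>Basis. C h b \<bullet> b) = 2 * (\<Sum>b\<in>Basis. \<Gamma> x h b \<bullet> b)" for h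
  proof -
    have "(\<Sum>b\<in>Basis. (C h b - 2 *\<^sub>R \<Gamma> x h b) \<bullet> b) = 0"
      by (rule trace_skew[OF inner_G[OF x], of _ "\<lambda>b w. DG x w h b - DG x b h w"])
        (simp_all add: C G_simps[OF x] G_\<Gamma>[OF x] field_simps)
    then show ?thesis by (simp add: inner_diff_left sum_subtractf sum_distrib_left)
  qed
  have "((\<lambda>y. gram_det (G y)) has_derivative (\<lambda>h. (\<Sum>i\<in>Basis. C h i \<bullet> i) * gram_det (G x))) (at x)"
  proof (rule gram_det_has_derivative[where A'="\<lambda>h i j. DG x h i j" and C="\<lambda>h i k. C h i \<bullet> k"])
    show "DG x h i j = (\<Sum>k\<in>Basis. C h i \<bullet> k * G x k j)" for h i j
      using linear_expand[OF form_linear[OF inner_G[OF x]], of "C h i" j] by (simp add: C)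
  qed (rule has_derivative_G[OF x])
  then show ?thesis by (simp add: tr)
qed

end


section \<open>Two Randers data with the same unparametrized forward geodesics\<close>

locale projective_randers_data =
  A: randers_data U G W + B: randers_data U G' W' for U :: "'e::euclidean_space set" and G W G' W' +
  assumes projective: "x \<in> U \<Longrightarrow> v \<noteq> 0 \<Longrightarrow>
    \<exists>m. B.acc (B.speed x v) x v = A.acc (A.speed x v) x v + m *\<^sub>R v"
begin

text \<open>Reversing the velocity separates the quadratic part of the spray from the magnetic part.\<close>

lemma odd_even_parts:
  assumes x: "x \<in> U" and v: "v \<noteq> 0"
  shows "\<exists>c. sqrt (G x v v) *\<^sub>R A.J x v - sqrt (G' x v v) *\<^sub>R B.J x v = c *\<^sub>R v"
    and "\<exists>c. A.\<Gamma> x v v - B.\<Gamma> x v v = c *\<^sub>R v"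
proof -
  obtain m where m: "B.acc (B.speed x v) x v = A.acc (A.speed x v) x v + m *\<^sub>R v"
    using projective[OF x v] by blast
  obtain k where k: "B.acc (B.speed x (- v)) x (- v) = A.acc (A.speed x (- v)) x (- v) + k *\<^sub>R (- v)"
    using projective[OF x, of "- v"] v by auto
  have s: "A.speed x (- v) = A.speed x v" "B.speed x (- v) = B.speed x v"
    by (simp_all add: A.speed_def B.speed_def A.G_simps[OF x] B.G_simps[OF x])
  have J: "A.J x (- v) = - A.J x v" "B.J x (- v) = - B.J x v"
    using linear_neg[OF A.linear_J[OF x]] linear_neg[OF B.linear_J[OF x]] by auto
  have g: "A.\<Gamma> x (- v) (- v) = A.\<Gamma> x v v" "B.\<Gamma> x (- v) (- v) = B.\<Gamma> x v v"
    using linear_neg[OF A.linear_\<Gamma>[OF x]] linear_neg[OF B.linear_\<Gamma>[OF x]]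
      A.\<Gamma>_sym[OF x, of "- v"] B.\<Gamma>_sym[OF x, of "- v"] by auto
  define a b p q where "a = A.speed x v *\<^sub>R A.J x v" and "b = B.speed x v *\<^sub>R B.J x v"
    and "p = A.\<Gamma> x v v" and "q = B.\<Gamma> x v v"
  have 1: "b - q = a - p + m *\<^sub>R v" using m
    unfolding A.acc_eq[OF x] B.acc_eq[OF x] a_def b_def p_def q_def .
  have 2: "- b - q = - a - p - k *\<^sub>R v" using k
    unfolding A.acc_eq[OF x] B.acc_eq[OF x] a_def b_def p_def q_def s J g by simp
  have d: "a - b = - (m *\<^sub>R v) + (p - q)" "a - b = - (k *\<^sub>R v) - (p - q)"
    using 1 2 by (simp_all add: algebra_simps)
  have "2 *\<^sub>R (a - b) = (- (m *\<^sub>R v) + (p - q)) + (- (k *\<^sub>R v) - (p - q))"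
    unfolding scaleR_2 by (rule arg_cong2[where f="(+)", OF d])
  also have "\<dots> = - (m *\<^sub>R v) - k *\<^sub>R v" by simp
  also have "\<dots> = 2 *\<^sub>R ((- (m + k) / 2) *\<^sub>R v)"
  proof -
    have "2 * (- (m + k) / 2) = - m - k" by simp
    then show ?thesis by (simp only: scaleR_scaleR scaleR_left_diff_distrib scaleR_minus_left)
  qed
  finally have "2 *\<^sub>R (a - b) = 2 *\<^sub>R ((- (m + k) / 2) *\<^sub>R v)" .
  then have ab: "a - b = (- (m + k) / 2) *\<^sub>R v" by (rule scaleR_left_imp_eq[rotated]) simp
  have "p - q = m *\<^sub>R v + (a - b)" using d(1) by (simp add: algebra_simps)
  then have "p - q = (m + - (m + k) / 2) *\<^sub>R v" unfolding ab by (simp only: scaleR_left_distrib)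
  with ab show "\<exists>c. sqrt (G x v v) *\<^sub>R A.J x v - sqrt (G' x v v) *\<^sub>R B.J x v = c *\<^sub>R v"
    "\<exists>c. A.\<Gamma> x v v - B.\<Gamma> x v v = c *\<^sub>R v"
    unfolding a_def b_def p_def q_def A.speed_def B.speed_def by blast+
qed

lemma conformal_where_not_closed:
  assumes x: "x \<in> U" and w: "A.dW x a b \<noteq> 0"
  shows "\<exists>f>0. \<forall>u v. G' x u v = f * G x u v"
proof -
  have "A.J x b \<noteq> 0" using w A.G_J[OF x, of b a] A.G_simps[OF x] by auto
  then show ?thesis
    using conformal_of_odd_parts[OF A.inner_G[OF x] B.inner_G[OF x] A.linear_J[OF x] B.linear_J[OF x]
        A.J_skew[OF x] _ odd_even_parts(1)[OF x]] by blast
qed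

text \<open>For proportional metrics \<open>J v - sqrt k J' v\<close> is a multiple of \<open>v\<close>, but it is also orthogonal to
  \<open>v\<close>, so it is zero.\<close>

lemma dW_of_proportional:
  assumes x: "x \<in> U" and k: "k > 0" and eq: "\<And>u v. G' x u v = k * G x u v"
  shows "B.dW x u v = sqrt k * A.dW x u v"
proof (cases "v = 0")
  case True
  then show ?thesis using A.linear_dW[OF x] B.linear_dW[OF x] by (simp add: linear_0)
next
  case False
  obtain c where c: "sqrt (G x v v) *\<^sub>R A.J x v - sqrt (G' x v v) *\<^sub>R B.J x v = c *\<^sub>R v"
    using odd_even_parts(1)[OF x False] by blast
  have pos: "G x v v > 0" by (rule form_pos[OF A.inner_G[OF x] False])
  have "k * G x (B.J x v) v = 0" using B.J_skew[OF x, of v] by (simp add: eq)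
  then have "G x (c *\<^sub>R v) v = 0" using k
    by (simp add: c[symmetric] A.G_simps[OF x] A.J_skew[OF x])
  then have "c = 0" using pos by (simp add: A.G_simps[OF x])
  then have "sqrt (G x v v) *\<^sub>R A.J x v = sqrt (G x v v) *\<^sub>R (sqrt k *\<^sub>R B.J x v)"
    using c by (simp add: eq real_sqrt_mult mult.commute)
  then have "A.J x v = sqrt k *\<^sub>R B.J x v"
    by (rule scaleR_left_imp_eq[rotated]) (use pos in simp)
  then have "A.dW x u v = sqrt k * G x (B.J x v) u"
    using A.G_J[OF x, of v u] by (simp add: A.G_simps[OF x])
  moreover have "B.dW x u v = k * G x (B.J x v) u" using B.G_J[OF x, of v u] by (simp add: eq)
  ultimately show ?thesis using k real_sqrt_mult_self[of k] by (simp add: mult.assoc[symmetric])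
qed

text \<open>Twice the logarithm of the ratio of the two volume densities.\<close>

definition \<theta> :: "'e \<Rightarrow> real" where
  "\<theta> x = ln \<bar>gram_det (G' x)\<bar> - ln \<bar>gram_det (G x)\<bar>"

definition D\<theta> :: "'e \<Rightarrow> 'e \<Rightarrow> real" where
  "D\<theta> x h = 2 * (\<Sum>b\<in>Basis. B.\<Gamma> x h b \<bullet> b) - 2 * (\<Sum>b\<in>Basis. A.\<Gamma> x h b \<bullet> b)"

lemma \<theta>_derivative:
  assumes x: "x \<in> U" shows "(\<theta> has_derivative D\<theta> x) (at x)"
proof -
  have ln: "((\<lambda>y. ln \<bar>f y\<bar>) has_derivative (\<lambda>h. c h)) (at x)"
    if f: "(f has_derivative (\<lambda>h. c h * f x)) (at x)" "f x \<noteq> 0" for f :: "'e \<Rightarrow> real" and c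
  proof -
    have p: "(f x)\<^sup>2 > 0" using f(2) by simp
    have 1: "((\<lambda>y. (f y)\<^sup>2) has_derivative (\<lambda>h. 2 * f x * (c h * f x))) (at x)"
      by (auto intro!: derivative_eq_intros f(1))
    have 2: "(ln has_derivative (*) (inverse ((f x)\<^sup>2))) (at ((f x)\<^sup>2))"
      using DERIV_ln[OF p] unfolding has_field_derivative_def .
    have "((\<lambda>y. (1 / 2) * ln ((f y)\<^sup>2)) has_derivative
        (\<lambda>h. (1 / 2) * (inverse ((f x)\<^sup>2) * (2 * f x * (c h * f x))))) (at x)"
      by (rule has_derivative_mult_right[OF has_derivative_compose[OF 1 2]])
    moreover have "(1 / 2) * (inverse ((f x)\<^sup>2) * (2 * f x * (c h * f x))) = c h" for h
      using f(2) by (simp add: power2_eq_square field_simps)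
    moreover have "(1 / 2) * ln ((f y)\<^sup>2) = ln \<bar>f y\<bar>" for y
      using ln_realpow[of "\<bar>f y\<bar>" 2] by (cases "f y = 0") simp_all
    ultimately show ?thesis by (simp only:)
  qed
  show ?thesis unfolding \<theta>_def D\<theta>_def
    by (rule has_derivative_diff[OF
          ln[OF B.gram_det_derivative[OF x] gram_det_nonzero[OF B.inner_G[OF x]]]
          ln[OF A.gram_det_derivative[OF x] gram_det_nonzero[OF A.inner_G[OF x]]]])
qed

lemma \<theta>_of_proportional:
  assumes x: "x \<in> U" and f: "f > 0" and eq: "\<And>u v. G' x u v = f * G x u v"
  shows "\<theta> x = DIM('e) * ln f"
proof -
  have "G' x = (\<lambda>u v. f * G x u v)" using eq by blast
  then have "\<bar>gram_det (G' x)\<bar> = f ^ DIM('e) * \<bar>gram_det (G x)\<bar>"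
    using f by (simp add: gram_det_scale abs_mult)
  then show ?thesis using f gram_det_nonzero[OF A.inner_G[OF x]]
    by (simp add: \<theta>_def ln_mult ln_realpow)
qed

text \<open>
  The difference of the two connections is \<open>\<psi> \<otimes> Id + Id \<otimes> \<psi>\<close>, and taking traces identifies
  \<open>\<psi>\<close> with a differential. The resulting identity says that
  \<open>exp (- 2 \<theta> / (n + 1)) G'\<close> is a Killing tensor of \<open>G\<close>.
\<close>

lemma killing_identity:
  assumes x: "x \<in> U"
  shows "B.DG x v v v - 2 * G' x (A.\<Gamma> x v v) v = 2 / (real DIM('e) + 1) * D\<theta> x v * G' x v v"
proof -
  define T where "T = (\<lambda>u v. A.\<Gamma> x u v - B.\<Gamma> x u v)"
  have T: "T v v = (2 / (real DIM('e) + 1) * (\<Sum>b\<in>Basis. T v b \<bullet> b)) *\<^sub>R v"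
  proof (rule trace_of_radial_bilinear)
    show "linear (T u)" for u unfolding T_def
      by (intro linear_compose_sub A.linear_\<Gamma>[OF x] B.linear_\<Gamma>[OF x])
    show "T u v = T v u" for u v by (simp add: T_def A.\<Gamma>_sym[OF x, of u] B.\<Gamma>_sym[OF x, of u])
    show "\<exists>m. T v v = m *\<^sub>R v" if "v \<noteq> 0" for v unfolding T_def by (rule odd_even_parts(2)[OF x that])
  qed
  have tr: "(\<Sum>b\<in>Basis. T v b \<bullet> b) = - D\<theta> x v / 2"
    by (simp add: T_def D\<theta>_def inner_diff_left sum_subtractf)
  have "A.\<Gamma> x v v = B.\<Gamma> x v v + T v v" by (simp add: T_def)
  moreover have "2 / (real DIM('e) + 1) * (- D\<theta> x v / 2) = - (D\<theta> x v / (real DIM('e) + 1))"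
    using add_nonneg_pos[of "real DIM('e)" 1] by (simp add: field_simps)
  ultimately have "A.\<Gamma> x v v = B.\<Gamma> x v v - (D\<theta> x v / (real DIM('e) + 1)) *\<^sub>R v"
    unfolding T tr by simp
  then have "G' x (A.\<Gamma> x v v) v = G' x (B.\<Gamma> x v v) v - D\<theta> x v / (real DIM('e) + 1) * G' x v v"
    by (simp add: B.G_simps[OF x])
  moreover have "G' x (B.\<Gamma> x v v) v = B.DG x v v v / 2" by (simp add: B.G_\<Gamma>[OF x])
  ultimately show ?thesis by (simp add: field_simps)
qed

text \<open>If \<open>G' = f G\<close>, then \<open>\<theta> = n ln f\<close>, and the Killing identity reduces to
  \<open>D f = 2 n / (n + 1) D f\<close>, so that \<open>D f = 0\<close> unless \<open>n = 1\<close>.\<close>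

lemma conformal_factor_constant:
  assumes n: "DIM('e) \<ge> 2" and r: "ball x0 r \<subseteq> U" "r > 0"
    and conf: "\<And>x. x \<in> ball x0 r \<Longrightarrow> \<exists>f>0. \<forall>u v. G' x u v = f * G x u v"
  shows "\<exists>k>0. \<forall>x\<in>ball x0 r. \<forall>u v. G' x u v = k * G x u v"
proof -
  let ?n = "real DIM('e)"
  obtain f where f: "\<And>x. x \<in> ball x0 r \<Longrightarrow> f x > 0"
    "\<And>x u v. x \<in> ball x0 r \<Longrightarrow> G' x u v = f x * G x u v" using conf by metis
  obtain b :: 'e where b: "b \<in> Basis" using nonempty_Basis by blast
  have b0: "b \<noteq> 0" using b by (simp add: nonzero_Basis)
  have df: "(f has_derivative (\<lambda>h. 0)) (at x)" if x: "x \<in> ball x0 r" for x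
  proof -
    have xU: "x \<in> U" using x r by blast
    have pos: "G y b b > 0" if "y \<in> U" for y by (rule form_pos[OF A.inner_G[OF that] b0])
    define D where "D = (\<lambda>h. (B.DG x h b b * G x b b - G' x b b * A.DG x h b b) / (G x b b)\<^sup>2)"
    have "((\<lambda>y. G' y b b / G y b b) has_derivative D) (at x)"
      using pos[OF xU] unfolding D_def
      by (auto intro!: derivative_eq_intros B.has_derivative_G[OF xU] A.has_derivative_G[OF xU]
          simp: field_simps power2_eq_square)
    then have fD: "(f has_derivative D) (at x)"
    proof (rule has_derivative_transform_within_open[OF _ open_ball x])
      fix y assume y: "y \<in> ball x0 r"
      then show "G' y b b / G y b b = f y" using f(2)[OF y, of b b] pos[of y] r by auto
    qed
    have dG': "B.DG x h v v = f x * A.DG x h v v + D h * G x v v" for h v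
    proof -
      have "((\<lambda>y. f y * G y v v) has_derivative (\<lambda>h. f x * A.DG x h v v + D h * G x v v)) (at x)"
        by (rule has_derivative_mult[OF fD A.has_derivative_G[OF xU]])
      then have "((\<lambda>y. G' y v v) has_derivative (\<lambda>h. f x * A.DG x h v v + D h * G x v v)) (at x)"
        by (rule has_derivative_transform_within_open[OF _ open_ball x]) (simp add: f(2))
      then show ?thesis
        using has_derivative_unique[OF B.has_derivative_G[OF xU]] by metis
    qed
    have d\<theta>: "D\<theta> x h = ?n * D h / f x" for h
    proof -
      have "((\<lambda>y. ?n * ln (f y)) has_derivative (\<lambda>h. ?n * D h / f x)) (at x)"
        using f(1)[OF x] by (auto intro!: derivative_eq_intros fD simp: field_simps)
      then have "(\<theta> has_derivative (\<lambda>h. ?n * D h / f x)) (at x)"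
      proof (rule has_derivative_transform_within_open[OF _ open_ball x])
        fix y assume y: "y \<in> ball x0 r"
        show "?n * ln (f y) = \<theta> y" using \<theta>_of_proportional[of y "f y"] f y r by auto
      qed
      then show ?thesis using has_derivative_unique[OF \<theta>_derivative[OF xU]] by metis
    qed
    have "D v = 0" for v
    proof (cases "v = 0")
      case True then show ?thesis using has_derivative_linear[OF fD] by (simp add: linear_0)
    next
      case False
      have g: "G x v v > 0" by (rule form_pos[OF A.inner_G[OF xU] False])
      have "B.DG x v v v - 2 * G' x (A.\<Gamma> x v v) v = D v * G x v v"
        by (simp add: dG' f(2)[OF x] A.G_\<Gamma>[OF xU])
      then have "D v * G x v v = 2 / (?n + 1) * (?n * D v / f x) * (f x * G x v v)"
        using killing_identity[OF xU, of v] by (simp only: d\<theta> f(2)[OF x])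
      also have "\<dots> = (2 * ?n * D v / (?n + 1)) * G x v v" using f(1)[OF x] by simp
      finally have "D v = 2 * ?n * D v / (?n + 1)"
        by (rule mult_right_cancel[THEN iffD1, rotated]) (use g in simp)
      moreover have "?n + 1 > 0" using of_nat_0_le_iff[of "DIM('e)"] by linarith
      ultimately have "D v * (?n + 1) = 2 * ?n * D v" by (metis nonzero_divide_eq_eq less_numeral_extra(3))
      then have "D v * (?n - 1) = 0" by (simp add: algebra_simps)
      then show ?thesis using n by simp
    qed
    then have "D = (\<lambda>h. 0)" by blast
    then show ?thesis using fD by simp
  qed
  then have "\<exists>k. \<forall>x\<in>ball x0 r. f x = k"
    using has_derivative_zero_constant[OF convex_ball, of x0 r f] by (blast intro: has_derivative_at_withinI)
  then obtain k where k: "\<And>x. x \<in> ball x0 r \<Longrightarrow> f x = k" by blast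
  have "x0 \<in> ball x0 r" using r by simp
  then have "k > 0" using f(1) k by metis
  then show ?thesis using f(2) k by metis
qed

text \<open>
  Along a \<open>G\<close>-geodesic the value of \<open>exp (- 2 \<theta> / (n + 1)) G'\<close> on the velocity is conserved. A
  point \<open>q\<close> near the region \<open>S\<close> of proportionality sees it under an open set of directions: the
  geodesics in these directions end in \<open>S\<close>, where \<open>G' = k G\<close>. So \<open>G'\<close> is a multiple of \<open>G\<close> at \<open>q\<close> in an open
  set of directions, hence in all directions, and evaluating \<open>\<theta>\<close> shows that the factor is \<open>k\<close>.

  Quantitatively, if \<open>S\<close> contains the ball of a small radius \<open>s\<close> about \<open>y\<close>, it contains the
  ball of radius \<open>9 s / 8\<close> about \<open>y\<close>. If \<open>x0\<close> were not an interior point, take \<open>y\<close> close to \<open>x0\<close> and let \<open>s\<close> be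
  its distance from the complement of the interior of \<open>S\<close> to get a contradiction.
\<close>

lemma proportionality_unique_continuation:
  assumes n: "DIM('e) \<ge> 2" and x0: "x0 \<in> U" and k: "k > 0"
    and near: "\<And>e. e > 0 \<Longrightarrow> \<exists>y r. r > 0 \<and> y \<in> ball x0 e \<and> ball y r \<subseteq> U \<and>
                 (\<forall>x\<in>ball y r. \<forall>u v. G' x u v = k * G x u v)"
  shows "\<exists>r>0. ball x0 r \<subseteq> U \<and> (\<forall>x\<in>ball x0 r. \<forall>u v. G' x u v = k * G x u v)"
proof -
  let ?n = "real DIM('e)"
  obtain \<rho> \<tau> M where geo: "\<rho> > 0" "\<tau> > 0" "M > 0" "cball x0 (2 * \<rho>) \<subseteq> U"
    "\<And>q u. q \<in> cball x0 \<rho> \<Longrightarrow> norm u \<le> 1 \<Longrightarrow> \<exists>X Y. X 0 = q \<and> Y 0 = u \<and> (\<forall>t\<in>{0..\<tau>}.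
       X t \<in> cball x0 (2 * \<rho>) \<and> norm (Y t) \<le> 1 + 1 \<and> norm (A.acc 0 (X t) (Y t)) \<le> M \<and>
       (X has_vector_derivative Y t) (at t within {0..\<tau>}) \<and>
       (Y has_vector_derivative A.acc 0 (X t) (Y t)) (at t within {0..\<tau>}))"
    by (rule A.magnetic_geodesics_exist[OF x0 zero_less_one, where \<nu>=0]) (rule that)
  define S where "S = {x \<in> U. \<forall>u v. G' x u v = k * G x u v}"
  have proportional: "q \<in> S" if q: "q \<in> cball x0 \<rho>" and s: "s > 0" "2 * s \<le> \<tau>" "16 * M * s \<le> 1"
    and y: "dist y q < 9 / 8 * s" "ball y s \<subseteq> S" for q s y
  proof -
    have qU: "q \<in> U" using q geo(1,4) by (auto simp: subset_eq)
    \<comment> \<open>the factor that equality of the conserved quantity at \<open>q\<close> and at a point of \<open>S\<close> prescribes\<close>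
    define c where "c = exp ((2 * \<theta> q + (1 - ?n) * ln k) / (?n + 1))"
    \<comment> \<open>the straight line \<open>q + t v\<close> ends at distance less than \<open>s / 2\<close> from \<open>y\<close>, and the geodesic
      deviates from it by at most \<open>s / 4\<close>\<close>
    have on_ball: "G' q v v = c * G q v v" if v: "v \<in> ball (y - q) (s / 2)" for v
    proof (cases "v = 0")
      case True then show ?thesis by (simp add: A.G_simps[OF qU] B.G_simps[OF qU])
    next
      case False
      \<comment> \<open>unit initial velocity \<open>u\<close> and time \<open>\<sigma>\<close>, so that one time \<open>\<tau>\<close> of existence serves for all \<open>v\<close>\<close>
      define \<sigma> u where "\<sigma> = norm v" and "u = (1 / norm v) *\<^sub>R v"
      have vy: "norm (q + v - y) < s / 2"
        using v by (simp add: dist_norm norm_minus_commute algebra_simps)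
      have "\<sigma> \<le> norm (q + v - y) + norm (y - q)"
        unfolding \<sigma>_def using norm_triangle_ineq[of "q + v - y" "y - q"] by (simp add: algebra_simps)
      then have \<sigma>: "\<sigma> > 0" "\<sigma> \<le> 2 * s" "\<sigma> \<le> \<tau>"
        using vy y(1) s False by (auto simp: dist_norm \<sigma>_def)
      have u: "norm u = 1" "v = \<sigma> *\<^sub>R u" "u \<noteq> 0" using False by (auto simp: u_def \<sigma>_def)
      obtain X Y where XY: "X 0 = q" "Y 0 = u"
        "\<And>t. t \<in> {0..\<tau>} \<Longrightarrow> X t \<in> cball x0 (2 * \<rho>)"
        "\<And>t. t \<in> {0..\<tau>} \<Longrightarrow> norm (A.acc 0 (X t) (Y t)) \<le> M"
        "\<And>t. t \<in> {0..\<tau>} \<Longrightarrow> (X has_vector_derivative Y t) (at t within {0..\<tau>})"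
        "\<And>t. t \<in> {0..\<tau>} \<Longrightarrow> (Y has_vector_derivative A.acc 0 (X t) (Y t)) (at t within {0..\<tau>})"
        using geo(5)[OF q, of u] u(1) by auto
      have XU: "X t \<in> U" if "t \<in> {0..\<tau>}" for t using XY(3)[OF that] geo(4) by blast
      have Yu: "norm (Y t - u) \<le> M * t" if "t \<in> {0..\<tau>}" for t
        using vector_derivative_mean_value_bound[of 0 \<tau> Y _ M t 0, OF XY(6) XY(4)] that XY(2) by auto
      have sub: "{0..\<sigma>} \<subseteq> {0..\<tau>}" using \<sigma> by auto
      have "norm ((X \<sigma> - \<sigma> *\<^sub>R u) - (X 0 - 0 *\<^sub>R u)) \<le> (M * \<sigma>) * \<bar>\<sigma> - 0\<bar>"
      proof (rule vector_derivative_mean_value_bound)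
        fix t assume t: "t \<in> {0..\<sigma>}"
        then show "((\<lambda>t. X t - t *\<^sub>R u) has_vector_derivative Y t - u) (at t within {0..\<sigma>})"
          using has_vector_derivative_within_subset[OF XY(5) sub] sub
          by (auto intro!: derivative_eq_intros)
        have "M * t \<le> M * \<sigma>" using t geo(3) by simp
        then show "norm (Y t - u) \<le> M * \<sigma>" using Yu[of t] t sub by force
      qed (use \<sigma> in auto)
      then have "norm (X \<sigma> - (q + v)) \<le> M * \<sigma>\<^sup>2"
        using \<sigma>(1) u(2) by (simp add: XY power2_eq_square algebra_simps)
      also have "\<dots> \<le> M * (2 * s)\<^sup>2" using \<sigma> geo(3) by (intro mult_left_mono power_mono) auto
      also have "\<dots> \<le> s / 4" using mult_right_mono[OF s(3), of s] s(1) by (simp add: power2_eq_square)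
      finally have "norm (X \<sigma> - y) < s"
        using vy s(1) norm_triangle_ineq[of "X \<sigma> - (q + v)" "q + v - y"] by (simp add: algebra_simps)
      then have X\<sigma>: "X \<sigma> \<in> S" using y(2) by (auto simp: dist_norm norm_minus_commute)
      have mem: "0 \<in> {0..\<tau>}" "\<sigma> \<in> {0..\<tau>}" using \<sigma> by auto
      have Gc: "G (X t) (Y t) (Y t) = G q u u" if "t \<in> {0..\<tau>}" for t
        using A.speed_conserved[OF _ that mem(1) XU XY(5) XY(6)] XY(1,2) by auto
      have gpos: "G q u u > 0" by (rule form_pos[OF A.inner_G[OF qU] u(3)])
      have Y0: "Y t \<noteq> 0" if "t \<in> {0..\<tau>}" for t
        using Gc[OF that] gpos A.G_simps[OF XU[OF that]] by auto
      define E where "E = (\<lambda>t. (?n + 1) * ln (G' (X t) (Y t) (Y t)) - 2 * \<theta> (X t))"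
      define m where "m = ?n + 1"
      have m: "m > 0" using of_nat_0_le_iff[of "DIM('e)"] unfolding m_def by linarith
      have "(E has_derivative (\<lambda>h. 0)) (at t within {0..\<tau>})" if t: "t \<in> {0..\<tau>}" for t
      proof -
        have pos: "G' (X t) (Y t) (Y t) > 0" by (rule form_pos[OF B.inner_G[OF XU[OF t]] Y0[OF t]])
        have a: "A.acc 0 (X t) (Y t) = - A.\<Gamma> (X t) (Y t) (Y t)" by (simp add: A.acc_eq[OF XU[OF t]])
        have "((\<lambda>t. G' (X t) (Y t) (Y t)) has_real_derivative
            B.DG (X t) (Y t) (Y t) (Y t) - 2 * G' (X t) (A.\<Gamma> (X t) (Y t) (Y t)) (Y t)) (at t within {0..\<tau>})"
          using B.has_derivative_G_along[OF XU t XY(5)[OF t] XY(6)[OF t] XY(6)[OF t]]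
          by (simp add: a B.G_simps[OF XU[OF t]] B.G_sym[OF XU[OF t], of "Y t"])
        then have dG: "((\<lambda>t. G' (X t) (Y t) (Y t)) has_real_derivative
            2 / m * D\<theta> (X t) (Y t) * G' (X t) (Y t) (Y t)) (at t within {0..\<tau>})"
          by (simp only: killing_identity[OF XU[OF t]] m_def)
        have "((\<lambda>t. \<theta> (X t)) has_derivative (\<lambda>h. D\<theta> (X t) (h *\<^sub>R Y t))) (at t within {0..\<tau>})"
          using has_derivative_compose[OF XY(5)[OF t, unfolded has_vector_derivative_def] \<theta>_derivative[OF XU[OF t]]] .
        then have d\<theta>: "((\<lambda>t. \<theta> (X t)) has_real_derivative D\<theta> (X t) (Y t)) (at t within {0..\<tau>})"
          by (rule has_derivative_imp_has_field_derivative)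
            (simp add: linear_cmul[OF has_derivative_linear[OF \<theta>_derivative[OF XU[OF t]]]])
        have "(E has_real_derivative 0) (at t within {0..\<tau>})"
          unfolding E_def m_def[symmetric] using pos m by (auto intro!: derivative_eq_intros dG d\<theta>)
        then show ?thesis unfolding has_field_derivative_def by (auto elim!: has_derivative_eq_rhs)
      qed
      then have "E \<sigma> = E 0"
        using has_derivative_zero_constant[of "{0..\<tau>}" E] mem by (metis convex_real_interval(5))
      moreover have "E \<sigma> = (?n + 1) * (ln k + ln (G q u u)) - 2 * (?n * ln k)"
      proof -
        have "G' (X \<sigma>) (Y \<sigma>) (Y \<sigma>) = k * G q u u" using X\<sigma> Gc[OF mem(2)] by (simp add: S_def)
        moreover have "\<theta> (X \<sigma>) = ?n * ln k"
          using X\<sigma> k by (intro \<theta>_of_proportional) (auto simp: S_def)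
        ultimately show ?thesis using k gpos by (simp add: E_def ln_mult)
      qed
      moreover have "E 0 = (?n + 1) * ln (G' q u u) - 2 * \<theta> q" by (simp add: E_def XY)
      ultimately have "(?n + 1) * (ln (G' q u u) - ln (G q u u)) = 2 * \<theta> q + (1 - ?n) * ln k"
        by (simp add: algebra_simps)
      then have "ln (G' q u u / G q u u) = (2 * \<theta> q + (1 - ?n) * ln k) / (?n + 1)"
        using gpos form_pos[OF B.inner_G[OF qU] u(3)] by (simp add: ln_div field_simps)
      then have "G' q u u / G q u u = c"
        unfolding c_def using gpos form_pos[OF B.inner_G[OF qU] u(3)] by (metis divide_pos_pos exp_ln)
      then have "G' q u u = c * G q u u" using gpos by (simp add: field_simps)
      then show ?thesis by (simp add: u(2) A.G_simps[OF qU] B.G_simps[OF qU])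
    qed
    have eq: "G' q u v = c * G q u v" for u v
    proof (rule quadratic_form_eq_on_ball[OF B.inner_G[OF qU] A.inner_G[OF qU]])
      show "s / 2 > 0" using s by simp
    qed (rule on_ball)
    have c0: "c > 0" by (simp add: c_def)
    \<comment> \<open>\<open>\<theta> q = n ln c\<close> turns the definition of \<open>c\<close> into \<open>(1 - n) (ln c - ln k) = 0\<close>\<close>
    have "(?n + 1) * ln c = 2 * \<theta> q + (1 - ?n) * ln k" by (simp add: c_def)
    moreover have "\<theta> q = ?n * ln c" by (rule \<theta>_of_proportional[OF qU c0 eq])
    ultimately have "(1 - ?n) * (ln c - ln k) = 0" by (simp add: algebra_simps)
    then have "c = k" using n k c0 by simp
    then show ?thesis using eq qU by (simp add: S_def)
  qed
  \<comment> \<open>radii below \<open>s0\<close> satisfy the smallness conditions above, and points \<open>q\<close> stay in \<open>cball x0 \<rho>\<close>\<close>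
  define s0 where "s0 = min (\<rho> / 4) (min (\<tau> / 2) (1 / (16 * M)))"
  have s0: "s0 > 0" "4 * s0 \<le> \<rho>" "2 * s0 \<le> \<tau>" "16 * M * s0 \<le> 1"
  proof -
    show "s0 > 0" "4 * s0 \<le> \<rho>" "2 * s0 \<le> \<tau>" using geo by (auto simp: s0_def)
    have "16 * M * s0 \<le> 16 * M * (1 / (16 * M))" using geo(3) by (intro mult_left_mono) (auto simp: s0_def)
    then show "16 * M * s0 \<le> 1" using geo(3) by simp
  qed
  define Q where "Q = interior S"
  have "x0 \<in> Q"
  proof (rule ccontr)
    assume out: "x0 \<notin> Q"
    obtain y r where y: "r > 0" "y \<in> ball x0 s0" "ball y r \<subseteq> U" "\<And>x u v. x \<in> ball y r \<Longrightarrow> G' x u v = k * G x u v"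
      using near[OF s0(1)] by blast
    have "ball y r \<subseteq> S" using y by (auto simp: S_def)
    then have "y \<in> Q" unfolding Q_def using y(1) by (meson centre_in_ball interior_maximal open_ball subsetD)
    define s where "s = infdist y (- Q)"
    have cl: "closed (- Q)" "- Q \<noteq> {}" using out by (auto simp: Q_def)
    have "s > 0" using in_closed_iff_infdist_zero[OF cl, of y] \<open>y \<in> Q\<close> infdist_nonneg[of y "- Q"]
      unfolding s_def by (auto simp: less_le)
    have "s \<le> dist y x0" unfolding s_def using out by (intro infdist_le) auto
    then have ss: "s < s0" using y(2) by (simp add: dist_commute)
    have "ball y s \<subseteq> Q"
    proof
      fix z assume "z \<in> ball y s"
      then show "z \<in> Q" using infdist_le[of z "- Q" y] unfolding s_def by (cases "z \<in> Q") auto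
    qed
    then have bS: "ball y s \<subseteq> S" using interior_subset[of S] unfolding Q_def by blast
    have "ball y (9 / 8 * s) \<subseteq> S"
    proof
      fix q assume q: "q \<in> ball y (9 / 8 * s)"
      have "dist x0 q \<le> \<rho>" using dist_triangle[of x0 q y] y(2) q ss s0(1,2) by simp
      moreover have "16 * M * s \<le> 16 * M * s0" using ss geo(3) by (intro mult_left_mono) auto
      ultimately show "q \<in> S"
        using q \<open>s > 0\<close> ss s0(3,4) by (intro proportional[OF _ _ _ _ _ bS]) auto
    qed
    then have big: "ball y (9 / 8 * s) \<subseteq> Q" unfolding Q_def by (simp add: interior_maximal)
    have "9 / 8 * s \<le> infdist y (- Q)"
      unfolding infdist_notempty[OF cl(2)]
      by (rule cINF_greatest[OF cl(2)]) (metis ComplD big linorder_not_le mem_ball subsetD)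
    then show False using \<open>s > 0\<close> by (simp add: s_def)
  qed
  then obtain r where "r > 0" "ball x0 r \<subseteq> S" unfolding Q_def mem_interior by blast
  then show ?thesis unfolding S_def by blast
qed

end

section \<open>The first variation of length\<close>

lemma continuous_on_locally_extends:
  fixes f :: "'a::t2_space \<Rightarrow> 'b::topological_space"
  assumes "\<And>z. z \<in> S \<Longrightarrow> \<exists>N g. open N \<and> z \<in> N \<and> continuous_on N g \<and> (\<forall>y\<in>N \<inter> S. f y = g y)"
  shows "continuous_on S f"
  unfolding continuous_on_def
proof
  fix z assume z: "z \<in> S"
  obtain N g where N: "open N" "z \<in> N" "continuous_on N g" "\<And>y. y \<in> N \<inter> S \<Longrightarrow> f y = g y"
    using assms[OF z] by blast
  have "(g \<longlongrightarrow> g z) (at z)" using N(2,3) continuous_on_eq_continuous_at[OF N(1), of g] by (simp add: isCont_def)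
  then have "(g \<longlongrightarrow> g z) (at z within S)" by (rule tendsto_within_subset) simp
  then have "(g \<longlongrightarrow> f z) (at z within S)" using N(4)[of z] N(2) z by simp
  moreover have "\<forall>\<^sub>F y in at z within S. g y = f y"
    unfolding eventually_at_topological using N by (intro exI[of _ N]) auto
  ultimately show "(f \<longlongrightarrow> f z) (at z within S)" by (rule Lim_transform_eventually)
qed

text \<open>A chain rule for functions that agree with \<open>g \<circ> p\<close> near \<open>t\<close>. It serves for one-sided derivatives
  of maps that are known through extensions to open sets.\<close>

lemma has_vector_derivative_along_curve:
  assumes N: "open N" "p t \<in> N" and t: "t \<in> T" and p: "(p has_vector_derivative e) (at t within T)"
    and g: "(g has_derivative g') (at (p t))" and eq: "\<And>r. r \<in> T \<Longrightarrow> p r \<in> N \<Longrightarrow> f r = g (p r)"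
  shows "(f has_vector_derivative g' e) (at t within T)"
proof -
  have "((\<lambda>r. g (p r)) has_derivative (\<lambda>k. g' (k *\<^sub>R e))) (at t within T)"
    using has_derivative_compose[OF p[unfolded has_vector_derivative_def] g] .
  then have d: "((\<lambda>r. g (p r)) has_derivative (\<lambda>k. k *\<^sub>R g' e)) (at t within T)"
    unfolding linear_cmul[OF has_derivative_linear[OF g]] .
  have "(p \<longlongrightarrow> p t) (at t within T)"
    using has_vector_derivative_continuous[OF p] by (simp add: continuous_within)
  then have "\<forall>\<^sub>F r in at t within T. p r \<in> N" using N by (rule topological_tendstoD)
  then have "\<forall>\<^sub>F r in at t within T. g (p r) = f r"
    unfolding eventually_at_filter by eventually_elim (simp add: eq)
  then show ?thesis
    using has_derivative_transform_eventually[OF d] eq[OF t N(2)] t by (simp add: has_vector_derivative_def)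
qed

lemma has_vector_derivative_cong_near:
  assumes "open B" "t \<in> B" "t \<in> S" "\<And>s. s \<in> B \<Longrightarrow> s \<in> S \<Longrightarrow> g s = f s"
    and "(g has_vector_derivative d) (at t within S)"
  shows "(f has_vector_derivative d) (at t within S)"
proof -
  obtain r where "r > 0" "ball t r \<subseteq> B" using assms(1,2) open_contains_ball by blast
  then show ?thesis
    using has_derivative_transform_within[of g "\<lambda>h. h *\<^sub>R d" t S r f] assms(3,4,5)
    by (auto simp: has_vector_derivative_def dist_commute subset_eq)
qed

context randers_data
begin

text \<open>Differentiation under the integral sign, followed by an integration by parts that uses the
  second derivative of the central curve only.\<close>

lemma first_variation:
  fixes X Xs Xt Xst :: "real \<Rightarrow> real \<Rightarrow> 'e"
  assumes e: "e > 0" and ab: "a < b"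
    and U: "\<And>s t. s \<in> {-e<..<e} \<Longrightarrow> t \<in> {a..b} \<Longrightarrow> X s t \<in> U"
    and reg: "\<And>s t. s \<in> {-e<..<e} \<Longrightarrow> t \<in> {a..b} \<Longrightarrow> Xt s t \<noteq> 0"
    and dXt: "\<And>t. t \<in> {a..b} \<Longrightarrow> ((\<lambda>t. X 0 t) has_vector_derivative Xt 0 t) (at t within {a..b})"
    and dXs: "\<And>s t. s \<in> {-e<..<e} \<Longrightarrow> t \<in> {a..b} \<Longrightarrow>
        ((\<lambda>s. X s t) has_vector_derivative Xs s t) (at s within {-e<..<e})"
    and dXst: "\<And>s t. s \<in> {-e<..<e} \<Longrightarrow> t \<in> {a..b} \<Longrightarrow>
        ((\<lambda>s. Xt s t) has_vector_derivative Xst s t) (at s within {-e<..<e})"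
    and dXts: "\<And>t. t \<in> {a..b} \<Longrightarrow> ((\<lambda>t. Xs 0 t) has_vector_derivative Xst 0 t) (at t within {a..b})"
    and dXtt: "\<And>t. t \<in> {a..b} \<Longrightarrow> ((\<lambda>t. Xt 0 t) has_vector_derivative Z t) (at t within {a..b})"
    and cont: "continuous_on ({-e<..<e} \<times> {a..b}) (\<lambda>z. X (fst z) (snd z))"
      "continuous_on ({-e<..<e} \<times> {a..b}) (\<lambda>z. Xt (fst z) (snd z))"
      "continuous_on ({-e<..<e} \<times> {a..b}) (\<lambda>z. Xs (fst z) (snd z))"
      "continuous_on ({-e<..<e} \<times> {a..b}) (\<lambda>z. Xst (fst z) (snd z))"
    and fixed: "Xs 0 a = 0" "Xs 0 b = 0"
  shows "((\<lambda>s. integral {a..b} (\<lambda>t. lagr (X s t) (Xt s t))) has_real_derivative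
          integral {a..b} (\<lambda>t. euler_lagrange (X 0 t) (Xt 0 t) (Z t) (Xs 0 t))) (at 0)"
proof -
  let ?I = "{-e<..<e}" and ?R = "{-e<..<e} \<times> {a..b}"
  define N where "N = (\<lambda>s t. sqrt (G (X s t) (Xt s t) (Xt s t)))"
  define V where "V = (\<lambda>s t. (DG (X s t) (Xs s t) (Xt s t) (Xt s t) / 2 + G (X s t) (Xst s t) (Xt s t)) / N s t
      + DW (X s t) (Xs s t) (Xt s t) + W (X s t) (Xst s t))"
  have pos: "G (X s t) (Xt s t) (Xt s t) > 0" if "s \<in> ?I" "t \<in> {a..b}" for s t
    by (rule form_pos[OF inner_G[OF U[OF that]] reg[OF that]])
  then have N: "N s t > 0" if "s \<in> ?I" "t \<in> {a..b}" for s t using that by (simp add: N_def)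
  have z0: "0 \<in> ?I" using e by simp
  have dL: "((\<lambda>s. lagr (X s t) (Xt s t)) has_real_derivative V s t) (at s within ?I)"
    if st: "s \<in> ?I" "t \<in> {a..b}" for s t
  proof -
    have dG: "((\<lambda>s. G (X s t) (Xt s t) (Xt s t)) has_real_derivative
       DG (X s t) (Xs s t) (Xt s t) (Xt s t) + G (X s t) (Xst s t) (Xt s t) + G (X s t) (Xt s t) (Xst s t))
       (at s within ?I)"
      by (rule has_derivative_G_along[OF _ st(1) dXs[OF st] dXst[OF st] dXst[OF st]]) (use U st in auto)
    have dW: "((\<lambda>s. W (X s t) (Xt s t)) has_real_derivative
       DW (X s t) (Xs s t) (Xt s t) + W (X s t) (Xst s t)) (at s within ?I)"
      by (rule has_derivative_W_along[OF _ st(1) dXs[OF st] dXst[OF st] dXst[OF st]]) (use U st in auto)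
    have "((\<lambda>s. sqrt (G (X s t) (Xt s t) (Xt s t))) has_real_derivative
       (DG (X s t) (Xs s t) (Xt s t) (Xt s t) + G (X s t) (Xst s t) (Xt s t) + G (X s t) (Xt s t) (Xst s t))
         / 2 / N s t) (at s within ?I)"
      using pos[OF st] unfolding N_def
      by (auto intro!: derivative_eq_intros dG simp: field_simps)
    from DERIV_add[OF this dW] show ?thesis
      unfolding lagr_def V_def
      by (rule DERIV_cong) (simp add: G_sym[OF U[OF st], of "Xt s t"] add_divide_distrib)
  qed
  have cN: "continuous_on ?R (\<lambda>z. N (fst z) (snd z))"
    unfolding N_def using U by (intro continuous_intros continuous_on_G[where w="\<lambda>z. 0"] cont) auto
  have cL: "continuous_on ?R (\<lambda>z. lagr (X (fst z) (snd z)) (Xt (fst z) (snd z)))"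
    unfolding lagr_def using U
    by (intro continuous_intros continuous_on_G[where w="\<lambda>z. 0"] continuous_on_W[where w="\<lambda>z. 0" and v="\<lambda>z. 0"] cont) auto
  have "continuous_on ?R (\<lambda>z. V (fst z) (snd z))"
  proof -
    have "X (fst z) (snd z) \<in> U" if "z \<in> ?R" for z using U that by auto
    moreover have "N (fst z) (snd z) \<noteq> 0" if "z \<in> ?R" for z using N[of "fst z" "snd z"] that by auto
    ultimately show ?thesis unfolding V_def
      by (intro continuous_intros continuous_on_G[where w="\<lambda>z. 0"] continuous_on_DG
          continuous_on_DW[where v="\<lambda>z. 0"] continuous_on_W[where w="\<lambda>z. 0" and v="\<lambda>z. 0"] cont cN) auto
  qed
  then have cV: "continuous_on (?I \<times> cbox a b) (\<lambda>(s, t). V s t)" by (simp add: split_beta)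
  have "((\<lambda>s. integral (cbox a b) (\<lambda>t. lagr (X s t) (Xt s t))) has_field_derivative
      integral (cbox a b) (V 0)) (at 0 within ?I)"
  proof (rule leibniz_rule_field_derivative)
    show "((\<lambda>s. lagr (X s t) (Xt s t)) has_field_derivative V s t) (at s within ?I)"
      if "s \<in> ?I" "t \<in> cbox a b" for s t using dL that by simp
    show "(\<lambda>t. lagr (X s t) (Xt s t)) integrable_on cbox a b" if "s \<in> ?I" for s
    proof -
      have "continuous_on {a..b} (\<lambda>t. lagr (X s t) (Xt s t))"
        using that by (intro continuous_on_compose2[OF cL, of "{a..b}" "\<lambda>t. (s, t)", simplified])
          (auto intro!: continuous_intros)
      then show ?thesis by (simp add: integrable_continuous_interval)
    qed
  qed (use cV z0 in auto)
  then have d: "((\<lambda>s. integral {a..b} (\<lambda>t. lagr (X s t) (Xt s t))) has_real_derivative integral {a..b} (V 0)) (at 0)"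
    using z0 by (simp add: at_within_open[OF z0 open_greaterThanLessThan])
  \<comment> \<open>integration by parts: the momentum paired with the variation field vanishes at the ends\<close>
  define P where "P = (\<lambda>t. G (X 0 t) (Xt 0 t) (Xs 0 t) / N 0 t + W (X 0 t) (Xs 0 t))"
  define EL where "EL = (\<lambda>t. euler_lagrange (X 0 t) (Xt 0 t) (Z t) (Xs 0 t))"
  have dP: "(P has_real_derivative V 0 t - EL t) (at t within {a..b})" if t: "t \<in> {a..b}" for t
  proof -
    have U0: "X 0 s \<in> U" if "s \<in> {a..b}" for s using U[OF z0 that] .
    have n: "N 0 t > 0" using N[OF z0 t] .
    have g: "G (X 0 t) (Xt 0 t) (Xt 0 t) > 0" using pos[OF z0 t] .
    have n2: "N 0 t * N 0 t = G (X 0 t) (Xt 0 t) (Xt 0 t)" using g by (simp add: N_def)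
    have d1: "((\<lambda>t. G (X 0 t) (Xt 0 t) (Xs 0 t)) has_real_derivative
       DG (X 0 t) (Xt 0 t) (Xt 0 t) (Xs 0 t) + G (X 0 t) (Z t) (Xs 0 t) + G (X 0 t) (Xt 0 t) (Xst 0 t)) (at t within {a..b})"
      by (rule has_derivative_G_along[OF U0 t dXt[OF t] dXtt[OF t] dXts[OF t]])
    have d2: "((\<lambda>t. G (X 0 t) (Xt 0 t) (Xt 0 t)) has_real_derivative
       DG (X 0 t) (Xt 0 t) (Xt 0 t) (Xt 0 t) + G (X 0 t) (Z t) (Xt 0 t) + G (X 0 t) (Xt 0 t) (Z t)) (at t within {a..b})"
      by (rule has_derivative_G_along[OF U0 t dXt[OF t] dXtt[OF t] dXtt[OF t]])
    have d3: "((\<lambda>t. W (X 0 t) (Xs 0 t)) has_real_derivative DW (X 0 t) (Xt 0 t) (Xs 0 t) + W (X 0 t) (Xst 0 t)) (at t within {a..b})"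
      by (rule has_derivative_W_along[OF U0 t dXt[OF t] dXts[OF t] dXts[OF t]])
    have dN: "((\<lambda>t. N 0 t) has_real_derivative (DG (X 0 t) (Xt 0 t) (Xt 0 t) (Xt 0 t) / 2
        + G (X 0 t) (Z t) (Xt 0 t)) / N 0 t) (at t within {a..b})"
    proof -
      have "((\<lambda>t. N 0 t) has_real_derivative (DG (X 0 t) (Xt 0 t) (Xt 0 t) (Xt 0 t)
         + G (X 0 t) (Z t) (Xt 0 t) + G (X 0 t) (Xt 0 t) (Z t)) / 2 / N 0 t) (at t within {a..b})"
        using g unfolding N_def by (auto intro!: derivative_eq_intros d2 simp: field_simps)
      then show ?thesis by (rule DERIV_cong) (simp add: G_sym[OF U0[OF t], of "Xt 0 t"] add_divide_distrib)
    qed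
    have "(P has_real_derivative ((DG (X 0 t) (Xt 0 t) (Xt 0 t) (Xs 0 t) + G (X 0 t) (Z t) (Xs 0 t)
        + G (X 0 t) (Xt 0 t) (Xst 0 t)) * N 0 t - G (X 0 t) (Xt 0 t) (Xs 0 t) *
        ((DG (X 0 t) (Xt 0 t) (Xt 0 t) (Xt 0 t) / 2 + G (X 0 t) (Z t) (Xt 0 t)) / N 0 t)) / (N 0 t * N 0 t)
        + (DW (X 0 t) (Xt 0 t) (Xs 0 t) + W (X 0 t) (Xst 0 t))) (at t within {a..b})"
      unfolding P_def using n by (intro DERIV_add DERIV_divide d1 dN d3) auto
    then show ?thesis
    proof (rule DERIV_cong)
      have sp: "speed (X 0 t) (Xt 0 t) = N 0 t" by (simp add: speed_def N_def)
      show "((DG (X 0 t) (Xt 0 t) (Xt 0 t) (Xs 0 t) + G (X 0 t) (Z t) (Xs 0 t)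
        + G (X 0 t) (Xt 0 t) (Xst 0 t)) * N 0 t - G (X 0 t) (Xt 0 t) (Xs 0 t) *
        ((DG (X 0 t) (Xt 0 t) (Xt 0 t) (Xt 0 t) / 2 + G (X 0 t) (Z t) (Xt 0 t)) / N 0 t)) / (N 0 t * N 0 t)
        + (DW (X 0 t) (Xt 0 t) (Xs 0 t) + W (X 0 t) (Xst 0 t)) = V 0 t - EL t"
        using n unfolding V_def EL_def euler_lagrange_def sp dW_def
        by (simp add: G_sym[OF U0[OF t], of "Xst 0 t"] divide_simps power3_eq_cube) (simp add: algebra_simps)
    qed
  qed
  have "((\<lambda>t. V 0 t - EL t) has_integral (P b - P a)) {a..b}"
    using ab dP by (intro fundamental_theorem_of_calculus)
      (auto simp: has_real_derivative_iff_has_vector_derivative[symmetric])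
  moreover have "P b = 0" "P a = 0"
    using fixed U[OF z0, of a] U[OF z0, of b] ab by (auto simp: P_def G_simps linear_0[OF linear_W])
  ultimately have i: "((\<lambda>t. V 0 t - EL t) has_integral 0) {a..b}" by simp
  have "continuous_on {a..b} (V 0)"
  proof -
    have "continuous_on {a..b} (\<lambda>t. case (0, t) of (s, t) \<Rightarrow> V s t)"
      by (rule continuous_on_compose2[OF cV, of "{a..b}" "\<lambda>t. (0, t)"]) (use z0 in \<open>auto intro!: continuous_intros\<close>)
    then show ?thesis by simp
  qed
  then have iV: "(V 0) integrable_on {a..b}" by (rule integrable_continuous_interval)
  have "((\<lambda>t. V 0 t - (V 0 t - EL t)) has_integral (integral {a..b} (V 0) - 0)) {a..b}"
    by (rule has_integral_diff[OF integrable_integral[OF iV] i])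
  then have "integral {a..b} EL = integral {a..b} (V 0)" by (simp add: integral_unique)
  then show ?thesis using d by (simp add: EL_def)
qed

end

text \<open>The partial derivatives of the local extensions at points of the strip are one-sided derivatives
  of \<open>X\<close>, so they fit together. Both mixed derivatives are \<open>Xst\<close> by the symmetry of the second
  derivatives of the extensions.\<close>

lemma C2_strip_partials:
  fixes X :: "real \<times> real \<Rightarrow> 'e::euclidean_space"
  assumes ab: "a < b"
    and extends: "\<And>z. z \<in> {-e<..<e} \<times> {a..b} \<Longrightarrow> \<exists>N h. open N \<and> z \<in> N \<and> Ck_on 2 N h \<and>
        (\<forall>y\<in>N \<inter> ({-e<..<e} \<times> {a..b}). h y = X y)"
  obtains Xs Xt Xst where
    "\<And>s t. s \<in> {-e<..<e} \<Longrightarrow> t \<in> {a..b} \<Longrightarrow> ((\<lambda>t. X (s, t)) has_vector_derivative Xt s t) (at t within {a..b})"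
    "\<And>s t. s \<in> {-e<..<e} \<Longrightarrow> t \<in> {a..b} \<Longrightarrow> ((\<lambda>s. X (s, t)) has_vector_derivative Xs s t) (at s within {-e<..<e})"
    "\<And>s t. s \<in> {-e<..<e} \<Longrightarrow> t \<in> {a..b} \<Longrightarrow> ((\<lambda>s. Xt s t) has_vector_derivative Xst s t) (at s within {-e<..<e})"
    "\<And>s t. s \<in> {-e<..<e} \<Longrightarrow> t \<in> {a..b} \<Longrightarrow> ((\<lambda>t. Xs s t) has_vector_derivative Xst s t) (at t within {a..b})"
    "continuous_on ({-e<..<e} \<times> {a..b}) X"
    "continuous_on ({-e<..<e} \<times> {a..b}) (\<lambda>z. Xt (fst z) (snd z))"
    "continuous_on ({-e<..<e} \<times> {a..b}) (\<lambda>z. Xs (fst z) (snd z))"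
    "continuous_on ({-e<..<e} \<times> {a..b}) (\<lambda>z. Xst (fst z) (snd z))"
proof -
  let ?I = "{-e<..<e}" and ?R = "{-e<..<e} \<times> {a..b}"
  define good where "good = (\<lambda>N h. open N \<and> Ck_on 2 N h \<and> (\<forall>y\<in>N \<inter> ?R. h y = X y))"
  define D where "D = (\<lambda>(h :: real \<times> real \<Rightarrow> 'e) v y. frechet_derivative h (at y) v)"
  define Xt where "Xt = (\<lambda>s t. vector_derivative (\<lambda>t. X (s, t)) (at t within {a..b}))"
  define Xs where "Xs = (\<lambda>s t. vector_derivative (\<lambda>s. X (s, t)) (at s within ?I))"
  define Xst where "Xst = (\<lambda>s t. vector_derivative (\<lambda>s. Xt s t) (at s within ?I))"
  have vertical: "((\<lambda>t. (s, t)) has_vector_derivative (0, 1)) (at t within T)"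
    and horizontal: "((\<lambda>s. (s, t)) has_vector_derivative (1, 0)) (at s within T)" for s t :: real and T
    by (auto intro!: derivative_eq_intros simp: has_vector_derivative_def)
  have nb_t: "at t within {a..b} \<noteq> bot" if "t \<in> {a..b}" for t
    using ab that by (simp add: trivial_limit_within islimpt_Icc)
  have nb_s: "at s within ?I \<noteq> bot" if "s \<in> ?I" for s
    using that at_within_open[OF that open_greaterThanLessThan] by simp
  have Dh: "(h has_derivative (\<lambda>v. D h v y)) (at y)" if "good N h" "y \<in> N" for N h y
    using Ck_on_2D(1)[of N h y] that by (auto simp: good_def D_def)
  have DDh: "((\<lambda>y. D h v y) has_derivative (\<lambda>w. D (\<lambda>y. D h v y) w y)) (at y)" if "good N h" "y \<in> N" for N h y v
    using Ck_on_has_derivative[of 0 N "\<lambda>y. D h v y" y] Ck_on_2D(2)[of N h v] that by (auto simp: good_def D_def)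
  have cD: "continuous_on N (\<lambda>y. D h v y)" "continuous_on N (\<lambda>y. D (\<lambda>y. D h v y) w y)" "continuous_on N h"
    if "good N h" for N h v w
    using Ck_on_2D(2)[of N h v] Ck_on_continuous[of 2 N h] Ck_on_continuous[of 1 N "D h v"] that
    by (cases w; auto simp: good_def D_def)+
  have dXt: "((\<lambda>t. X (s, t)) has_vector_derivative D h (0, 1) (s, t)) (at t within {a..b})"
    if "good N h" "(s, t) \<in> N \<inter> ?R" for N h s t
    by (rule has_vector_derivative_along_curve[where N=N, OF _ _ _ vertical Dh[OF that(1)]]) (use that in \<open>auto simp: good_def\<close>)
  have dXs: "((\<lambda>s. X (s, t)) has_vector_derivative D h (1, 0) (s, t)) (at s within ?I)"
    if "good N h" "(s, t) \<in> N \<inter> ?R" for N h s t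
    by (rule has_vector_derivative_along_curve[where N=N, OF _ _ _ horizontal Dh[OF that(1)]]) (use that in \<open>auto simp: good_def\<close>)
  have Xt: "Xt s t = D h (0, 1) (s, t)" and Xs: "Xs s t = D h (1, 0) (s, t)"
    if "good N h" "(s, t) \<in> N \<inter> ?R" for N h s t
    unfolding Xt_def Xs_def using that(2)
    by (auto intro!: vector_derivative_within[OF nb_t dXt[OF that]] vector_derivative_within[OF nb_s dXs[OF that]])
  have dXst: "((\<lambda>s. Xt s t) has_vector_derivative D (\<lambda>y. D h (0, 1) y) (1, 0) (s, t)) (at s within ?I)"
    if "good N h" "(s, t) \<in> N \<inter> ?R" for N h s t
    by (rule has_vector_derivative_along_curve[where N=N, OF _ _ _ horizontal DDh[OF that(1)]]) (use that Xt[OF that(1)] in \<open>auto simp: good_def\<close>)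
  have Xst: "Xst s t = D (\<lambda>y. D h (0, 1) y) (1, 0) (s, t)"
    if "good N h" "(s, t) \<in> N \<inter> ?R" for N h s t
    unfolding Xst_def using that(2) by (intro vector_derivative_within[OF nb_s dXst[OF that]]) auto
  have dXts: "((\<lambda>t. Xs s t) has_vector_derivative Xst s t) (at t within {a..b})"
    if "good N h" "(s, t) \<in> N \<inter> ?R" for N h s t
  proof -
    have "((\<lambda>t. Xs s t) has_vector_derivative D (\<lambda>y. D h (1, 0) y) (0, 1) (s, t)) (at t within {a..b})"
      by (rule has_vector_derivative_along_curve[where N=N, OF _ _ _ vertical DDh[OF that(1)]]) (use that Xs[OF that(1)] in \<open>auto simp: good_def\<close>)
    moreover have "D (\<lambda>y. D h (1, 0) y) (0, 1) (s, t) = D (\<lambda>y. D h (0, 1) y) (1, 0) (s, t)"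
      unfolding D_def by (rule mixed_partials_commute) (use that in \<open>auto simp: good_def\<close>)
    ultimately show ?thesis by (simp add: Xst[OF that])
  qed
  have good: "\<exists>N h. good N h \<and> z \<in> N" if "z \<in> ?R" for z using extends[OF that] by (auto simp: good_def)
  have cont: "continuous_on ?R f"
    if "\<And>N h. good N h \<Longrightarrow> \<exists>g. continuous_on N g \<and> (\<forall>y\<in>N \<inter> ?R. f y = g y)" for f :: "real \<times> real \<Rightarrow> 'e"
  proof (rule continuous_on_locally_extends)
    fix z assume "z \<in> ?R"
    then obtain N h where N: "good N h" "z \<in> N" using good by blast
    then show "\<exists>N g. open N \<and> z \<in> N \<and> continuous_on N g \<and> (\<forall>y\<in>N \<inter> ?R. f y = g y)"
      using that[OF N(1)] unfolding good_def by blast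
  qed
  show thesis
  proof (rule that[of Xt Xs Xst])
    fix s t assume st: "s \<in> ?I" "t \<in> {a..b}"
    then obtain N h where N: "good N h" "(s, t) \<in> N \<inter> ?R" using good[of "(s, t)"] by blast
    show "((\<lambda>t. X (s, t)) has_vector_derivative Xt s t) (at t within {a..b})"
      using dXt[OF N] Xt[OF N] by simp
    show "((\<lambda>s. X (s, t)) has_vector_derivative Xs s t) (at s within ?I)"
      using dXs[OF N] Xs[OF N] by simp
    show "((\<lambda>s. Xt s t) has_vector_derivative Xst s t) (at s within ?I)"
      using dXst[OF N] Xst[OF N] by simp
    show "((\<lambda>t. Xs s t) has_vector_derivative Xst s t) (at t within {a..b})" by (rule dXts[OF N])
  next
    show "continuous_on ?R X"
      by (rule cont) (use cD(3) in \<open>force simp: good_def\<close>)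
    show "continuous_on ?R (\<lambda>z. Xt (fst z) (snd z))"
      by (rule cont) (use cD(1) Xt in \<open>force\<close>)
    show "continuous_on ?R (\<lambda>z. Xs (fst z) (snd z))"
      by (rule cont) (use cD(1) Xs in \<open>force\<close>)
    show "continuous_on ?R (\<lambda>z. Xst (fst z) (snd z))"
      by (rule cont) (use cD(2) Xst in \<open>force\<close>)
  qed
qed

section \<open>Charts, tangent vectors and differentials\<close>

lemma atlas_charts_at: "c \<in> charts_at M p \<Longrightarrow> c \<in> atlas M" "c \<in> charts_at M p \<Longrightarrow> p \<in> fst c"
  by (auto simp: charts_at_def)

lemma charts_atI: "c \<in> atlas M \<Longrightarrow> p \<in> fst c \<Longrightarrow> c \<in> charts_at M p"
  by (auto simp: charts_at_def)

locale smooth_mfd =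
  fixes M :: "('a, 'e::euclidean_space) manifold"
  assumes smooth: "smooth_manifold M"
begin

context fixes c assumes c: "c \<in> atlas M" begin

lemma chart: "is_chart (mtop M) c" using smooth c by (auto simp: smooth_manifold_def)

lemma openin_chart: "openin (mtop M) (fst c)" and open_chart_range: "open (snd c ` fst c)"
  and chart_homeomorphic: "homeomorphic_map (subtopology (mtop M) (fst c)) (top_of_set (snd c ` fst c)) (snd c)"
  using chart by (auto simp: is_chart_def)

lemma chart_subset: "fst c \<subseteq> points M" using openin_chart by (rule openin_subset)

lemma topspace_chart: "topspace (subtopology (mtop M) (fst c)) = fst c"
  using chart_subset by (auto simp: topspace_subtopology)

lemma chart_inj: "inj_on (snd c) (fst c)"
  using chart_homeomorphic unfolding homeomorphic_map_def topspace_chart by blast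

lemma cinv_chart [simp]: "p \<in> fst c \<Longrightarrow> cinv c (snd c p) = p"
  unfolding cinv_def using chart_inj by (rule inv_into_f_f)

lemma chart_cinv [simp]: "x \<in> snd c ` fst c \<Longrightarrow> snd c (cinv c x) = x"
  and cinv_in_chart [simp]: "x \<in> snd c ` fst c \<Longrightarrow> cinv c x \<in> fst c"
  unfolding cinv_def by (auto simp: f_inv_into_f inv_into_into)

lemma open_chart_image:
  assumes "openin (mtop M) S" "S \<subseteq> fst c" shows "open (snd c ` S)"
proof -
  have "openin (subtopology (mtop M) (fst c)) S"
    using assms by (auto simp: openin_subtopology)
  then have "openin (top_of_set (snd c ` fst c)) (snd c ` S)"
    using homeomorphic_imp_open_map[OF chart_homeomorphic] by (simp add: open_map_def)
  then show ?thesis using open_chart_range by (simp add: openin_open_eq)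
qed

lemma openin_chart_preimage:
  assumes "open V" shows "openin (mtop M) {p \<in> fst c. snd c p \<in> V}"
proof -
  have "openin (top_of_set (snd c ` fst c)) (snd c ` fst c \<inter> V)" using assms by (auto simp: openin_open)
  then have "openin (subtopology (mtop M) (fst c))
      {p \<in> topspace (subtopology (mtop M) (fst c)). snd c p \<in> snd c ` fst c \<inter> V}"
    using homeomorphic_imp_continuous_map[OF chart_homeomorphic] openin_continuous_map_preimage by blast
  moreover have "{p \<in> fst c. snd c p \<in> snd c ` fst c \<inter> V} = {p \<in> fst c. snd c p \<in> V}" by auto
  ultimately have "openin (subtopology (mtop M) (fst c)) {p \<in> fst c. snd c p \<in> V}"
    unfolding topspace_chart by simp
  then show ?thesis using openin_trans_full openin_chart by blast
qed

end

lemma points_covered: "p \<in> points M \<Longrightarrow> \<exists>c. c \<in> charts_at M p"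
proof -
  assume "p \<in> points M"
  then have "p \<in> (\<Union>c\<in>atlas M. fst c)" using smooth unfolding smooth_manifold_def by blast
  then show ?thesis unfolding charts_at_def by blast
qed

lemma charts_at_points: "c \<in> charts_at M p \<Longrightarrow> p \<in> points M"
  using chart_subset[of c] unfolding charts_at_def by blast

lemma smooth_map_id: "smooth_map M id"
  using smooth by (auto simp: smooth_map_def smooth_manifold_def Int_def)

text \<open>The coordinate expression of a map. For the identity it is the change of charts, so that one
  chain rule covers tangent vectors, differentials and changes of charts.\<close>

definition loc :: "('a \<Rightarrow> 'a) \<Rightarrow> ('a, 'e) chart \<Rightarrow> ('a, 'e) chart \<Rightarrow> 'e \<Rightarrow> 'e" where
  "loc \<phi> c d = snd d \<circ> \<phi> \<circ> cinv c"

definition loc_dom :: "('a \<Rightarrow> 'a) \<Rightarrow> ('a, 'e) chart \<Rightarrow> ('a, 'e) chart \<Rightarrow> 'e set" where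
  "loc_dom \<phi> c d = snd c ` {p \<in> fst c. \<phi> p \<in> fst d}"

abbreviation Dloc :: "('a \<Rightarrow> 'a) \<Rightarrow> ('a, 'e) chart \<Rightarrow> ('a, 'e) chart \<Rightarrow> 'e \<Rightarrow> 'e \<Rightarrow> 'e" where
  "Dloc \<phi> c d x \<equiv> frechet_derivative (loc \<phi> c d) (at x)"

lemma loc_dom_subset: "loc_dom \<phi> c d \<subseteq> snd c ` fst c" by (auto simp: loc_dom_def)

context
  fixes \<phi> c d assumes \<phi>: "smooth_map M \<phi>" and c: "c \<in> atlas M" and d: "d \<in> atlas M"
begin

lemma open_loc_dom: "open (loc_dom \<phi> c d)"
proof -
  have "openin (mtop M) {p \<in> points M. \<phi> p \<in> fst d}"
    using \<phi> openin_chart[OF d] by (auto simp: smooth_map_def intro: openin_continuous_map_preimage)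
  then have "openin (mtop M) (fst c \<inter> {p \<in> points M. \<phi> p \<in> fst d})"
    using openin_chart[OF c] by (rule openin_Int[rotated])
  moreover have "fst c \<inter> {p \<in> points M. \<phi> p \<in> fst d} = {p \<in> fst c. \<phi> p \<in> fst d}"
    using chart_subset[OF c] by auto
  ultimately show ?thesis unfolding loc_dom_def by (intro open_chart_image[OF c]) auto
qed

lemma Ck_on_loc: "Ck_on k (loc_dom \<phi> c d) (loc \<phi> c d)"
  using \<phi> c d unfolding smooth_map_def loc_def loc_dom_def by (blast intro: smooth_on_imp_Ck_on)

lemma has_derivative_loc: "x \<in> loc_dom \<phi> c d \<Longrightarrow> (loc \<phi> c d has_derivative Dloc \<phi> c d x) (at x)"
  using Ck_on_2D(1)[OF Ck_on_loc] .

lemma linear_Dloc: "x \<in> loc_dom \<phi> c d \<Longrightarrow> linear (Dloc \<phi> c d x)"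
  using has_derivative_loc by (rule has_derivative_linear)

lemma loc_dom_iff: "x \<in> loc_dom \<phi> c d \<longleftrightarrow> x \<in> snd c ` fst c \<and> \<phi> (cinv c x) \<in> fst d"
  using c by (auto simp: loc_dom_def image_iff)

lemma loc_in_range: "x \<in> loc_dom \<phi> c d \<Longrightarrow> loc \<phi> c d x \<in> snd d ` fst d"
  and cinv_loc: "x \<in> loc_dom \<phi> c d \<Longrightarrow> cinv d (loc \<phi> c d x) = \<phi> (cinv c x)"
  using d by (auto simp: loc_dom_iff loc_def)

end

lemma Dloc_chain:
  assumes \<phi>: "smooth_map M \<phi>" and \<psi>: "smooth_map M \<psi>"
    and c: "c \<in> charts_at M p" and d: "d \<in> charts_at M (\<phi> p)" and e: "e \<in> charts_at M (\<psi> (\<phi> p))"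
  shows "Dloc (\<psi> \<circ> \<phi>) c e (snd c p) u = Dloc \<psi> d e (snd d (\<phi> p)) (Dloc \<phi> c d (snd c p) u)"
proof -
  note at = atlas_charts_at[OF c] atlas_charts_at[OF d] atlas_charts_at[OF e]
  have x: "snd c p \<in> loc_dom \<phi> c d" using at by (auto simp: loc_dom_def)
  have fx: "loc \<phi> c d (snd c p) = snd d (\<phi> p)" using at by (simp add: loc_def)
  have y: "snd d (\<phi> p) \<in> loc_dom \<psi> d e" using at by (auto simp: loc_dom_def)
  have 1: "((\<lambda>x. loc \<psi> d e (loc \<phi> c d x)) has_derivative
      (\<lambda>u. Dloc \<psi> d e (snd d (\<phi> p)) (Dloc \<phi> c d (snd c p) u))) (at (snd c p))"
    using has_derivative_compose[OF has_derivative_loc[OF \<phi> at(1,3) x]]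
      has_derivative_loc[OF \<psi> at(3,5) y] fx by metis
  have "continuous_on (loc_dom \<phi> c d) (loc \<phi> c d)" using Ck_on_loc[OF \<phi> at(1,3), of 0] by simp
  then have op: "open (loc_dom \<phi> c d \<inter> loc \<phi> c d -` loc_dom \<psi> d e)"
    using continuous_on_open_vimage[OF open_loc_dom[OF \<phi> at(1,3)]] open_loc_dom[OF \<psi> at(3,5)]
    by (metis Int_commute)
  have "(loc (\<psi> \<circ> \<phi>) c e has_derivative
      (\<lambda>u. Dloc \<psi> d e (snd d (\<phi> p)) (Dloc \<phi> c d (snd c p) u))) (at (snd c p))"
  proof (rule has_derivative_transform_within_open[OF 1 op])
    fix x assume x': "x \<in> loc_dom \<phi> c d \<inter> loc \<phi> c d -` loc_dom \<psi> d e"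
    then show "loc \<psi> d e (loc \<phi> c d x) = loc (\<psi> \<circ> \<phi>) c e x"
      using cinv_loc[OF \<phi> at(1,3), of x] by (simp add: loc_def[of \<psi>] loc_def[of "\<psi> \<circ> \<phi>"])
  qed (use x y fx in auto)
  then show ?thesis by (metis frechet_derivative_at)
qed

lemma Dloc_identity:
  assumes c: "c \<in> charts_at M p" and id: "\<And>q. q \<in> points M \<Longrightarrow> \<phi> q = q"
  shows "Dloc \<phi> c c (snd c p) u = u"
proof -
  note at = atlas_charts_at[OF c]
  have "((\<lambda>x. x) has_derivative (\<lambda>u. u)) (at (snd c p))" by simp
  then have "(loc \<phi> c c has_derivative (\<lambda>u. u)) (at (snd c p))"
  proof (rule has_derivative_transform_within_open[OF _ open_chart_range[OF at(1)]])
    fix x assume x: "x \<in> snd c ` fst c"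
    then have "cinv c x \<in> points M" using at(1) chart_subset[OF at(1)] cinv_in_chart by blast
    then show "x = loc \<phi> c c x" using at x id by (simp add: loc_def)
  qed (use at in auto)
  then show ?thesis by (metis frechet_derivative_at)
qed

lemma tvec_eq: "tvec M c p u = (\<lambda>d. if d \<in> charts_at M p then Dloc id c d (snd c p) u else 0)"
  by (rule ext) (simp add: tvec_def loc_def)

lemma tvec_self: "c \<in> charts_at M p \<Longrightarrow> tvec M c p u c = u"
  by (simp add: tvec_eq Dloc_identity)

lemma tangent_space_iff: "\<xi> \<in> tangent_space M p \<longleftrightarrow> (\<forall>c. c \<notin> charts_at M p \<longrightarrow> \<xi> c = 0) \<and>
     (\<forall>c\<in>charts_at M p. \<forall>d\<in>charts_at M p. \<xi> d = Dloc id c d (snd c p) (\<xi> c))"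
  by (simp add: tangent_space_def loc_def)

lemma Dloc_id_chain:
  assumes "c \<in> charts_at M p" "d \<in> charts_at M p" "e \<in> charts_at M p"
  shows "Dloc id c e (snd c p) u = Dloc id d e (snd d p) (Dloc id c d (snd c p) u)"
  using Dloc_chain[OF smooth_map_id smooth_map_id assms(1), of d e u] assms(2,3) by (simp only: id_apply id_o)

lemma tvec_tangent:
  assumes c: "c \<in> charts_at M p" shows "tvec M c p u \<in> tangent_space M p"
  unfolding tangent_space_iff
proof (intro conjI allI ballI impI)
  fix d e assume de: "d \<in> charts_at M p" "e \<in> charts_at M p"
  show "tvec M c p u e = Dloc id d e (snd d p) (tvec M c p u d)"
    unfolding tvec_eq if_P[OF de(1)] if_P[OF de(2)] by (rule Dloc_id_chain[OF c de])
qed (simp add: tvec_def)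

lemma tangent_eq_tvec:
  assumes c: "c \<in> charts_at M p" and \<xi>: "\<xi> \<in> tangent_space M p" shows "\<xi> = tvec M c p (\<xi> c)"
proof (rule ext)
  fix d
  show "\<xi> d = tvec M c p (\<xi> c) d"
  proof (cases "d \<in> charts_at M p")
    case True
    then have "\<xi> d = Dloc id c d (snd c p) (\<xi> c)" using \<xi> c unfolding tangent_space_iff by blast
    with True show ?thesis by (simp only: tvec_eq if_True)
  next
    case False
    then have "\<xi> d = 0" using \<xi> unfolding tangent_space_iff by blast
    with False show ?thesis by (simp add: tvec_def)
  qed
qed

lemma linear_Dloc_id: "c \<in> charts_at M p \<Longrightarrow> d \<in> charts_at M p \<Longrightarrow> linear (Dloc id c d (snd c p))"
  by (rule linear_Dloc[OF smooth_map_id]) (auto simp: charts_at_def loc_dom_def)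

lemma tvec_add: "c \<in> charts_at M p \<Longrightarrow> tvec M c p (u + v) = tadd (tvec M c p u) (tvec M c p v)"
  and tvec_scale: "c \<in> charts_at M p \<Longrightarrow> tvec M c p (r *\<^sub>R u) = tscale r (tvec M c p u)"
  by (auto simp: tvec_eq tadd_def tscale_def fun_eq_iff linear_add[OF linear_Dloc_id] linear_cmul[OF linear_Dloc_id])

lemma tvec_nonzero: "c \<in> charts_at M p \<Longrightarrow> u \<noteq> 0 \<Longrightarrow> tvec M c p u \<noteq> tzero"
  using tvec_self by (metis tzero_def)

lemma differential_tvec:
  assumes \<phi>: "smooth_map M \<phi>" and c: "c \<in> charts_at M p" and d: "d \<in> charts_at M (\<phi> p)"
  shows "differential M \<phi> p (tvec M c p u) = tvec M d (\<phi> p) (Dloc \<phi> c d (snd c p) u)"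
proof (rule ext)
  fix e
  define b where "b = (SOME c. c \<in> charts_at M p)"
  have b: "b \<in> charts_at M p" unfolding b_def using c by (rule someI)
  show "differential M \<phi> p (tvec M c p u) e = tvec M d (\<phi> p) (Dloc \<phi> c d (snd c p) u) e"
  proof (cases "e \<in> charts_at M (\<phi> p)")
    case True
    have "differential M \<phi> p (tvec M c p u) e = Dloc \<phi> b e (snd b p) (Dloc id c b (snd c p) u)"
      using True b by (simp add: differential_def loc_def tvec_def Let_def flip: b_def)
    also have "\<dots> = Dloc (\<phi> \<circ> id) c e (snd c p) u"
      using Dloc_chain[OF smooth_map_id \<phi> c, of b e u] b True by simp
    also have "\<dots> = Dloc (id \<circ> \<phi>) c e (snd c p) u" by simp
    also have "\<dots> = Dloc id d e (snd d (\<phi> p)) (Dloc \<phi> c d (snd c p) u)"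
      using Dloc_chain[OF \<phi> smooth_map_id c d, of e u] True by simp
    finally show ?thesis using True by (simp add: tvec_eq)
  qed (simp add: differential_def tvec_def)
qed

lemma smooth_map_points: "smooth_map M \<phi> \<Longrightarrow> p \<in> points M \<Longrightarrow> \<phi> p \<in> points M"
  by (auto simp: smooth_map_def continuous_map_def Pi_iff)

text \<open>The chain rule for the inverse diffeomorphism after \<open>\<phi>\<close>.\<close>

lemma Dloc_nonzero:
  assumes \<phi>: "diffeomorphism M \<phi>" and c: "c \<in> charts_at M p" and d: "d \<in> charts_at M (\<phi> p)" and u: "u \<noteq> 0"
  shows "Dloc \<phi> c d (snd c p) u \<noteq> 0"
proof
  assume 0: "Dloc \<phi> c d (snd c p) u = 0"
  define \<psi> where "\<psi> = inv_into (points M) \<phi>"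
  have s: "smooth_map M \<phi>" "smooth_map M \<psi>" and inj: "inj_on \<phi> (points M)"
    using \<phi> by (auto simp: diffeomorphism_def \<psi>_def bij_betw_def)
  have inv: "\<psi> (\<phi> q) = q" if "q \<in> points M" for q using inj that by (simp add: \<psi>_def)
  have c': "c \<in> charts_at M (\<psi> (\<phi> p))" using c inv charts_at_points by metis
  have "u = Dloc (\<psi> \<circ> \<phi>) c c (snd c p) u" using inv by (intro Dloc_identity[OF c, symmetric]) simp
  also have "\<dots> = Dloc \<psi> d c (snd d (\<phi> p)) 0" unfolding Dloc_chain[OF s c d c'] 0 ..
  also have "\<dots> = 0"
    by (intro linear_0 linear_Dloc[OF s(2)]) (use c' d in \<open>auto simp: charts_at_def loc_dom_def\<close>)
  finally show False using u by simp
qed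


section \<open>Local expressions of Randers metrics\<close>

lemma chart_point:
  assumes "c \<in> atlas M" "x \<in> snd c ` fst c"
  shows "c \<in> charts_at M (cinv c x)" "cinv c x \<in> points M" "snd c (cinv c x) = x"
  using assms chart_subset[OF assms(1)] cinv_in_chart[OF assms] by (auto intro: charts_atI)

lemma inner_form_coords:
  assumes g: "riemannian_metric M g" and c: "c \<in> charts_at M p"
  shows "inner_form (\<lambda>u v. g p (tvec M c p u) (tvec M c p v))"
proof -
  have p: "p \<in> points M" using c by (rule charts_at_points)
  note t = tvec_tangent[OF c]
  have lin: "linear_at M p (\<lambda>\<xi>. g p \<xi> \<eta>)" if "\<eta> \<in> tangent_space M p" for \<eta>
    using g p that unfolding riemannian_metric_def by blast
  have "linear (\<lambda>u. g p (tvec M c p u) (tvec M c p v))" for v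
    using lin[OF t[of v]] unfolding linear_at_def
    by (intro linearI) (simp_all add: tvec_add[OF c] tvec_scale[OF c] t)
  moreover have "g p (tvec M c p u) (tvec M c p v) = g p (tvec M c p v) (tvec M c p u)" for u v
    using g p t[of u] t[of v] unfolding riemannian_metric_def by blast
  moreover have "g p (tvec M c p u) (tvec M c p u) > 0" if "u \<noteq> 0" for u
    using g p t[of u] tvec_nonzero[OF c that] unfolding riemannian_metric_def by blast
  ultimately show ?thesis unfolding inner_form_def by blast
qed

lemma linear_coords:
  assumes \<omega>: "one_form M \<omega>" and c: "c \<in> charts_at M p"
  shows "linear (\<lambda>u. \<omega> p (tvec M c p u))"
proof -
  have "linear_at M p (\<omega> p)" using \<omega> charts_at_points[OF c] unfolding one_form_def by blast
  then show ?thesis unfolding linear_at_def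
    by (intro linearI) (simp_all add: tvec_add[OF c] tvec_scale[OF c] tvec_tangent[OF c])
qed

lemma randers_data_chart:
  assumes g: "riemannian_metric M g" and \<omega>: "one_form M \<omega>" and c: "c \<in> atlas M"
  shows "randers_data (snd c ` fst c) (bilinear_coords M g c) (fiber_coords M \<omega> c)"
proof (rule randers_data.intro)
  fix x assume x: "x \<in> snd c ` fst c"
  show "inner_form (bilinear_coords M g c x)"
    using inner_form_coords[OF g chart_point(1)[OF c x]] by (simp add: bilinear_coords_def[abs_def])
  show "linear (fiber_coords M \<omega> c x)"
    using linear_coords[OF \<omega> chart_point(1)[OF c x]] by (simp add: fiber_coords_def[abs_def])
next
  show "open (snd c ` fst c)" by (rule open_chart_range[OF c])
  show "Ck_on 2 (snd c ` fst c) (\<lambda>x. bilinear_coords M g c x u v)" for u v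
    using g c unfolding riemannian_metric_def by blast
  show "Ck_on 2 (snd c ` fst c) (\<lambda>x. fiber_coords M \<omega> c x u)" for u
    using \<omega> c unfolding one_form_def by blast
qed

context
  fixes \<phi> c d assumes diffeo: "diffeomorphism M \<phi>" and c: "c \<in> atlas M" and d: "d \<in> atlas M"
begin

lemma diffeo_smooth: "smooth_map M \<phi>" using diffeo by (simp add: diffeomorphism_def)

lemma
  assumes x: "x \<in> loc_dom \<phi> c d"
  shows pullback_bilinear_coords: "bilinear_coords M (pullback_bilinear M \<phi> g) c x u v =
        bilinear_coords M g d (loc \<phi> c d x) (Dloc \<phi> c d x u) (Dloc \<phi> c d x v)"
    and pullback_fiber_coords: "fiber_coords M (pullback_finsler M \<phi> F) c x u =
        fiber_coords M F d (loc \<phi> c d x) (Dloc \<phi> c d x u)"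
proof -
  have xc: "x \<in> snd c ` fst c" using x loc_dom_subset by blast
  have dc: "d \<in> charts_at M (\<phi> (cinv c x))"
    using x loc_dom_iff[OF diffeo_smooth c d] d by (intro charts_atI) auto
  have "differential M \<phi> (cinv c x) (tvec M c (cinv c x) u) =
      tvec M d (\<phi> (cinv c x)) (Dloc \<phi> c d x u)" for u
    using differential_tvec[OF diffeo_smooth chart_point(1)[OF c xc] dc] chart_point(3)[OF c xc] by simp
  then show "bilinear_coords M (pullback_bilinear M \<phi> g) c x u v =
        bilinear_coords M g d (loc \<phi> c d x) (Dloc \<phi> c d x u) (Dloc \<phi> c d x v)"
      "fiber_coords M (pullback_finsler M \<phi> F) c x u =
        fiber_coords M F d (loc \<phi> c d x) (Dloc \<phi> c d x u)"
    using cinv_loc[OF diffeo_smooth c d x]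
    by (simp_all add: bilinear_coords_def pullback_bilinear_def fiber_coords_def pullback_finsler_def)
qed

lemma Dloc_nonzero_coords:
  assumes x: "x \<in> loc_dom \<phi> c d" and u: "u \<noteq> 0" shows "Dloc \<phi> c d x u \<noteq> 0"
proof -
  have xc: "x \<in> snd c ` fst c" using x loc_dom_subset by blast
  have "d \<in> charts_at M (\<phi> (cinv c x))"
    using x loc_dom_iff[OF diffeo_smooth c d] d by (intro charts_atI) auto
  from Dloc_nonzero[OF diffeo chart_point(1)[OF c xc] this u] show ?thesis
    using chart_point(3)[OF c xc] by simp
qed

text \<open>The coefficients of the pullback are polynomials in the first derivatives of the smooth map \<open>loc \<phi> c d\<close> and
  in coefficients composed with it.\<close>

lemma randers_data_pullback:
  assumes g: "riemannian_metric M g" and \<omega>: "one_form M \<omega>"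
  shows "randers_data (loc_dom \<phi> c d) (bilinear_coords M (pullback_bilinear M \<phi> g) c)
           (fiber_coords M (pullback_finsler M \<phi> \<omega>) c)"
proof -
  interpret D: randers_data "snd d ` fst d" "bilinear_coords M g d" "fiber_coords M \<omega> d"
    by (rule randers_data_chart[OF g \<omega> d])
  let ?V = "loc_dom \<phi> c d" and ?f = "loc \<phi> c d" and ?D = "Dloc \<phi> c d"
  note V = open_loc_dom[OF diffeo_smooth c d]
  note range = loc_in_range[OF diffeo_smooth c d]
  note lin = linear_Dloc[OF diffeo_smooth c d]
  have Df: "Ck_on 2 ?V (\<lambda>x. ?D x u \<bullet> i)" for u i
  proof -
    have "Ck_on (Suc 2) ?V ?f" by (rule Ck_on_loc[OF diffeo_smooth c d])
    then have "Ck_on 2 ?V (\<lambda>x. ?D x u)" by (simp only: Ck_on.simps)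
    then show ?thesis by (rule Ck_on_linear_comp[OF V bounded_linear_inner_left])
  qed
  have comp: "Ck_on 2 ?V (\<lambda>x. h (?f x))" if "Ck_on 2 (snd d ` fst d) h" for h :: "'e \<Rightarrow> real"
    by (rule Ck_on_compose[OF V open_chart_range[OF d] _ that Ck_on_loc[OF diffeo_smooth c d]])
      (use range in auto)
  show ?thesis
  proof (rule randers_data.intro)
    show "open ?V" by (rule V)
    show "Ck_on 2 ?V (\<lambda>x. bilinear_coords M (pullback_bilinear M \<phi> g) c x u v)" for u v
    proof (subst Ck_on_cong[OF V])
      show "Ck_on 2 ?V (\<lambda>x. \<Sum>i\<in>Basis. \<Sum>j\<in>Basis. (?D x u \<bullet> i) * (?D x v \<bullet> j) * bilinear_coords M g d (?f x) i j)"
        by (intro Ck_on_sum Ck_on_mult V Df comp D.C2_G)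
    qed (simp add: pullback_bilinear_coords D.G_expand[OF range])
    show "Ck_on 2 ?V (\<lambda>x. fiber_coords M (pullback_finsler M \<phi> \<omega>) c x u)" for u
    proof (subst Ck_on_cong[OF V])
      show "Ck_on 2 ?V (\<lambda>x. \<Sum>i\<in>Basis. (?D x u \<bullet> i) * fiber_coords M \<omega> d (?f x) i)"
        by (intro Ck_on_sum Ck_on_mult V Df comp D.C2_W)
    qed (simp add: pullback_fiber_coords D.W_expand[OF range])
    fix x assume x: "x \<in> ?V"
    show "inner_form (bilinear_coords M (pullback_bilinear M \<phi> g) c x)"
    proof -
      have "linear (\<lambda>u. bilinear_coords M (pullback_bilinear M \<phi> g) c x u v)" for v
        by (intro linearI) (simp_all add: pullback_bilinear_coords[OF x] linear_add[OF lin[OF x]]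
            linear_cmul[OF lin[OF x]] D.G_simps[OF range[OF x]])
      then show ?thesis unfolding inner_form_def
        using D.G_sym[OF range[OF x]] form_pos[OF D.inner_G[OF range[OF x]]] Dloc_nonzero_coords[OF x]
        by (simp add: pullback_bilinear_coords[OF x])
    qed
    show "linear (fiber_coords M (pullback_finsler M \<phi> \<omega>) c x)"
      by (intro linearI) (simp_all add: pullback_fiber_coords[OF x] linear_add[OF lin[OF x]]
          linear_cmul[OF lin[OF x]] linear_add[OF D.linear_W[OF range[OF x]]] linear_cmul[OF D.linear_W[OF range[OF x]]])
  qed
qed

text \<open>The exterior derivative is natural: the second derivatives of the coordinate expression
  of \<open>\<phi>\<close> are symmetric and cancel.\<close>

lemma ext_deriv_pullback:
  assumes g: "riemannian_metric M g" and \<omega>: "one_form M \<omega>" and x: "x \<in> loc_dom \<phi> c d"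
  shows "ext_deriv_coords M (pullback_finsler M \<phi> \<omega>) c x u v =
         ext_deriv_coords M \<omega> d (loc \<phi> c d x) (Dloc \<phi> c d x u) (Dloc \<phi> c d x v)"
proof -
  interpret D: randers_data "snd d ` fst d" "bilinear_coords M g d" "fiber_coords M \<omega> d"
    by (rule randers_data_chart[OF g \<omega> d])
  interpret P: randers_data "loc_dom \<phi> c d" "bilinear_coords M (pullback_bilinear M \<phi> g) c"
    "fiber_coords M (pullback_finsler M \<phi> \<omega>) c"
    by (rule randers_data_pullback[OF g \<omega>])
  let ?V = "loc_dom \<phi> c d" and ?f = "loc \<phi> c d" and ?D = "Dloc \<phi> c d"
  note V = open_loc_dom[OF diffeo_smooth c d]
  have C2: "Ck_on 2 ?V ?f" by (rule Ck_on_loc[OF diffeo_smooth c d])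
  define E where "E = (\<lambda>u v. frechet_derivative (\<lambda>y. ?D y v) (at x) u)"
  have DW: "P.DW x u v = D.DW (?f x) (?D x u) (?D x v) + fiber_coords M \<omega> d (?f x) (E u v)" for u v
  proof -
    define S where "S = {t :: real. x + t *\<^sub>R u \<in> ?V}"
    have "open ((\<lambda>t :: real. x + t *\<^sub>R u) -` ?V)"
      by (intro open_vimage V continuous_intros)
    then have "open S" by (simp add: S_def vimage_def)
    moreover have S0: "0 \<in> S" using x by (simp add: S_def)
    ultimately have S: "at 0 within S = at (0::real)" by (intro at_within_open)
    have line': "((\<lambda>t. x + t *\<^sub>R u) has_vector_derivative u) (at 0 within S)"
      by (auto intro!: derivative_eq_intros)
    have along: "((\<lambda>t. h (x + t *\<^sub>R u)) has_vector_derivative h' u) (at 0 within S)"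
      if "(h has_derivative h') (at x)" for h :: "'e \<Rightarrow> 'e" and h'
      by (rule has_vector_derivative_along_curve[OF open_UNIV _ S0 line']) (use that in auto)
    have "Ck_on 1 ?V (\<lambda>y. ?D y v)" by (rule Ck_on_2D(2)[OF C2])
    then have dD: "((\<lambda>y. ?D y v) has_derivative (\<lambda>u. E u v)) (at x)"
      using Ck_on_has_derivative[of 0 ?V "\<lambda>y. ?D y v" x] x unfolding E_def by simp
    have 1: "((\<lambda>t. fiber_coords M (pullback_finsler M \<phi> \<omega>) c (x + t *\<^sub>R u) v) has_real_derivative
        P.DW x u v) (at 0 within S)"
      using P.has_derivative_W_along[of S "\<lambda>t. x + t *\<^sub>R u" 0 u "\<lambda>t. v" 0 "\<lambda>t. v" 0] S0 line'
      by (simp add: S_def linear_0[OF P.linear_W[OF x]])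
    have 2: "((\<lambda>t. fiber_coords M \<omega> d (?f (x + t *\<^sub>R u)) (?D (x + t *\<^sub>R u) v)) has_real_derivative
        D.DW (?f x) (?D x u) (?D x v) + fiber_coords M \<omega> d (?f x) (E u v)) (at 0 within S)"
      using D.has_derivative_W_along[of S "\<lambda>t. ?f (x + t *\<^sub>R u)" 0 "?D x u" "\<lambda>t. ?D (x + t *\<^sub>R u) v" "E u v"
          "\<lambda>t. 0" 0] S0 along[OF has_derivative_loc[OF diffeo_smooth c d x]] along[OF dD]
        loc_in_range[OF diffeo_smooth c d] by (simp add: S_def)
    have "((\<lambda>t. fiber_coords M (pullback_finsler M \<phi> \<omega>) c (x + t *\<^sub>R u) v) has_real_derivative
        D.DW (?f x) (?D x u) (?D x v) + fiber_coords M \<omega> d (?f x) (E u v)) (at 0 within S)"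
      by (rule has_real_derivative_transform_on[OF S0 _ 2]) (simp add: S_def pullback_fiber_coords)
    then show ?thesis using 1 unfolding S by (rule DERIV_unique[rotated])
  qed
  have "E u v = E v u" unfolding E_def by (rule mixed_partials_commute[OF V x C2])
  then show ?thesis using DW[of u v] DW[of v u]
    by (simp add: ext_deriv_coords_def P.DW_def D.DW_def)
qed

end

end

section \<open>Geodesics in charts\<close>

context randers_data
begin

lemma linear_euler_lagrange: assumes x: "x \<in> U" shows "linear (euler_lagrange x v a)"
  by (rule linearI)
    (simp_all add: euler_lagrange_def G_simps[OF x] D_simps[OF x] dW_def algebra_simps add_divide_distrib diff_divide_distrib)

lemma continuous_on_euler_lagrange:
  assumes "\<And>t. t \<in> S \<Longrightarrow> X t \<in> U" "\<And>t. t \<in> S \<Longrightarrow> Y t \<noteq> 0"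
    and "continuous_on S X" "continuous_on S Y" "continuous_on S Z"
  shows "continuous_on S (\<lambda>t. euler_lagrange (X t) (Y t) (Z t) w)"
proof -
  have nz: "sqrt (G (X t) (Y t) (Y t)) \<noteq> 0" if "t \<in> S" for t
    using speed_pos[OF assms(1,2)[OF that]] by (simp add: speed_def)
  note c = continuous_on_const[of S w] continuous_on_const[of S "0::'e"]
  show ?thesis unfolding euler_lagrange_def speed_def dW_def
    by (intro continuous_intros
        continuous_on_G[OF assms(1,3,4,4) c(2)] continuous_on_G[OF assms(1,3,5) c(1,2)]
        continuous_on_G[OF assms(1,3,4) c(1,2)] continuous_on_G[OF assms(1,3,5,4) c(2)]
        continuous_on_DG[OF assms(1,3,4,4) c(1)] continuous_on_DG[OF assms(1,3,4) c(1) assms(4)]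
        continuous_on_DG[OF assms(1,3,4,4,4)]
        continuous_on_DW[OF assms(1,3,4) c(2) c(1)] continuous_on_DW[OF assms(1,3) c(1) c(2) assms(4)])
      (use nz in auto)
qed

end

context smooth_mfd
begin

text \<open>One chart suffices, because changes of charts are smooth.\<close>

lemma Ck_into_coords:
  fixes X :: "'d::euclidean_space \<Rightarrow> 'e"
  assumes c: "c \<in> atlas M" and N: "open N" and X: "Ck_on k N X" and ran: "X ` N \<subseteq> snd c ` fst c"
    and S: "S \<subseteq> N" and f: "\<And>z. z \<in> S \<Longrightarrow> f z = cinv c (X z)"
  shows "Ck_into k M S f"
  unfolding Ck_into_def
proof (intro conjI ballI)
  show "f z \<in> points M" if "z \<in> S" for z
  proof -
    have "X z \<in> snd c ` fst c" using that S ran by blast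
    then show ?thesis using chart_point(2)[OF c] f[OF that] by simp
  qed
  fix z d assume z: "z \<in> S" and d: "d \<in> charts_at M (f z)"
  note da = atlas_charts_at[OF d]
  let ?N = "N \<inter> X -` loc_dom id c d"
  have iff: "y \<in> loc_dom id c d \<longleftrightarrow> y \<in> snd c ` fst c \<and> cinv c y \<in> fst d" for y
    using loc_dom_iff[OF smooth_map_id c da(1)] by simp
  have op: "open ?N"
    using continuous_on_open_vimage[OF N] Ck_on_continuous[OF X] open_loc_dom[OF smooth_map_id c da(1)]
    by (metis Int_commute)
  have "Ck_on k ?N (\<lambda>y. loc id c d (X y))"
    by (rule Ck_on_compose[OF op open_loc_dom[OF smooth_map_id c da(1)] _ Ck_on_loc[OF smooth_map_id c da(1)]])
      (auto intro: Ck_on_subset[OF X])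
  moreover have "z \<in> ?N" using z S ran da f[OF z] iff by auto
  moreover have "f ` (?N \<inter> S) \<subseteq> fst d" using f iff by auto
  moreover have "\<forall>y\<in>?N \<inter> S. loc id c d (X y) = snd d (f y)" using f by (auto simp: loc_def)
  ultimately show "\<exists>N h. open N \<and> z \<in> N \<and> f ` (N \<inter> S) \<subseteq> fst d \<and> Ck_on k N h \<and> (\<forall>y\<in>N \<inter> S. h y = snd d (f y))"
    using op by blast
qed

text \<open>The chain rule for changes of charts; \<open>near\<close> keeps the curve in the domain of each chart.\<close>

lemma velocity_eq_tvec:
  assumes c: "c \<in> charts_at M (\<gamma> t)" and t: "t \<in> S" "at t within S \<noteq> bot"
    and near: "\<And>d. d \<in> charts_at M (\<gamma> t) \<Longrightarrow> \<exists>N. open N \<and> t \<in> N \<and> \<gamma> ` (N \<inter> S) \<subseteq> fst d"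
    and x: "((\<lambda>s. snd c (\<gamma> s)) has_vector_derivative x') (at t within S)"
  shows "velocity M S \<gamma> t = tvec M c (\<gamma> t) x'"
proof (rule ext)
  fix d
  show "velocity M S \<gamma> t d = tvec M c (\<gamma> t) x' d"
  proof (cases "d \<in> charts_at M (\<gamma> t)")
    case True
    note ca = atlas_charts_at[OF c] and da = atlas_charts_at[OF True]
    obtain N1 N2 where N: "open N1" "t \<in> N1" "\<gamma> ` (N1 \<inter> S) \<subseteq> fst d" "open N2" "t \<in> N2" "\<gamma> ` (N2 \<inter> S) \<subseteq> fst c"
      using near[OF True] near[OF c] by blast
    have D: "(loc id c d has_derivative Dloc id c d (snd c (\<gamma> t))) (at (snd c (\<gamma> t)))"
      by (rule has_derivative_loc[OF smooth_map_id ca(1) da(1)]) (use ca da in \<open>auto simp: loc_dom_def\<close>)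
    have d1: "((\<lambda>s. loc id c d (snd c (\<gamma> s))) has_vector_derivative Dloc id c d (snd c (\<gamma> t)) x') (at t within S)"
      by (rule has_vector_derivative_along_curve[OF open_UNIV _ t(1) x D]) auto
    have "((\<lambda>s. snd d (\<gamma> s)) has_vector_derivative Dloc id c d (snd c (\<gamma> t)) x') (at t within S)"
    proof (rule has_vector_derivative_cong_near[OF open_Int[OF N(1,4)] _ t(1) _ d1])
      fix s assume "s \<in> N1 \<inter> N2" "s \<in> S"
      then have "\<gamma> s \<in> fst c" using N by blast
      then show "loc id c d (snd c (\<gamma> s)) = snd d (\<gamma> s)" using ca by (simp add: loc_def)
    qed (use N in auto)
    then have "vector_derivative (snd d \<circ> \<gamma>) (at t within S) = Dloc id c d (snd c (\<gamma> t)) x'"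
      by (intro vector_derivative_within[OF t(2)]) (simp add: o_def)
    then show ?thesis using True by (simp add: velocity_def tvec_eq)
  qed (simp add: velocity_def tvec_def)
qed

text \<open>Below, \<open>F\<close> is the given Randers metric or its pullback; the latter has Randers data on a part \<open>V\<close>
  of the chart.\<close>

context
  fixes c V G W F
  assumes c: "c \<in> atlas M" and V: "V \<subseteq> snd c ` fst c"
    and R: "randers_data V G W"
    and F: "\<And>x u. x \<in> V \<Longrightarrow> fiber_coords M F c x u = randers_data.lagr G W x u"
begin

interpretation R: randers_data V G W by (rule R)

text \<open>
  For small parameters the varied curves stay in \<open>V\<close> and are regular. There their lengths are
  integrals of \<open>lagr\<close>, and the first variation formula for coordinates applies. The variation field \<open>\<eta>\<close> is the
  coordinate derivative of \<open>H\<close> at parameter 0.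
\<close>

lemma first_variation_in_chart:
  assumes ab: "a < b" and x: "\<And>t. t \<in> {a..b} \<Longrightarrow> x t \<in> V"
    and dx: "\<And>t. t \<in> {a..b} \<Longrightarrow> (x has_vector_derivative y t) (at t within {a..b})"
    and dy: "\<And>t. t \<in> {a..b} \<Longrightarrow> (y has_vector_derivative z t) (at t within {a..b})"
    and y: "\<And>t. t \<in> {a..b} \<Longrightarrow> y t \<noteq> 0"
    and \<gamma>: "\<And>t. t \<in> {a..b} \<Longrightarrow> \<gamma> t = cinv c (x t)"
    and \<epsilon>: "\<epsilon> > 0" and H: "fixed_end_variation M a b \<gamma> \<epsilon> H"
  obtains \<eta> where "\<And>t. t \<in> {a..b} \<Longrightarrow> ((\<lambda>s. snd c (H s t)) has_vector_derivative \<eta> t) (at 0)"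
    and "((\<lambda>s. forward_length M F a b (H s)) has_real_derivative
           integral {a..b} (\<lambda>t. R.euler_lagrange (x t) (y t) (z t) (\<eta> t))) (at 0)"
proof -
  let ?R\<epsilon> = "{-\<epsilon><..<\<epsilon>} \<times> {a..b}"
  have vertical: "((\<lambda>t. (s, t)) has_vector_derivative (0, 1)) (at t within T)" for s t :: real and T
    by (auto intro!: derivative_eq_intros simp: has_vector_derivative_def)
  define h where "h = (\<lambda>w. H (fst w) (snd w))"
  have "h = (\<lambda>(s, t). H s t)" by (simp add: h_def fun_eq_iff)
  then have Hh: "Ck_into 2 M ?R\<epsilon> h" and H0: "\<And>t. t \<in> {a..b} \<Longrightarrow> H 0 t = \<gamma> t"
    and Hab: "\<And>s. s \<in> {-\<epsilon><..<\<epsilon>} \<Longrightarrow> H s a = \<gamma> a \<and> H s b = \<gamma> b"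
    using H unfolding fixed_end_variation_def by auto
  have ext: "\<exists>N k. open N \<and> w \<in> N \<and> h ` (N \<inter> ?R\<epsilon>) \<subseteq> fst d \<and> Ck_on 2 N k \<and> (\<forall>v\<in>N \<inter> ?R\<epsilon>. k v = snd d (h v))"
    if "w \<in> ?R\<epsilon>" "d \<in> charts_at M (h w)" for w d
    using Hh that unfolding Ck_into_def by blast
  have nb_t: "at t within {a..b} \<noteq> bot" if "t \<in> {a..b}" for t
    using ab that by (simp add: trivial_limit_within islimpt_Icc)
  have \<gamma>c: "\<gamma> t \<in> fst c" "snd c (\<gamma> t) = x t" if "t \<in> {a..b}" for t
    using \<gamma>[OF that] x[OF that] V c by auto
  \<comment> \<open>local \<open>C\<^sup>2\<close> extensions of the coordinate expression of \<open>H\<close>, shrunk so that they have values in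
    \<open>V\<close> and a nonzero derivative in \<open>t\<close>\<close>
  define good where "good = (\<lambda>N k. open N \<and> Ck_on 2 N k \<and> h ` (N \<inter> ?R\<epsilon>) \<subseteq> fst c \<and>
      (\<forall>v\<in>N \<inter> ?R\<epsilon>. k v = snd c (h v)) \<and> (\<forall>v\<in>N. k v \<in> V \<and> frechet_derivative k (at v) (0, 1) \<noteq> 0))"
  have good: "\<exists>N k. (0, t) \<in> N \<and> good N k" if t: "t \<in> {a..b}" for t
  proof -
    have w: "(0, t) \<in> ?R\<epsilon>" using t \<epsilon> by simp
    have "c \<in> charts_at M (h (0, t))" using t c \<gamma>c H0 by (auto simp: h_def intro: charts_atI)
    from ext[OF w this] obtain N k where N: "open N" "(0, t) \<in> N" "h ` (N \<inter> ?R\<epsilon>) \<subseteq> fst c" "Ck_on 2 N k"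
      "\<And>v. v \<in> N \<inter> ?R\<epsilon> \<Longrightarrow> k v = snd c (h v)" by blast
    let ?D = "\<lambda>v. frechet_derivative k (at v) (0, 1)"
    let ?N = "(N \<inter> k -` V) \<inter> (N \<inter> ?D -` (- {0}))"
    have "open (N \<inter> k -` V)" "open (N \<inter> ?D -` (- {0}))"
      using continuous_on_open_vimage[OF N(1)] Ck_on_continuous[OF N(4)] R.open_U
        Ck_on_continuous[OF Ck_on_2D(2)[OF N(4)]] open_Compl[OF closed_singleton] by (metis Int_commute)+
    then have op: "open ?N" by (rule open_Int)
    have "(x has_vector_derivative ?D (0, t)) (at t within {a..b})"
    proof (rule has_vector_derivative_along_curve[OF N(1,2) t vertical Ck_on_2D(1)[OF N(4,2)]])
      fix r assume r: "r \<in> {a..b}" "(0, r) \<in> N"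
      then show "x r = k (0, r)" using N(5)[of "(0, r)"] \<epsilon> \<gamma>c(2)[OF r(1)] H0[OF r(1)] by (simp add: h_def)
    qed
    then have "?D (0, t) = y t" using vector_derivative_unique_within[OF nb_t[OF t]] dx[OF t] by blast
    moreover have "k (0, t) = x t" using N(5)[of "(0, t)"] N(2) w \<gamma>c(2)[OF t] H0[OF t] by (simp add: h_def)
    ultimately have mem: "(0, t) \<in> ?N" using N(2) y[OF t] x[OF t] by simp
    have "Ck_on 2 ?N k" by (rule Ck_on_subset[OF N(4)]) auto
    moreover have "h ` (?N \<inter> ?R\<epsilon>) \<subseteq> fst c" using N(3) by blast
    moreover have "\<forall>v\<in>?N \<inter> ?R\<epsilon>. k v = snd c (h v)" using N(5) by blast
    moreover have "\<forall>v\<in>?N. k v \<in> V \<and> ?D v \<noteq> 0" by simp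
    ultimately have "good ?N k" unfolding good_def by (intro conjI op)
    with mem show ?thesis by (intro exI conjI)
  qed
  \<comment> \<open>by compactness of the interval the variation stays in the chart for small parameters\<close>
  define T where "T = \<Union>{N. \<exists>k. good N k}"
  have "open T" unfolding T_def good_def by blast
  moreover have "compact ({0::real} \<times> {a..b})" by (intro compact_Times) auto
  moreover have "{0} \<times> {a..b} \<subseteq> T" using good unfolding T_def by blast
  ultimately obtain e0 where e0: "e0 > 0" "{w. infdist w ({0} \<times> {a..b}) \<le> e0} \<subseteq> T"
    using compact_in_open_separated[of "{0} \<times> {a..b}" T] ab by auto
  define e where "e = min e0 \<epsilon>"
  have e: "e > 0" "e \<le> \<epsilon>" using e0 \<epsilon> by (auto simp: e_def)
  let ?R = "{-e<..<e} \<times> {a..b}"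
  have sub: "?R \<subseteq> ?R\<epsilon>" using e by auto
  have inT: "w \<in> T" if w: "w \<in> ?R" for w
  proof -
    obtain s t where st: "w = (s, t)" "\<bar>s\<bar> < e" "t \<in> {a..b}" using w by (cases w) auto
    have "infdist w ({0} \<times> {a..b}) \<le> dist w (0, t)" using st by (intro infdist_le) auto
    also have "dist w (0, t) = \<bar>s\<bar>" by (simp add: st(1) dist_Pair_Pair dist_real_def)
    finally show ?thesis using e0(2) st(2) by (auto simp: e_def)
  qed
  have loc: "\<exists>N k. w \<in> N \<and> good N k" if "w \<in> ?R" for w using inT[OF that] unfolding T_def by blast
  define X where "X = (\<lambda>w. snd c (h w))"
  have cover: "\<exists>N k. open N \<and> w \<in> N \<and> Ck_on 2 N k \<and> (\<forall>v\<in>N \<inter> ?R. k v = X v)" if w: "w \<in> ?R" for w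
  proof -
    obtain N k where N: "w \<in> N" "good N k" using loc[OF w] by blast
    have "open N" "Ck_on 2 N k" "\<And>v. v \<in> N \<inter> ?R\<epsilon> \<Longrightarrow> k v = X v"
      using N(2) unfolding good_def X_def by simp_all
    moreover have "v \<in> N \<inter> ?R\<epsilon>" if "v \<in> N \<inter> ?R" for v using that sub by blast
    ultimately show ?thesis using N(1) by blast
  qed
  obtain Xs Xt Xst where P:
    "\<And>s t. s \<in> {-e<..<e} \<Longrightarrow> t \<in> {a..b} \<Longrightarrow> ((\<lambda>t. X (s, t)) has_vector_derivative Xt s t) (at t within {a..b})"
    "\<And>s t. s \<in> {-e<..<e} \<Longrightarrow> t \<in> {a..b} \<Longrightarrow> ((\<lambda>s. X (s, t)) has_vector_derivative Xs s t) (at s within {-e<..<e})"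
    "\<And>s t. s \<in> {-e<..<e} \<Longrightarrow> t \<in> {a..b} \<Longrightarrow> ((\<lambda>s. Xt s t) has_vector_derivative Xst s t) (at s within {-e<..<e})"
    "\<And>s t. s \<in> {-e<..<e} \<Longrightarrow> t \<in> {a..b} \<Longrightarrow> ((\<lambda>t. Xs s t) has_vector_derivative Xst s t) (at t within {a..b})"
    "continuous_on ?R X" "continuous_on ?R (\<lambda>z. Xt (fst z) (snd z))"
    "continuous_on ?R (\<lambda>z. Xs (fst z) (snd z))" "continuous_on ?R (\<lambda>z. Xst (fst z) (snd z))"
    by (rule C2_strip_partials[OF ab cover]) (assumption, rule that)
  have inV: "X (s, t) \<in> V" and Xt0: "Xt s t \<noteq> 0" and inc: "H s t \<in> fst c" if st: "s \<in> {-e<..<e}" "t \<in> {a..b}" for s t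
  proof -
    have w: "(s, t) \<in> ?R" using st by simp
    obtain N k where N: "(s, t) \<in> N" "good N k" using loc[OF w] by blast
    have g: "open N" "Ck_on 2 N k" "h ` (N \<inter> ?R\<epsilon>) \<subseteq> fst c" "\<And>v. v \<in> N \<inter> ?R\<epsilon> \<Longrightarrow> k v = X v"
      "\<And>v. v \<in> N \<Longrightarrow> k v \<in> V" "\<And>v. v \<in> N \<Longrightarrow> frechet_derivative k (at v) (0, 1) \<noteq> 0"
      using N(2) unfolding good_def X_def by simp_all
    have k: "k v = X v" if "v \<in> N \<inter> ?R" for v using g(4) that sub by blast
    show "X (s, t) \<in> V" using k[of "(s, t)"] g(5)[OF N(1)] N(1) w by simp
    have "h (s, t) \<in> fst c" using g(3) N(1) w sub by blast
    then show "H s t \<in> fst c" by (simp add: h_def)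
    have kd: "(k has_derivative frechet_derivative k (at (s, t))) (at (s, t))"
      by (rule Ck_on_2D(1)[OF g(2) N(1)])
    from g(1) have "((\<lambda>t. X (s, t)) has_vector_derivative frechet_derivative k (at (s, t)) (0, 1)) (at t within {a..b})"
      by (rule has_vector_derivative_along_curve[OF _ N(1) st(2) vertical kd]) (use k st in auto)
    then have "Xt s t = frechet_derivative k (at (s, t)) (0, 1)"
      using vector_derivative_unique_within[OF nb_t[OF st(2)]] P(1)[OF st] by blast
    then show "Xt s t \<noteq> 0" using g(6)[OF N(1)] by simp
  qed
  have len: "forward_length M F a b (H s) = integral {a..b} (\<lambda>t. R.lagr (X (s, t)) (Xt s t))"
    if s: "s \<in> {-e<..<e}" for s
    unfolding forward_length_def
  proof (rule integral_cong)
    fix t assume t: "t \<in> {a..b}"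
    have cH: "c \<in> charts_at M (H s t)" using inc[OF s t] c by (rule charts_atI[rotated])
    have "velocity M {a..b} (H s) t = tvec M c (H s t) (Xt s t)"
    proof (rule velocity_eq_tvec[where \<gamma>="H s", OF cH t nb_t[OF t]])
      show "((\<lambda>t. snd c (H s t)) has_vector_derivative Xt s t) (at t within {a..b})"
        using P(1)[OF s t] by (simp add: X_def h_def)
      fix d assume d: "d \<in> charts_at M (H s t)"
      have "(s, t) \<in> ?R\<epsilon>" using s t e by auto
      then obtain N where N: "open N" "(s, t) \<in> N" "h ` (N \<inter> ?R\<epsilon>) \<subseteq> fst d"
        using ext[of "(s, t)" d] d by (auto simp: h_def)
      have "open (Pair s -` N)" by (intro open_vimage N continuous_intros)
      moreover have "H s ` (Pair s -` N \<inter> {a..b}) \<subseteq> fst d"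
        using N(3) s e by (force simp: h_def image_subset_iff)
      ultimately show "\<exists>N. open N \<and> t \<in> N \<and> H s ` (N \<inter> {a..b}) \<subseteq> fst d" using N(2) by blast
    qed
    moreover have "cinv c (X (s, t)) = H s t" using inc[OF s t] c by (simp add: X_def h_def)
    ultimately show "F (H s t) (velocity M {a..b} (H s) t) = R.lagr (X (s, t)) (Xt s t)"
      using F[OF inV[OF s t], of "Xt s t"] by (simp add: fiber_coords_def)
  qed
  have z0: "0 \<in> {-e<..<e}" using e by simp
  have X0: "X (0, t) = x t" if "t \<in> {a..b}" for t using \<gamma>c[OF that] H0[OF that] by (simp add: X_def h_def)
  have Xt_y: "Xt 0 t = y t" if t: "t \<in> {a..b}" for t
  proof -
    have "((\<lambda>t. X (0, t)) has_vector_derivative y t) (at t within {a..b})"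
      by (rule has_vector_derivative_transform[OF t X0 dx[OF t]])
    then show ?thesis using vector_derivative_unique_within[OF nb_t[OF t]] P(1)[OF z0 t] by blast
  qed
  have Z: "((\<lambda>t. Xt 0 t) has_vector_derivative z t) (at t within {a..b})" if t: "t \<in> {a..b}" for t
    by (rule has_vector_derivative_transform[OF t Xt_y dy[OF t]])
  have at0: "at 0 within {-e<..<e} = at 0" by (rule at_within_open[OF z0 open_greaterThanLessThan])
  have fixed: "Xs 0 t = 0" if t: "t = a \<or> t = b" for t
  proof -
    have tab: "t \<in> {a..b}" using t ab by auto
    have "((\<lambda>s. X (s, t)) has_vector_derivative 0) (at 0 within {-e<..<e})"
    proof (rule has_vector_derivative_transform[OF z0])
      show "X (s, t) = X (0, t)" if "s \<in> {-e<..<e}" for s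
      proof -
        have "s \<in> {-\<epsilon><..<\<epsilon>}" "0 \<in> {-\<epsilon><..<\<epsilon>}" using that e by auto
        then show ?thesis using Hab t by (auto simp: X_def h_def)
      qed
    qed simp
    then show ?thesis using vector_derivative_unique_within[of 0 "{-e<..<e}"] P(2)[OF z0 tab] at0 by simp
  qed
  have "((\<lambda>s. integral {a..b} (\<lambda>t. R.lagr (X (s, t)) (Xt s t))) has_real_derivative
          integral {a..b} (\<lambda>t. R.euler_lagrange (X (0, t)) (Xt 0 t) (z t) (Xs 0 t))) (at 0)"
    by (rule R.first_variation[where X="\<lambda>s t. X (s, t)" and Xst=Xst, OF e(1) ab inV Xt0 P(1)[OF z0] P(2) P(3) P(4)[OF z0] Z])
      (use P(5-8) fixed in auto)
  also have "integral {a..b} (\<lambda>t. R.euler_lagrange (X (0, t)) (Xt 0 t) (z t) (Xs 0 t)) =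
      integral {a..b} (\<lambda>t. R.euler_lagrange (x t) (y t) (z t) (Xs 0 t))"
    by (rule integral_cong) (simp add: X0 Xt_y)
  finally have d: "((\<lambda>s. integral {a..b} (\<lambda>t. R.lagr (X (s, t)) (Xt s t))) has_real_derivative
      integral {a..b} (\<lambda>t. R.euler_lagrange (x t) (y t) (z t) (Xs 0 t))) (at 0)" .
  show thesis
  proof (rule that[of "Xs 0"])
    show "((\<lambda>s. snd c (H s t)) has_vector_derivative Xs 0 t) (at 0)" if "t \<in> {a..b}" for t
      using P(2)[OF z0 that] unfolding at0 by (simp add: X_def h_def)
    show "((\<lambda>s. forward_length M F a b (H s)) has_real_derivative
           integral {a..b} (\<lambda>t. R.euler_lagrange (x t) (y t) (z t) (Xs 0 t))) (at 0)"
      by (rule has_field_derivative_transform_within_open[OF d open_greaterThanLessThan z0]) (simp add: len)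
  qed
qed

lemma extremal_of_euler_lagrange:
  assumes ab: "a \<le> b" and x: "\<And>t. t \<in> {a..b} \<Longrightarrow> x t \<in> V"
    and dx: "\<And>t. t \<in> {a..b} \<Longrightarrow> (x has_vector_derivative y t) (at t within {a..b})"
    and dy: "\<And>t. t \<in> {a..b} \<Longrightarrow> (y has_vector_derivative z t) (at t within {a..b})"
    and y: "\<And>t. t \<in> {a..b} \<Longrightarrow> y t \<noteq> 0"
    and \<gamma>: "\<And>t. t \<in> {a..b} \<Longrightarrow> \<gamma> t = cinv c (x t)"
    and el: "\<And>t w. t \<in> {a..b} \<Longrightarrow> R.euler_lagrange (x t) (y t) (z t) w = 0"
  shows "extremal M F a b \<gamma>"
  unfolding extremal_def
proof (intro allI impI)
  fix \<epsilon> :: real and H assume \<epsilon>: "\<epsilon> > 0" and H: "fixed_end_variation M a b \<gamma> \<epsilon> H"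
  show "((\<lambda>s. forward_length M F a b (H s)) has_real_derivative 0) (at 0)"
  proof (cases "a = b")
    case True then show ?thesis by (simp add: forward_length_def)
  next
    case False
    then have "a < b" using ab by simp
    from first_variation_in_chart[OF this x dx dy y \<gamma> \<epsilon> H] obtain \<eta> where
      "((\<lambda>s. forward_length M F a b (H s)) has_real_derivative
           integral {a..b} (\<lambda>t. R.euler_lagrange (x t) (y t) (z t) (\<eta> t))) (at 0)" by blast
    moreover have "integral {a..b} (\<lambda>t. R.euler_lagrange (x t) (y t) (z t) (\<eta> t)) = integral {a..b} (\<lambda>t. 0)"
      by (rule integral_cong) (rule el)
    ultimately show ?thesis by simp
  qed
qed

text \<open>The variations \<open>x t + s (t - a) (b - t) w\<close> on short intervals detect every component of the
  Euler-Lagrange expression.\<close>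

lemma euler_lagrange_of_extremal:
  assumes I: "open I" and x: "\<And>t. t \<in> I \<Longrightarrow> x t \<in> V"
    and dx: "\<And>t. t \<in> I \<Longrightarrow> (x has_vector_derivative y t) (at t)"
    and dy: "\<And>t. t \<in> I \<Longrightarrow> (y has_vector_derivative z t) (at t)"
    and C2: "Ck_on 2 I x" and z: "continuous_on I z"
    and y: "\<And>t. t \<in> I \<Longrightarrow> y t \<noteq> 0"
    and \<gamma>: "\<And>t. t \<in> I \<Longrightarrow> \<gamma> t = cinv c (x t)"
    and t0: "t0 \<in> I" and \<delta>: "\<delta> > 0"
    and ex: "\<And>a b. a \<in> I \<Longrightarrow> b \<in> I \<Longrightarrow> a \<le> b \<Longrightarrow> \<bar>a - t0\<bar> < \<delta> \<Longrightarrow> \<bar>b - t0\<bar> < \<delta> \<Longrightarrow> extremal M F a b \<gamma>"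
  shows "R.euler_lagrange (x t0) (y t0) (z t0) w = 0"
proof (rule ccontr)
  define E where "E = (\<lambda>t. R.euler_lagrange (x t) (y t) (z t) w)"
  assume "R.euler_lagrange (x t0) (y t0) (z t0) w \<noteq> 0"
  then have E0: "E t0 * E t0 > 0" by (simp add: E_def flip: power2_eq_square)
  have cx: "continuous_on I x" and cy: "continuous_on I y"
    using dx dy by (auto intro!: continuous_on_vector_derivative intro: has_vector_derivative_at_within)
  have cE: "continuous_on I E"
    unfolding E_def by (rule R.continuous_on_euler_lagrange[OF x y cx cy z])
  have "open (I \<inter> (\<lambda>t. E t0 * E t) -` {0<..})"
    by (intro continuous_open_preimage continuous_on_mult_left cE I open_greaterThan)
  moreover have "t0 \<in> I \<inter> (\<lambda>t. E t0 * E t) -` {0<..}" using t0 E0 by simp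
  ultimately obtain r0 where r0: "r0 > 0" "ball t0 r0 \<subseteq> I \<inter> (\<lambda>t. E t0 * E t) -` {0<..}"
    using open_contains_ball by blast
  define r where "r = min (r0 / 2) (\<delta> / 2)"
  define a b where "a = t0 - r" and "b = t0 + r"
  have r: "r > 0" "r < r0" "r < \<delta>" using r0 \<delta> by (auto simp: r_def)
  have ab: "a < b" and t0ab: "t0 \<in> {a..b}" using r by (auto simp: a_def b_def)
  have near: "t \<in> I \<inter> (\<lambda>t. E t0 * E t) -` {0<..}" if "t \<in> {a..b}" for t
  proof -
    have "t \<in> ball t0 r0" using that r by (simp add: a_def b_def dist_real_def abs_less_iff)
    then show ?thesis using r0(2) by blast
  qed
  have abI: "t \<in> I" and Epos: "E t0 * E t > 0" if "t \<in> {a..b}" for t using near[OF that] by simp_all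
  have extremal: "extremal M F a b \<gamma>"
  proof (rule ex)
    show "a \<in> I" "b \<in> I" using abI ab by simp_all
    show "\<bar>a - t0\<bar> < \<delta>" "\<bar>b - t0\<bar> < \<delta>" using r by (simp_all add: a_def b_def)
  qed (use ab in simp)
  \<comment> \<open>the variation stays in \<open>V\<close> for small parameters\<close>
  define X where "X = (\<lambda>p. x (snd p) + (fst p * ((snd p - a) * (b - snd p))) *\<^sub>R w)"
  define N where "N = (UNIV \<times> I) \<inter> X -` V"
  have UI: "open (UNIV \<times> I :: (real \<times> real) set)" using I by (intro open_Times) auto
  have X2: "Ck_on 2 (UNIV \<times> I) X"
  proof -
    have l: "Ck_on 2 (UNIV \<times> I) (\<lambda>p :: real \<times> real. fst p)" "Ck_on 2 (UNIV \<times> I) (\<lambda>p :: real \<times> real. snd p)"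
      by (intro Ck_on_bounded_linear UI bounded_linear_fst bounded_linear_snd)+
    have m: "Ck_on 2 (UNIV \<times> I) (\<lambda>p :: real \<times> real. - snd p)"
      by (intro Ck_on_bounded_linear UI bounded_linear_minus bounded_linear_snd)
    have "Ck_on 2 (UNIV \<times> I) (\<lambda>p :: real \<times> real. x (snd p))"
      by (rule Ck_on_compose[OF UI I _ C2 l(2)]) auto
    moreover have "Ck_on 2 (UNIV \<times> I) (\<lambda>p :: real \<times> real. (fst p * ((snd p + (- a)) * (b + (- snd p)))) *\<^sub>R w)"
      by (intro Ck_on_scaleR Ck_on_mult Ck_on_add Ck_on_const UI l m)
    ultimately show ?thesis unfolding X_def using Ck_on_add[OF UI] by fastforce
  qed
  have N: "open N" unfolding N_def
    by (intro continuous_open_preimage Ck_on_continuous[OF X2] UI R.open_U)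
  have "{0} \<times> {a..b} \<subseteq> N" using abI x by (auto simp: N_def X_def)
  moreover have "compact ({0::real} \<times> {a..b})" by (intro compact_Times) auto
  ultimately obtain \<epsilon> where \<epsilon>: "\<epsilon> > 0" "{p. infdist p ({0} \<times> {a..b}) \<le> \<epsilon>} \<subseteq> N"
    using compact_in_open_separated[of "{0} \<times> {a..b}" N] N ab by auto
  have sub: "{-\<epsilon><..<\<epsilon>} \<times> {a..b} \<subseteq> N"
  proof
    fix p assume p: "p \<in> {-\<epsilon><..<\<epsilon>} \<times> {a..b}"
    then obtain s t where st: "p = (s, t)" "\<bar>s\<bar> < \<epsilon>" "t \<in> {a..b}" by (cases p) auto
    have "infdist p ({0} \<times> {a..b}) \<le> dist p (0, t)" using st by (intro infdist_le) auto
    also have "dist p (0, t) = \<bar>s\<bar>" by (simp add: st(1) dist_Pair_Pair dist_real_def)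
    finally show "p \<in> N" using \<epsilon>(2) st(2) by auto
  qed
  define H where "H = (\<lambda>s t. cinv c (X (s, t)))"
  have H: "fixed_end_variation M a b \<gamma> \<epsilon> H"
    unfolding fixed_end_variation_def
  proof (intro conjI ballI)
    show "Ck_into 2 M ({-\<epsilon><..<\<epsilon>} \<times> {a..b}) (\<lambda>(s, t). H s t)"
    proof (rule Ck_into_coords[OF c N _ _ sub])
      show "Ck_on 2 N X" by (rule Ck_on_subset[OF X2]) (auto simp: N_def)
      show "X ` N \<subseteq> snd c ` fst c" using V by (auto simp: N_def)
    qed (auto simp: H_def)
  qed (use \<gamma> abI ab in \<open>auto simp: H_def X_def\<close>)
  have wd: "(x has_vector_derivative y t) (at t within {a..b})" "(y has_vector_derivative z t) (at t within {a..b})"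
    if "t \<in> {a..b}" for t using dx dy abI[OF that] by (auto intro: has_vector_derivative_at_within)
  obtain \<eta> where \<eta>: "\<And>t. t \<in> {a..b} \<Longrightarrow> ((\<lambda>s. snd c (H s t)) has_vector_derivative \<eta> t) (at 0)"
    and d: "((\<lambda>s. forward_length M F a b (H s)) has_real_derivative
           integral {a..b} (\<lambda>t. R.euler_lagrange (x t) (y t) (z t) (\<eta> t))) (at 0)"
    by (rule first_variation_in_chart[OF ab x[OF abI] wd y[OF abI] \<gamma>[OF abI] \<epsilon>(1) H]) (assumption+, rule that)
  have \<eta>w: "\<eta> t = ((t - a) * (b - t)) *\<^sub>R w" if t: "t \<in> {a..b}" for t
  proof -
    have "((\<lambda>s. X (s, t)) has_vector_derivative ((t - a) * (b - t)) *\<^sub>R w) (at 0)"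
      unfolding X_def by (auto intro!: derivative_eq_intros)
    then have "((\<lambda>s. snd c (H s t)) has_vector_derivative ((t - a) * (b - t)) *\<^sub>R w) (at 0)"
    proof (rule has_vector_derivative_cong_near[of "{-\<epsilon><..<\<epsilon>}", rotated 4])
      fix s assume s: "s \<in> {-\<epsilon><..<\<epsilon>}"
      then have "(s, t) \<in> N" using sub t by blast
      then have "X (s, t) \<in> snd c ` fst c" using V by (auto simp: N_def)
      then show "X (s, t) = snd c (H s t)" using c by (simp add: H_def)
    qed (use \<epsilon> in auto)
    then show ?thesis using \<eta>[OF t] vector_derivative_unique_at by blast
  qed
  have "integral {a..b} (\<lambda>t. R.euler_lagrange (x t) (y t) (z t) (\<eta> t)) = 0"
    using extremal \<epsilon>(1) H d DERIV_unique unfolding extremal_def by blast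
  moreover have "integral {a..b} (\<lambda>t. R.euler_lagrange (x t) (y t) (z t) (\<eta> t)) =
      integral {a..b} (\<lambda>t. ((t - a) * (b - t)) * E t)"
    by (rule integral_cong)
      (simp add: \<eta>w E_def linear_cmul[OF R.linear_euler_lagrange[OF x[OF abI]]])
  ultimately have "E t0 * integral {a..b} (\<lambda>t. ((t - a) * (b - t)) * E t) = 0" by simp
  then have i: "integral {a..b} (\<lambda>t. E t0 * (((t - a) * (b - t)) * E t)) = 0" by simp
  have "continuous_on {a..b} (\<lambda>t. E t0 * (((t - a) * (b - t)) * E t))"
    by (intro continuous_intros continuous_on_subset[OF cE]) (use abI in blast)
  moreover have "E t0 * (((t - a) * (b - t)) * E t) \<ge> 0" if "t \<in> {a..b}" for t
  proof -
    have "((t - a) * (b - t)) * (E t0 * E t) \<ge> 0"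
      by (rule mult_nonneg_nonneg) (use less_imp_le[OF Epos[OF that]] that in auto)
    then show ?thesis by (simp only: mult.assoc mult.left_commute)
  qed
  ultimately have "E t0 * (((t0 - a) * (b - t0)) * E t0) = 0"
    using integral_eq_0_iff[OF _ ab] i t0ab by blast
  then show False using E0 r by (simp add: a_def b_def)
qed

lemma forward_geodesic_of_euler_lagrange:
  assumes I: "open I" "is_interval I" "p \<in> I" "q \<in> I" "p < q" and x: "\<And>t. t \<in> I \<Longrightarrow> x t \<in> V"
    and dx: "\<And>t. t \<in> I \<Longrightarrow> (x has_vector_derivative y t) (at t)"
    and dy: "\<And>t. t \<in> I \<Longrightarrow> (y has_vector_derivative z t) (at t)"
    and C2: "Ck_on 2 I x" and y: "\<And>t. t \<in> I \<Longrightarrow> y t \<noteq> 0"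
    and \<gamma>: "\<And>t. t \<in> I \<Longrightarrow> \<gamma> t = cinv c (x t)"
    and el: "\<And>t w. t \<in> I \<Longrightarrow> R.euler_lagrange (x t) (y t) (z t) w = 0"
  shows "forward_geodesic M F I \<gamma>"
  unfolding forward_geodesic_def
proof (intro conjI)
  have xc: "x t \<in> snd c ` fst c" if "t \<in> I" for t using x[OF that] V by blast
  have Ck: "Ck_into 2 M I \<gamma>"
    by (rule Ck_into_coords[OF c I(1) C2 _ order_refl \<gamma>]) (use xc in auto)
  have "velocity M I \<gamma> t \<noteq> tzero" if t: "t \<in> I" for t
  proof -
    have \<gamma>c: "\<gamma> t \<in> fst c" "snd c (\<gamma> t) = x t" if "t \<in> I" for t
      using \<gamma>[OF that] xc[OF that] c by auto
    have at: "at t within I = at t" by (rule at_within_open[OF t I(1)])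
    have cc: "c \<in> charts_at M (\<gamma> t)" by (rule charts_atI[OF c \<gamma>c(1)[OF t]])
    have "velocity M I \<gamma> t = tvec M c (\<gamma> t) (y t)"
    proof (rule velocity_eq_tvec[where \<gamma>=\<gamma>, OF cc t])
      show "at t within I \<noteq> bot" by (simp add: at)
      show "\<exists>N. open N \<and> t \<in> N \<and> \<gamma> ` (N \<inter> I) \<subseteq> fst d" if "d \<in> charts_at M (\<gamma> t)" for d
        using Ck t that unfolding Ck_into_def by blast
      show "((\<lambda>s. snd c (\<gamma> s)) has_vector_derivative y t) (at t within I)"
        by (rule has_vector_derivative_transform[OF t \<gamma>c(2)]) (simp_all add: at dx t)
    qed
    then show ?thesis using tvec_nonzero[OF cc y[OF t]] by simp
  qed
  with Ck show "regular_curve M I \<gamma>" unfolding regular_curve_def by blast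
  have ext: "extremal M F a b \<gamma>" if "a \<in> I" "b \<in> I" "a \<le> b" for a b
  proof -
    have sub: "t \<in> I" if "t \<in> {a..b}" for t
      using I(2) \<open>a \<in> I\<close> \<open>b \<in> I\<close> that unfolding is_interval_1 atLeastAtMost_iff by blast
    show ?thesis
      by (rule extremal_of_euler_lagrange[OF that(3), where x=x and y=y and z=z])
        (simp_all add: sub x y \<gamma> el has_vector_derivative_at_within[OF dx] has_vector_derivative_at_within[OF dy])
  qed
  show "\<forall>t\<in>I. \<exists>\<delta>>0. \<forall>a\<in>I. \<forall>b\<in>I. a \<le> b \<and> \<bar>a - t\<bar> < \<delta> \<and> \<bar>b - t\<bar> < \<delta> \<longrightarrow> extremal M F a b \<gamma>"
    using ext by (intro ballI exI[of _ 1]) auto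
qed (use I in auto)

end

end

section \<open>Projective transformations of a Randers metric\<close>

lemma randers_data_subset:
  assumes "randers_data U G W" "open V" "V \<subseteq> U" shows "randers_data V G W"
proof -
  interpret randers_data U G W by fact
  show ?thesis
    by (rule randers_data.intro[OF assms(2)])
      (use assms(3) inner_G linear_W Ck_on_subset[OF C2_G assms(3)] Ck_on_subset[OF C2_W assms(3)] in blast)+
qed

lemma Ck_on_2_curve:
  fixes X :: "real \<Rightarrow> 'b::real_normed_vector"
  assumes I: "open I" and X: "\<And>t. t \<in> I \<Longrightarrow> (X has_vector_derivative Y t) (at t)"
    and Y: "\<And>t. t \<in> I \<Longrightarrow> (Y has_vector_derivative Z t) (at t)" and Z: "continuous_on I Z"
  shows "Ck_on 2 I X"
proof -
  have "Ck_on (Suc 0) I (\<lambda>t. h *\<^sub>R Y t)" for h :: real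
  proof (rule Ck_on_SucI[OF I])
    show "((\<lambda>t. h *\<^sub>R Y t) has_derivative (\<lambda>k. h *\<^sub>R (k *\<^sub>R Z t))) (at t)" if "t \<in> I" for t
      using Y[OF that] unfolding has_vector_derivative_def by (rule has_derivative_scaleR_right)
    show "Ck_on 0 I (\<lambda>t. h *\<^sub>R (v *\<^sub>R Z t))" for v
      using Z by (auto intro!: continuous_intros)
  qed
  then have "Ck_on (Suc 1) I X"
    using X unfolding has_vector_derivative_def by (intro Ck_on_SucI[OF I]) auto
  then show ?thesis by (metis Suc_1)
qed

context smooth_mfd
begin

lemma fiber_coords_randers:
  assumes "randers_data V (bilinear_coords M g c) (fiber_coords M \<omega> c)"
  shows "fiber_coords M (randers_function g \<omega>) c x u =
         randers_data.lagr (bilinear_coords M g c) (fiber_coords M \<omega> c) x u"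
  by (simp add: randers_data.lagr_def[OF assms] fiber_coords_def bilinear_coords_def randers_function_def)

lemma pullback_randers:
  "pullback_finsler M \<phi> (randers_function g \<omega>) =
   randers_function (pullback_bilinear M \<phi> g) (pullback_finsler M \<phi> \<omega>)"
  by (simp add: pullback_finsler_def randers_function_def pullback_bilinear_def fun_eq_iff)

text \<open>
  Solve the magnetic geodesic equation of \<open>\<phi>\<^sup>*F\<close> with initial point \<open>x\<close> and initial velocity \<open>v\<close>. The
  solution is a forward geodesic of \<open>\<phi>\<^sup>*F\<close>, hence of \<open>F\<close>, and so satisfies the Euler-Lagrange
  equations of both. Variations test these at interior times; continuity gives them at time 0,
  where they determine the acceleration up to a multiple of \<open>v\<close>.
\<close>

lemma projective_randers_data_chart:
  assumes g: "riemannian_metric M g" and \<omega>: "one_form M \<omega>"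
    and \<phi>: "projective_transformation M (randers_function g \<omega>) \<phi>"
    and c: "c \<in> atlas M" and d: "d \<in> atlas M"
  shows "projective_randers_data (loc_dom \<phi> c d) (bilinear_coords M g c) (fiber_coords M \<omega> c)
      (bilinear_coords M (pullback_bilinear M \<phi> g) c) (fiber_coords M (pullback_finsler M \<phi> \<omega>) c)"
proof -
  let ?V = "loc_dom \<phi> c d" and ?F = "randers_function g \<omega>"
  have diffeo: "diffeomorphism M \<phi>" and
    pe: "\<And>I \<gamma>. forward_geodesic M (pullback_finsler M \<phi> ?F) I \<gamma> \<Longrightarrow> forward_geodesic M ?F I \<gamma>"
    using \<phi> by (auto simp: projective_transformation_def projectively_equivalent_def)
  have smooth: "smooth_map M \<phi>" using diffeo by (simp add: diffeomorphism_def)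
  note V = loc_dom_subset[of \<phi> c d]
  have RA: "randers_data ?V (bilinear_coords M g c) (fiber_coords M \<omega> c)"
    by (rule randers_data_subset[OF randers_data_chart[OF g \<omega> c] open_loc_dom[OF smooth c d] V])
  have RB: "randers_data ?V (bilinear_coords M (pullback_bilinear M \<phi> g) c) (fiber_coords M (pullback_finsler M \<phi> \<omega>) c)"
    by (rule randers_data_pullback[OF diffeo c d g \<omega>])
  interpret A: randers_data ?V "bilinear_coords M g c" "fiber_coords M \<omega> c" by (rule RA)
  interpret B: randers_data ?V "bilinear_coords M (pullback_bilinear M \<phi> g) c" "fiber_coords M (pullback_finsler M \<phi> \<omega>) c"
    by (rule RB)
  note FA = fiber_coords_randers[OF RA]
  have FB: "fiber_coords M (pullback_finsler M \<phi> ?F) c x u = B.lagr x u" for x u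
    unfolding pullback_randers by (rule fiber_coords_randers[OF RB])
  have "\<exists>m. B.acc (B.speed x v) x v = A.acc (A.speed x v) x v + m *\<^sub>R v" if x: "x \<in> ?V" and v: "v \<noteq> 0" for x v
  proof -
    \<comment> \<open>the value of \<open>\<nu>\<close> for which the solution solves the Euler-Lagrange equation, its speed being conserved\<close>
    define \<nu> where "\<nu> = B.speed x v"
    have nv: "norm v > 0" using v by simp
    obtain \<rho> \<tau> C where ex: "\<rho> > 0" "\<tau> > 0" "C > 0" "cball x (2 * \<rho>) \<subseteq> ?V"
      "\<And>q u. q \<in> cball x \<rho> \<Longrightarrow> norm u \<le> norm v \<Longrightarrow> \<exists>X Y. X 0 = q \<and> Y 0 = u \<and> (\<forall>t\<in>{0..\<tau>}.
       X t \<in> cball x (2 * \<rho>) \<and> norm (Y t) \<le> norm v + 1 \<and> norm (B.acc \<nu> (X t) (Y t)) \<le> C \<and>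
       (X has_vector_derivative Y t) (at t within {0..\<tau>}) \<and>
       (Y has_vector_derivative B.acc \<nu> (X t) (Y t)) (at t within {0..\<tau>}))"
      by (rule B.magnetic_geodesics_exist[OF x nv, where \<nu>=\<nu>]) (rule that)
    obtain X Y where XY: "X 0 = x" "Y 0 = v"
      "\<And>t. t \<in> {0..\<tau>} \<Longrightarrow> X t \<in> cball x (2 * \<rho>)" "\<And>t. t \<in> {0..\<tau>} \<Longrightarrow> norm (Y t) \<le> norm v + 1"
      "\<And>t. t \<in> {0..\<tau>} \<Longrightarrow> (X has_vector_derivative Y t) (at t within {0..\<tau>})"
      "\<And>t. t \<in> {0..\<tau>} \<Longrightarrow> (Y has_vector_derivative B.acc \<nu> (X t) (Y t)) (at t within {0..\<tau>})"
      using ex(5)[of x v] ex(1) by auto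
    define Z where "Z = (\<lambda>t. B.acc \<nu> (X t) (Y t))"
    have XV: "X t \<in> ?V" if "t \<in> {0..\<tau>}" for t using XY(3)[OF that] ex(4) by blast
    have cX: "continuous_on {0..\<tau>} X" and cY: "continuous_on {0..\<tau>} Y"
      by (rule continuous_on_vector_derivative[OF XY(5)], assumption,
          rule continuous_on_vector_derivative[OF XY(6)], assumption)
    obtain L where L: "L-lipschitz_on (cball x (2 * \<rho>) \<times> cball 0 (norm v + 1)) (\<lambda>z. B.acc \<nu> (fst z) (snd z))"
      using B.acc_lipschitz[OF compact_cball convex_cball ex(4)] by blast
    have cZ: "continuous_on {0..\<tau>} Z"
    proof -
      have "continuous_on {0..\<tau>} (\<lambda>t. B.acc \<nu> (fst (X t, Y t)) (snd (X t, Y t)))"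
        by (rule continuous_on_compose2[OF lipschitz_on_continuous_on[OF L]])
          (use cX cY XY(3,4) in \<open>auto intro!: continuous_intros\<close>)
      then show ?thesis by (simp add: Z_def)
    qed
    have mem0: "0 \<in> {0..\<tau>}" using ex(2) by simp
    have G: "bilinear_coords M (pullback_bilinear M \<phi> g) c (X t) (Y t) (Y t) =
        bilinear_coords M (pullback_bilinear M \<phi> g) c x v v" if t: "t \<in> {0..\<tau>}" for t
      using B.speed_conserved[OF convex_closed_interval t mem0 XV XY(5) XY(6)] XY(1,2)
      by (simp add: convex_real_interval)
    then have sp: "B.speed (X t) (Y t) = \<nu>" if "t \<in> {0..\<tau>}" for t
      using that by (simp add: B.speed_def \<nu>_def)
    have "\<nu> > 0" unfolding \<nu>_def by (rule B.speed_pos[OF x v])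
    then have Y0: "Y t \<noteq> 0" if "t \<in> {0..\<tau>}" for t
      using sp[OF that] B.G_simps(10)[OF XV[OF that], of 0] by (auto simp: B.speed_def)
    have elB: "B.euler_lagrange (X t) (Y t) (Z t) w = 0" if "t \<in> {0..\<tau>}" for t w
      using B.euler_lagrange_acc[OF XV[OF that] Y0[OF that], of w] by (simp add: sp[OF that] Z_def)
    let ?I = "{0<..<\<tau>}"
    have sub: "t \<in> {0..\<tau>}" if "t \<in> ?I" for t using that by simp
    have dX: "(X has_vector_derivative Y t) (at t)" and dY: "(Y has_vector_derivative Z t) (at t)" if t: "t \<in> ?I" for t
      using XY(5,6)[OF sub[OF t]] t by (simp_all add: Z_def at_within_Icc_at)
    have C2: "Ck_on 2 ?I X"
      by (rule Ck_on_2_curve[OF _ dX dY]) (auto intro: continuous_on_subset[OF cZ])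
    define \<gamma> where "\<gamma> = (\<lambda>t. cinv c (X t))"
    have "forward_geodesic M (pullback_finsler M \<phi> ?F) ?I \<gamma>"
      by (rule forward_geodesic_of_euler_lagrange[OF c V RB FB, where x=X and y=Y and z=Z and p="\<tau> / 3" and q="\<tau> / 2"])
        (use ex(2) XV sub dX dY C2 Y0 elB in \<open>auto simp: \<gamma>_def is_interval_oo\<close>)
    then have fg: "forward_geodesic M ?F ?I \<gamma>" by (rule pe)
    have elA: "A.euler_lagrange (X t) (Y t) (Z t) w = 0" if t: "t \<in> ?I" for t w
    proof -
      obtain \<delta> where \<delta>: "\<delta> > 0" "\<And>a b. a \<in> ?I \<Longrightarrow> b \<in> ?I \<Longrightarrow> a \<le> b \<Longrightarrow> \<bar>a - t\<bar> < \<delta> \<Longrightarrow> \<bar>b - t\<bar> < \<delta> \<Longrightarrow> extremal M ?F a b \<gamma>"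
        using fg t unfolding forward_geodesic_def by metis
      show ?thesis
        by (rule euler_lagrange_of_extremal[OF c V RA FA open_greaterThanLessThan XV[OF sub] dX dY C2 _ Y0[OF sub] _ t \<delta>])
          (auto simp: \<gamma>_def intro: continuous_on_subset[OF cZ])
    qed
    have "A.euler_lagrange (X 0) (Y 0) (Z 0) w = 0" for w
    proof (rule continuous_constant_on_closure[of ?I "\<lambda>t. A.euler_lagrange (X t) (Y t) (Z t) w"])
      show "continuous_on (closure ?I) (\<lambda>t. A.euler_lagrange (X t) (Y t) (Z t) w)"
        using ex(2) A.continuous_on_euler_lagrange[OF XV Y0 cX cY cZ] by simp
      show "0 \<in> closure ?I" using ex(2) by simp
    qed (rule elA)
    then obtain m where "Z 0 = A.acc (A.speed x v) x v + m *\<^sub>R v"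
      using A.acc_of_euler_lagrange[OF x v, of "Z 0"] XY(1,2) by auto
    then show ?thesis by (auto simp: Z_def XY \<nu>_def)
  qed
  then show ?thesis
    by (intro projective_randers_data.intro RA RB projective_randers_data_axioms.intro)
qed

lemma proportional_iff_coords:
  assumes c: "c \<in> charts_at M p"
  shows "(\<forall>\<xi>\<in>tangent_space M p. \<forall>\<eta>\<in>tangent_space M p. h p \<xi> \<eta> = k * g p \<xi> \<eta>) \<longleftrightarrow>
         (\<forall>u v. bilinear_coords M h c (snd c p) u v = k * bilinear_coords M g c (snd c p) u v)"
proof -
  have p: "cinv c (snd c p) = p" using atlas_charts_at[OF c] by simp
  show ?thesis
    unfolding bilinear_coords_def p
    using tvec_tangent[OF c] tangent_eq_tvec[OF c] by metis
qed

text \<open>The set of points near which \<open>\<phi>\<^sup>*g = k g\<close> is open and closed, and a point where \<open>d\<omega> \<noteq> 0\<close> lies in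
  it for a suitable \<open>k\<close>.\<close>

context
  fixes g \<omega> \<phi>
  assumes g: "riemannian_metric M g" and \<omega>: "one_form M \<omega>"
    and \<phi>: "projective_transformation M (randers_function g \<omega>) \<phi>"
    and dim: "DIM('e) \<ge> 2"
begin

lemma projective_diffeo: "diffeomorphism M \<phi>"
  using \<phi> by (simp add: projective_transformation_def)

lemma projective_smooth: "smooth_map M \<phi>"
  using projective_diffeo by (simp add: diffeomorphism_def)

definition proportional_at :: "real \<Rightarrow> 'a \<Rightarrow> bool" where
  "proportional_at k p \<longleftrightarrow> (\<forall>\<xi>\<in>tangent_space M p. \<forall>\<eta>\<in>tangent_space M p.
     pullback_bilinear M \<phi> g p \<xi> \<eta> = k * g p \<xi> \<eta>)"

definition proportional_near :: "real \<Rightarrow> 'a \<Rightarrow> bool" where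
  "proportional_near k p \<longleftrightarrow> (\<exists>S. openin (mtop M) S \<and> p \<in> S \<and> (\<forall>q\<in>S. proportional_at k q))"

lemma proportional_at_coords:
  "c \<in> charts_at M p \<Longrightarrow> proportional_at k p \<longleftrightarrow>
     (\<forall>u v. bilinear_coords M (pullback_bilinear M \<phi> g) c (snd c p) u v = k * bilinear_coords M g c (snd c p) u v)"
  unfolding proportional_at_def by (rule proportional_iff_coords)

lemma proportional_near_of_ball:
  assumes c: "c \<in> charts_at M p" and r: "r > 0" "ball (snd c p) r \<subseteq> snd c ` fst c"
    and eq: "\<And>x u v. x \<in> ball (snd c p) r \<Longrightarrow>
      bilinear_coords M (pullback_bilinear M \<phi> g) c x u v = k * bilinear_coords M g c x u v"
  shows "proportional_near k p"
  unfolding proportional_near_def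
proof (intro exI conjI ballI)
  note ca = atlas_charts_at[OF c]
  show "openin (mtop M) {q \<in> fst c. snd c q \<in> ball (snd c p) r}"
    by (rule openin_chart_preimage[OF ca(1) open_ball])
  show "p \<in> {q \<in> fst c. snd c q \<in> ball (snd c p) r}" using ca r by simp
  fix q assume q: "q \<in> {q \<in> fst c. snd c q \<in> ball (snd c p) r}"
  then have "c \<in> charts_at M q" using ca by (intro charts_atI) auto
  from proportional_at_coords[OF this, of k] show "proportional_at k q" using eq q by simp
qed

lemma chart_pair:
  assumes "c \<in> charts_at M p"
  obtains d where "d \<in> charts_at M (\<phi> p)" "d \<in> atlas M" "snd c p \<in> loc_dom \<phi> c d"
proof -
  have "\<phi> p \<in> points M" using smooth_map_points[OF projective_smooth charts_at_points[OF assms]] .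
  then obtain d where "d \<in> charts_at M (\<phi> p)" using points_covered by blast
  then show thesis using that[of d] atlas_charts_at[of d] atlas_charts_at[OF assms] by (auto simp: loc_dom_def)
qed

text \<open>\<open>d\<omega> \<noteq> 0\<close> in a ball, which is where the metrics are conformal, with a constant factor.\<close>

lemma proportional_near_where_not_closed:
  assumes c: "c \<in> atlas M" and x: "x \<in> snd c ` fst c" and uv: "ext_deriv_coords M \<omega> c x u v \<noteq> 0"
  shows "\<exists>k>0. proportional_near k (cinv c x)"
proof -
  note cp = chart_point[OF c x]
  obtain d where d: "d \<in> atlas M" "x \<in> loc_dom \<phi> c d" using chart_pair[OF cp(1)] cp(3) by metis
  interpret P: projective_randers_data "loc_dom \<phi> c d" "bilinear_coords M g c" "fiber_coords M \<omega> c"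
    "bilinear_coords M (pullback_bilinear M \<phi> g) c" "fiber_coords M (pullback_finsler M \<phi> \<omega>) c"
    by (rule projective_randers_data_chart[OF g \<omega> \<phi> c d(1)])
  have dW: "P.A.dW y u v = ext_deriv_coords M \<omega> c y u v" for y
    by (simp add: P.A.dW_def P.A.DW_def ext_deriv_coords_def)
  have "continuous_on (loc_dom \<phi> c d) (\<lambda>y. P.A.dW y u v)"
    unfolding P.A.dW_def using Ck_on_continuous[OF P.A.C1_DW] by (intro continuous_intros)
  then have "open (loc_dom \<phi> c d \<inter> (\<lambda>y. P.A.dW y u v) -` (- {0}))"
    by (intro continuous_open_preimage P.A.open_U) auto
  moreover have "x \<in> loc_dom \<phi> c d \<inter> (\<lambda>y. P.A.dW y u v) -` (- {0})" using d(2) uv dW by simp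
  ultimately obtain r where r: "r > 0" "ball x r \<subseteq> loc_dom \<phi> c d \<inter> (\<lambda>y. P.A.dW y u v) -` (- {0})"
    using open_contains_ball by blast
  have "\<exists>f>0. \<forall>a b. bilinear_coords M (pullback_bilinear M \<phi> g) c y a b = f * bilinear_coords M g c y a b"
    if "y \<in> ball x r" for y
    by (rule P.conformal_where_not_closed[of y u v]) (use r(2) that in auto)
  then obtain k where k: "k > 0" "\<And>y a b. y \<in> ball x r \<Longrightarrow>
      bilinear_coords M (pullback_bilinear M \<phi> g) c y a b = k * bilinear_coords M g c y a b"
    using P.conformal_factor_constant[OF dim _ r(1)] r(2) by (metis le_inf_iff)
  have "ball x r \<subseteq> snd c ` fst c" using r(2) loc_dom_subset by blast
  then have "proportional_near k (cinv c x)"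
    using proportional_near_of_ball[OF cp(1) r(1)] k(2) unfolding cp(3) by blast
  then show ?thesis using k(1) by blast
qed

lemma proportional_near_closed:
  assumes k: "k > 0" and p: "p \<in> points M"
    and cl: "\<And>S. openin (mtop M) S \<Longrightarrow> p \<in> S \<Longrightarrow> \<exists>q\<in>S. proportional_near k q"
  shows "proportional_near k p"
proof -
  obtain c where c: "c \<in> charts_at M p" using points_covered[OF p] by blast
  note ca = atlas_charts_at[OF c]
  obtain d where d: "d \<in> atlas M" "snd c p \<in> loc_dom \<phi> c d" using chart_pair[OF c] by metis
  interpret P: projective_randers_data "loc_dom \<phi> c d" "bilinear_coords M g c" "fiber_coords M \<omega> c"
    "bilinear_coords M (pullback_bilinear M \<phi> g) c" "fiber_coords M (pullback_finsler M \<phi> \<omega>) c"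
    by (rule projective_randers_data_chart[OF g \<omega> \<phi> ca(1) d(1)])
  let ?eq = "\<lambda>x. \<forall>u v. bilinear_coords M (pullback_bilinear M \<phi> g) c x u v = k * bilinear_coords M g c x u v"
  have "\<exists>r>0. ball (snd c p) r \<subseteq> loc_dom \<phi> c d \<and> (\<forall>x\<in>ball (snd c p) r. ?eq x)"
  proof (rule P.proportionality_unique_continuation[OF dim d(2) k])
    fix e :: real assume e: "e > 0"
    let ?S = "{q \<in> fst c. snd c q \<in> ball (snd c p) e \<inter> loc_dom \<phi> c d}"
    have "openin (mtop M) ?S" by (rule openin_chart_preimage[OF ca(1) open_Int[OF open_ball P.A.open_U]])
    moreover have "p \<in> ?S" using ca(2) d(2) e by simp
    ultimately obtain q where q: "q \<in> ?S" "proportional_near k q" using cl by blast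
    then obtain T where T: "openin (mtop M) T" "q \<in> T" "\<And>q'. q' \<in> T \<Longrightarrow> proportional_at k q'"
      unfolding proportional_near_def by blast
    have "open (snd c ` (T \<inter> fst c))" by (rule open_chart_image[OF ca(1) openin_Int[OF T(1) openin_chart[OF ca(1)]]]) simp
    then have "open (snd c ` (T \<inter> fst c) \<inter> loc_dom \<phi> c d)" using P.A.open_U by (rule open_Int)
    moreover have "snd c q \<in> snd c ` (T \<inter> fst c) \<inter> loc_dom \<phi> c d" using q(1) T(2) by blast
    ultimately obtain r where r: "r > 0" "ball (snd c q) r \<subseteq> snd c ` (T \<inter> fst c) \<inter> loc_dom \<phi> c d"
      using open_contains_ball by blast
    have "?eq x" if x: "x \<in> ball (snd c q) r" for x
    proof -
      obtain q' where q': "q' \<in> T" "q' \<in> fst c" "x = snd c q'" using x r(2) by blast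
      have "c \<in> charts_at M q'" by (rule charts_atI[OF ca(1) q'(2)])
      from proportional_at_coords[OF this, of k] show ?thesis using T(3)[OF q'(1)] unfolding q'(3) by blast
    qed
    then show "\<exists>y r. r > 0 \<and> y \<in> ball (snd c p) e \<and> ball y r \<subseteq> loc_dom \<phi> c d \<and> (\<forall>x\<in>ball y r. ?eq x)"
      using q(1) r by (intro exI[of _ "snd c q"] exI[of _ r]) auto
  qed
  then obtain r where r: "r > 0" "ball (snd c p) r \<subseteq> loc_dom \<phi> c d" "\<And>x. x \<in> ball (snd c p) r \<Longrightarrow> ?eq x" by blast
  show ?thesis
    by (rule proportional_near_of_ball[OF c r(1)]) (use r(2,3) loc_dom_subset in blast)+
qed

lemma proportional_everywhere:
  assumes conn: "connected_space (mtop M)" and nc: "\<not> closed_form M \<omega>"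
  obtains k where "k > 0" "\<And>p. p \<in> points M \<Longrightarrow> proportional_at k p"
proof -
  obtain c x u v where c: "c \<in> atlas M" "x \<in> snd c ` fst c" "ext_deriv_coords M \<omega> c x u v \<noteq> 0"
    using nc unfolding closed_form_def by blast
  from proportional_near_where_not_closed[OF this] obtain k where k: "k > 0" "proportional_near k (cinv c x)" by blast
  define T where "T = {p \<in> points M. proportional_near k p}"
  have "openin (mtop M) T"
  proof (subst openin_subopen, intro ballI)
    fix p assume "p \<in> T"
    then obtain S where S: "openin (mtop M) S" "p \<in> S" "\<forall>q\<in>S. proportional_at k q"
      unfolding T_def proportional_near_def by blast
    then have "S \<subseteq> T" using openin_subset[OF S(1)] unfolding T_def proportional_near_def by blast
    then show "\<exists>S. openin (mtop M) S \<and> p \<in> S \<and> S \<subseteq> T" using S by blast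
  qed
  moreover have "openin (mtop M) (points M - T)"
  proof (subst openin_subopen, intro ballI)
    fix p assume p: "p \<in> points M - T"
    then have "\<not> proportional_near k p" by (simp add: T_def)
    then obtain S where S: "openin (mtop M) S" "p \<in> S" "\<And>q. q \<in> S \<Longrightarrow> \<not> proportional_near k q"
      using proportional_near_closed[OF k(1), of p] p by blast
    then have "S \<subseteq> points M - T" using openin_subset[OF S(1)] by (auto simp: T_def)
    then show "\<exists>S. openin (mtop M) S \<and> p \<in> S \<and> S \<subseteq> points M - T" using S by blast
  qed
  then have "closedin (mtop M) T" by (simp add: closedin_def T_def)
  moreover have "cinv c x \<in> T" using k(2) chart_point(2)[OF c(1,2)] by (simp add: T_def)
  ultimately have "T = points M" using conn unfolding connected_space_clopen_in by blast
  then have "proportional_at k p" if "p \<in> points M" for p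
    using that unfolding T_def proportional_near_def by blast
  then show thesis using that k(1) by blast
qed


section \<open>The compact case\<close>

text \<open>The \<open>g\<close>-norm of \<open>d\<omega>\<close> at \<open>p\<close> is at most \<open>C\<close>. Upper bounds serve in place of the norm, which would be
  a supremum.\<close>

definition ext_deriv_bound :: "real \<Rightarrow> ('a, 'e) chart \<Rightarrow> 'a \<Rightarrow> bool" where
  "ext_deriv_bound C c p \<longleftrightarrow> (\<forall>u v. \<bar>ext_deriv_coords M \<omega> c (snd c p) u v\<bar> \<le>
     C * (sqrt (bilinear_coords M g c (snd c p) u u) * sqrt (bilinear_coords M g c (snd c p) v v)))"

text \<open>On a compact ball in the chart, the coefficients of \<open>d\<omega>\<close> are bounded and \<open>g\<close> is coercive.\<close>

lemma ext_deriv_bound_near: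
  assumes c: "c \<in> charts_at M p"
  shows "\<exists>S C. openin (mtop M) S \<and> p \<in> S \<and> C \<ge> 0 \<and> (\<forall>q\<in>S. c \<in> charts_at M q \<and> ext_deriv_bound C c q)"
proof -
  note ca = atlas_charts_at[OF c]
  interpret A: randers_data "snd c ` fst c" "bilinear_coords M g c" "fiber_coords M \<omega> c"
    by (rule randers_data_chart[OF g \<omega> ca(1)])
  have x: "snd c p \<in> snd c ` fst c" using ca(2) by blast
  obtain r where r: "r > 0" "cball (snd c p) r \<subseteq> snd c ` fst c"
    using A.open_U x open_contains_cball by blast
  let ?K = "cball (snd c p) r"
  have "\<exists>B\<ge>0. \<forall>y\<in>?K. \<bar>A.dW y i j\<bar> \<le> B" for i j
  proof -
    have "continuous_on ?K (\<lambda>y. A.dW y i j)"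
      unfolding A.dW_def using continuous_on_subset[OF Ck_on_continuous[OF A.C1_DW] r(2)] by (intro continuous_intros)
    then have "bounded ((\<lambda>y. A.dW y i j) ` ?K)"
      using compact_continuous_image compact_cball compact_imp_bounded by blast
    then obtain B where "\<forall>y\<in>?K. \<bar>A.dW y i j\<bar> \<le> B" unfolding bounded_iff by auto
    then show ?thesis by (intro exI[of _ "\<bar>B\<bar>"]) force
  qed
  then obtain B where B: "\<And>i j. B i j \<ge> 0" "\<And>i j y. y \<in> ?K \<Longrightarrow> \<bar>A.dW y i j\<bar> \<le> B i j" by metis
  define b where "b = (\<Sum>i\<in>(Basis :: 'e set). \<Sum>j\<in>(Basis :: 'e set). B i j)"
  have b0: "b \<ge> 0" using B(1) by (simp add: b_def sum_nonneg)
  have dW: "\<bar>A.dW y u v\<bar> \<le> b * (norm u * norm v)" if y: "y \<in> ?K" for y u v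
  proof -
    have yc: "y \<in> snd c ` fst c" using y r(2) by blast
    have "A.dW y u v = (\<Sum>i\<in>Basis. \<Sum>j\<in>Basis. (u \<bullet> i) * (v \<bullet> j) * A.dW y i j)"
      by (rule bilinear_expand[OF A.linear_dW(1)[OF yc] A.linear_dW(2)[OF yc]])
    also have "\<bar>\<dots>\<bar> \<le> (\<Sum>i\<in>Basis. \<Sum>j\<in>Basis. \<bar>(u \<bullet> i) * (v \<bullet> j) * A.dW y i j\<bar>)"
      by (rule order_trans[OF sum_abs sum_mono[OF sum_abs]])
    also have "\<dots> \<le> (\<Sum>i\<in>Basis. \<Sum>j\<in>Basis. (norm u * norm v) * B i j)"
      unfolding abs_mult using B(2)[OF y] by (intro sum_mono mult_mono Basis_le_norm) auto
    also have "\<dots> = b * (norm u * norm v)" by (simp add: b_def sum_distrib_left mult_ac)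
    finally show ?thesis .
  qed
  obtain m where m: "m > 0" "\<And>y v. y \<in> ?K \<Longrightarrow> m * (norm v)\<^sup>2 \<le> bilinear_coords M g c y v v"
    using A.coercive_on_compact[OF compact_cball r(2)] by blast
  have nv: "norm v \<le> sqrt (bilinear_coords M g c y v v) / sqrt m" if "y \<in> ?K" for y v
  proof -
    have "sqrt m * norm v = sqrt (m * (norm v)\<^sup>2)" using m(1) by (simp add: real_sqrt_mult)
    also have "\<dots> \<le> sqrt (bilinear_coords M g c y v v)" using m(2)[OF that] by (rule real_sqrt_le_mono)
    finally show ?thesis using m(1) by (simp add: field_simps)
  qed
  let ?S = "{q \<in> fst c. snd c q \<in> ball (snd c p) r}"
  have "ext_deriv_bound (b / m) c q" if q: "q \<in> ?S" for q
    unfolding ext_deriv_bound_def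
  proof (intro allI)
    fix u v
    let ?n = "\<lambda>v. sqrt (bilinear_coords M g c (snd c q) v v)"
    have y: "snd c q \<in> ?K" using q by simp
    have "\<bar>A.dW (snd c q) u v\<bar> \<le> b * (norm u * norm v)" by (rule dW[OF y])
    also have "\<dots> \<le> b * ((?n u / sqrt m) * (?n v / sqrt m))"
      using nv[OF y] b0 by (intro mult_left_mono mult_mono order_trans[OF norm_ge_zero nv[OF y]]) auto
    also have "\<dots> = b / m * (?n u * ?n v)" using m(1) real_sqrt_mult_self[of m] by (simp add: field_simps)
    finally show "\<bar>ext_deriv_coords M \<omega> c (snd c q) u v\<bar> \<le> b / m * (?n u * ?n v)"
      by (simp add: A.dW_def A.DW_def ext_deriv_coords_def)
  qed
  moreover have "openin (mtop M) ?S" by (rule openin_chart_preimage[OF ca(1) open_ball])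
  moreover have "p \<in> ?S" using ca(2) r(1) by simp
  moreover have "c \<in> charts_at M q" if "q \<in> ?S" for q using that ca(1) by (intro charts_atI) auto
  moreover have "b / m \<ge> 0" using b0 m(1) by simp
  ultimately show ?thesis by blast
qed

lemma ext_deriv_bounded_of_compact:
  assumes "compact_space (mtop M)"
  shows "\<exists>C\<ge>0. \<forall>p\<in>points M. \<exists>c\<in>charts_at M p. ext_deriv_bound C c p"
proof -
  define \<U> where "\<U> = {S. openin (mtop M) S \<and> (\<exists>C\<ge>0. \<forall>q\<in>S. \<exists>c\<in>charts_at M q. ext_deriv_bound C c q)}"
  have "points M \<subseteq> \<Union>\<U>"
  proof
    fix p assume "p \<in> points M"
    then obtain c where "c \<in> charts_at M p" using points_covered by blast
    from ext_deriv_bound_near[OF this] show "p \<in> \<Union>\<U>" unfolding \<U>_def by blast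
  qed
  moreover have "\<forall>S\<in>\<U>. openin (mtop M) S" by (simp add: \<U>_def)
  ultimately obtain \<F> where \<F>: "finite \<F>" "\<F> \<subseteq> \<U>" "points M \<subseteq> \<Union>\<F>"
    using assms unfolding compact_space_def compactin_def by metis
  have "\<forall>S\<in>\<F>. \<exists>C\<ge>0. \<forall>q\<in>S. \<exists>c\<in>charts_at M q. ext_deriv_bound C c q" using \<F>(2) unfolding \<U>_def by blast
  then obtain C where C: "\<And>S. S \<in> \<F> \<Longrightarrow> C S \<ge> 0"
    "\<And>S q. S \<in> \<F> \<Longrightarrow> q \<in> S \<Longrightarrow> \<exists>c\<in>charts_at M q. ext_deriv_bound (C S) c q" by metis
  have mono: "ext_deriv_bound C2 c p" if "ext_deriv_bound C1 c p" "C1 \<le> C2" "c \<in> charts_at M p" for C1 C2 c p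
    unfolding ext_deriv_bound_def
  proof (intro allI)
    fix u v
    have "inner_form (bilinear_coords M g c (snd c p))"
      using randers_data.inner_G[OF randers_data_chart[OF g \<omega> atlas_charts_at(1)[OF that(3)]]]
        atlas_charts_at[OF that(3)] by blast
    from form_nonneg[OF this]
    have "C1 * (sqrt (bilinear_coords M g c (snd c p) u u) * sqrt (bilinear_coords M g c (snd c p) v v))
       \<le> C2 * (sqrt (bilinear_coords M g c (snd c p) u u) * sqrt (bilinear_coords M g c (snd c p) v v))"
      by (intro mult_right_mono that(2)) simp
    then show "\<bar>ext_deriv_coords M \<omega> c (snd c p) u v\<bar> \<le>
       C2 * (sqrt (bilinear_coords M g c (snd c p) u u) * sqrt (bilinear_coords M g c (snd c p) v v))"
      using that(1) order_trans unfolding ext_deriv_bound_def by blast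
  qed
  have "\<exists>c\<in>charts_at M p. ext_deriv_bound (\<Sum>S\<in>\<F>. C S) c p" if p: "p \<in> points M" for p
  proof -
    obtain S where S: "S \<in> \<F>" "p \<in> S" using p \<F>(3) by blast
    have "C S \<le> (\<Sum>S\<in>\<F>. C S)" using C(1) \<F>(1) S(1) by (intro member_le_sum) auto
    then show ?thesis using C(2)[OF S] mono by blast
  qed
  moreover have "(\<Sum>S\<in>\<F>. C S) \<ge> 0" by (rule sum_nonneg) (rule C(1))
  ultimately show ?thesis by blast
qed

text \<open>
  The homothety constant \<open>k\<close> of \<open>g\<close> forces \<open>\<phi>\<^sup>*d\<omega> = sqrt k d\<omega>\<close>, so the \<open>g\<close>-norm of \<open>d\<omega>\<close> is scaled
  by \<open>1 / sqrt k\<close> when passing from \<open>p\<close> to \<open>\<phi> p\<close>.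
\<close>

lemma ext_deriv_bound_transfer:
  assumes k: "k > 0" and proportional: "proportional_at k p"
    and c: "c \<in> charts_at M p" and d: "d \<in> charts_at M (\<phi> p)"
  shows "ext_deriv_bound C d (\<phi> p) \<longleftrightarrow> ext_deriv_bound (sqrt k * C) c p"
proof -
  note ca = atlas_charts_at[OF c] and da = atlas_charts_at[OF d]
  let ?x = "snd c p" and ?y = "snd d (\<phi> p)" and ?D = "Dloc \<phi> c d (snd c p)"
  have x: "?x \<in> loc_dom \<phi> c d" using ca da by (auto simp: loc_dom_def)
  have fx: "loc \<phi> c d ?x = ?y" using ca by (simp add: loc_def)
  interpret P: projective_randers_data "loc_dom \<phi> c d" "bilinear_coords M g c" "fiber_coords M \<omega> c"
    "bilinear_coords M (pullback_bilinear M \<phi> g) c" "fiber_coords M (pullback_finsler M \<phi> \<omega>) c"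
    by (rule projective_randers_data_chart[OF g \<omega> \<phi> ca(1) da(1)])
  have eq: "bilinear_coords M (pullback_bilinear M \<phi> g) c ?x u v = k * bilinear_coords M g c ?x u v" for u v
    using proportional unfolding proportional_at_coords[OF c] by blast
  have gd: "bilinear_coords M g d ?y (?D u) (?D v) = k * bilinear_coords M g c ?x u v" for u v
    using pullback_bilinear_coords[OF projective_diffeo ca(1) da(1) x, of g u v] eq fx by simp
  have wd: "ext_deriv_coords M \<omega> d ?y (?D u) (?D v) = sqrt k * ext_deriv_coords M \<omega> c ?x u v" for u v
  proof -
    have "ext_deriv_coords M \<omega> d ?y (?D u) (?D v) = ext_deriv_coords M (pullback_finsler M \<phi> \<omega>) c ?x u v"
      using ext_deriv_pullback[OF projective_diffeo ca(1) da(1) g \<omega> x] fx by simp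
    also have "\<dots> = P.B.dW ?x u v" by (simp add: P.B.dW_def P.B.DW_def ext_deriv_coords_def)
    also have "\<dots> = sqrt k * P.A.dW ?x u v" by (rule P.dW_of_proportional[OF x k eq])
    finally show ?thesis by (simp add: P.A.dW_def P.A.DW_def ext_deriv_coords_def)
  qed
  have lin: "linear ?D" by (rule linear_Dloc[OF projective_smooth ca(1) da(1) x])
  have "inj ?D" unfolding linear_injective_0[OF lin]
    using Dloc_nonzero_coords[OF projective_diffeo ca(1) da(1) x] by blast
  then have "surj ?D" using eucl.linear_inj_imp_surj[OF lin] by blast
  then have all: "(\<forall>u v. Q u v) \<longleftrightarrow> (\<forall>u v. Q (?D u) (?D v))" for Q
    by (metis surjD)
  have rescale: "\<bar>sqrt k * e\<bar> \<le> C * (sqrt (k * a) * sqrt (k * b)) \<longleftrightarrow>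
      sqrt k * \<bar>e\<bar> \<le> sqrt k * (sqrt k * C * (sqrt a * sqrt b))" for a b e
  proof -
    have "C * (sqrt (k * a) * sqrt (k * b)) = sqrt k * (sqrt k * C * (sqrt a * sqrt b))"
      by (simp only: real_sqrt_mult mult_ac)
    moreover have "\<bar>sqrt k * e\<bar> = sqrt k * \<bar>e\<bar>" using k by (simp add: abs_mult)
    ultimately show ?thesis by (simp only:)
  qed
  have "ext_deriv_bound C d (\<phi> p) \<longleftrightarrow> (\<forall>u v. \<bar>ext_deriv_coords M \<omega> d ?y (?D u) (?D v)\<bar> \<le>
      C * (sqrt (bilinear_coords M g d ?y (?D u) (?D u)) * sqrt (bilinear_coords M g d ?y (?D v) (?D v))))"
    unfolding ext_deriv_bound_def by (rule all)
  also have "\<dots> \<longleftrightarrow> (\<forall>u v. sqrt k * \<bar>ext_deriv_coords M \<omega> c ?x u v\<bar> \<le>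
      sqrt k * (sqrt k * C * (sqrt (bilinear_coords M g c ?x u u) * sqrt (bilinear_coords M g c ?x v v))))"
    unfolding gd wd rescale ..
  also have "\<dots> \<longleftrightarrow> ext_deriv_bound (sqrt k * C) c p"
    unfolding ext_deriv_bound_def using k by (simp only: mult_le_cancel_left_pos real_sqrt_gt_zero)
  finally show ?thesis .
qed

text \<open>If \<open>k \<noteq> 1\<close>, then one step along \<open>\<phi>\<close> or backwards along \<open>\<phi>\<close> improves a global bound of the norm
  of \<open>d\<omega>\<close> by a factor \<open>q < 1\<close>. Iterating gives \<open>d\<omega> = 0\<close>.\<close>

lemma homothety_constant_of_compact:
  assumes comp: "compact_space (mtop M)" and nc: "\<not> closed_form M \<omega>" and k: "k > 0"
    and proportional: "\<And>p. p \<in> points M \<Longrightarrow> proportional_at k p"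
  shows "k = 1"
proof (rule ccontr)
  assume k1: "k \<noteq> 1"
  define q where "q = (if k < 1 then sqrt k else 1 / sqrt k)"
  have q: "0 \<le> q" "q < 1" using k k1 by (auto simp: q_def)
  have bij: "bij_betw \<phi> (points M) (points M)" using projective_diffeo by (simp add: diffeomorphism_def)
  have step: "ext_deriv_bound (q * C) c p"
    if C: "\<And>p. p \<in> points M \<Longrightarrow> \<exists>c\<in>charts_at M p. ext_deriv_bound C c p" and c: "c \<in> charts_at M p" for C c p
  proof (cases "k < 1")
    case True
    have p: "p \<in> points M" by (rule charts_at_points[OF c])
    obtain d where d: "d \<in> charts_at M (\<phi> p)" "ext_deriv_bound C d (\<phi> p)"
      using C smooth_map_points[OF projective_smooth p] by blast
    show ?thesis using ext_deriv_bound_transfer[OF k proportional[OF p] c d(1), of C] d(2) True by (simp add: q_def)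
  next
    case False
    have p: "p \<in> points M" by (rule charts_at_points[OF c])
    obtain p' where p': "p' \<in> points M" "p = \<phi> p'" using bij p unfolding bij_betw_def by blast
    obtain b where b: "b \<in> charts_at M p'" "ext_deriv_bound C b p'" using C[OF p'(1)] by blast
    have e: "sqrt k * (q * C) = C" using k False by (simp add: q_def)
    show ?thesis
      using ext_deriv_bound_transfer[OF k proportional[OF p'(1)] b(1), of c "q * C"] c b(2) p'(2)
      unfolding e by simp
  qed
  obtain C where C: "\<And>p. p \<in> points M \<Longrightarrow> \<exists>c\<in>charts_at M p. ext_deriv_bound C c p"
    using ext_deriv_bounded_of_compact[OF comp] by blast
  have all: "ext_deriv_bound (q ^ Suc n * C) c p" if "c \<in> charts_at M p" for n c p
    using that
  proof (induction n arbitrary: c p)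
    case 0 then show ?case using step[OF C] by simp
  next
    case (Suc n)
    have "ext_deriv_bound (q * (q ^ Suc n * C)) c p"
      by (rule step[OF _ Suc.prems]) (use points_covered Suc.IH in blast)
    then show ?case by (simp add: mult_ac)
  qed
  obtain c x u v where c: "c \<in> atlas M" "x \<in> snd c ` fst c" "ext_deriv_coords M \<omega> c x u v \<noteq> 0"
    using nc unfolding closed_form_def by blast
  note cp = chart_point[OF c(1,2)]
  define s where "s = C * (sqrt (bilinear_coords M g c x u u) * sqrt (bilinear_coords M g c x v v))"
  have le: "\<bar>ext_deriv_coords M \<omega> c x u v\<bar> \<le> q ^ Suc n * s" for n
    using all[OF cp(1), of n] unfolding ext_deriv_bound_def cp(3) by (simp add: s_def mult_ac)
  have "(\<lambda>n. q ^ Suc n * s) \<longlonglongrightarrow> 0 * s"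
    by (intro tendsto_mult LIMSEQ_Suc[OF LIMSEQ_realpow_zero] q tendsto_const)
  then have "\<bar>ext_deriv_coords M \<omega> c x u v\<bar> \<le> 0"
    using le by (intro LIMSEQ_le_const[where X="\<lambda>n. q ^ Suc n * s"]) auto
  then show False using c(3) by simp
qed

end

end

section \<open>Projective transformations are homotheties\<close>

theorem corollary1:
  fixes M :: "('a, 'e::euclidean_space) manifold"
    and g :: "('a, 'e) bilinear_field"
    and \<omega> :: "('a, 'e) covector_field"
  assumes "smooth_manifold M"
    and "connected_space (mtop M)"
    and "DIM('e) \<ge> 2"
    and "riemannian_metric M g"
    and "one_form M \<omega>"
    and "finsler_metric M (randers_function g \<omega>)"
    and "\<not> closed_form M \<omega>"
  shows "(\<forall>\<phi>. projective_transformation M (randers_function g \<omega>) \<phi> \<longrightarrow> homothety M g \<phi>) \<and>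
         (compact_space (mtop M) \<longrightarrow>
           (\<forall>\<phi>. projective_transformation M (randers_function g \<omega>) \<phi> \<longrightarrow> isometry M g \<phi>))"
proof -
  interpret smooth_mfd M by unfold_locales (rule assms(1))
  have main: "homothety M g \<phi> \<and> (compact_space (mtop M) \<longrightarrow> isometry M g \<phi>)"
    if \<phi>: "projective_transformation M (randers_function g \<omega>) \<phi>" for \<phi>
  proof -
    note ctxt = assms(4,5) \<phi> assms(3)
    obtain k where k: "k > 0" "\<And>p. p \<in> points M \<Longrightarrow> proportional_at g \<phi> k p"
      by (rule proportional_everywhere[OF ctxt assms(2,7)]) (rule that)
    have "homothety M g \<phi>"
      unfolding homothety_def using k projective_diffeo[OF ctxt]
      unfolding proportional_at_def[OF ctxt] by blast
    moreover have "isometry M g \<phi>" if comp: "compact_space (mtop M)"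
    proof -
      have "k = 1" by (rule homothety_constant_of_compact[OF ctxt comp assms(7) k])
      then show ?thesis
        unfolding isometry_def using k(2) projective_diffeo[OF ctxt]
        unfolding proportional_at_def[OF ctxt] by simp
    qed
    ultimately show ?thesis by blast
  qed
  then show ?thesis by blast
qed

end
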